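(* There exist universal constants $c>0$ and $C<\infty$ such that for all $h\ge 0$ and all integers $N\ge 2$, $$\mathbb P\big[0\overset{\widetilde\varphi_N\ge h}{\longleftrightarrow}\partial_iB_N\big]\le C(\log N)^{-1}N^{-ch^2}.$$
   Context: Notation: for $x\in\mathbb Z^2$, $|x|_\infty$ is the sup norm; for real $r\ge0$, $B_r:=\{x\in\mathbb Z^2:|x|_\infty\le r\}$. Vertices $x,y\in\mathbb Z^2$ are neighbours, $x\sim y$, if their Euclidean distance is $1$. For $A\subset\mathbb Z^2$, $\partial_iA:=\{x\in A:\exists y\notin A,\ x\sim y\}$ (inner boundary). For $A\subset\mathbb Z^2$, $\widetilde A$ is the metric graph obtained from $A$ by joining each pair of neighbouring vertices of $A$ by a line segment of length $2$. Discrete Gaussian free field (GFF): $\varphi_N=(\varphi_{N,x})_{x\in B_{N+1}}$ is the centred Gaussian field with $\varphi_{N,x}=0$ for $x\in\partial_iB_{N+1}$ and covariance $G_{B_N}(x,y)$ for $x,y\in B_N$, where $G_{B_N}(x,y)$ is the expected number of visits to $y$ by simple random walk on $\mathbb Z^2$ started at $x$ before exiting $B_N$. Metric-graph GFF with Dirichlet boundary conditions: $\widetilde\varphi_N$ is the continuous centred Gaussian field on $\widetilde B_{N+1}$, vanishing on $\partial_iB_{N+1}$ and on the segments joining vertices of $\partial_i B_{N+1}$, whose covariance is the Green's function of Brownian motion on the metric graph killed on the boundary. Equivalently, its restriction to $B_{N+1}$ is $\varphi_N$ and, conditionally on $\varphi_N$, the values on the remaining edges are independent bridges of length $2$ of $\sqrt2$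 times a standard Brownian motion, with endpoint values given by $\varphi_N$. The event $\{A_1\overset{\widetilde\varphi_N\ge h}{\longleftrightarrow}A_2\}$ means that some connected component of $\{x\in\widetilde B_{N+1}:\widetilde\varphi_{N,x}\ge h\}$ intersects both $A_1$ and $A_2$; $0$ stands for $\{0\}$. *)

theory Defs
  imports "HOL-Probability.Probability"
begin

section \<open>The square lattice\<close>

type_synonym vertex = "int \<times> int"

definition pt :: "vertex \<Rightarrow> real \<times> real" where
  "pt x = (real_of_int (fst x), real_of_int (snd x))"

definition sup_norm :: "vertex \<Rightarrow> int" where
  "sup_norm x = max \<bar>fst x\<bar> \<bar>snd x\<bar>"

definition B :: "real \<Rightarrow> vertex set" where
  "B r = {x. real_of_int (sup_norm x) \<le> r}"

definition nbr :: "vertex \<Rightarrow> vertex \<Rightarrow> bool" where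
  "nbr x y \<longleftrightarrow> dist (pt x) (pt y) = 1"

definition inner_boundary :: "vertex set \<Rightarrow> vertex set" where
  "inner_boundary A = {x \<in> A. \<exists>y. y \<notin> A \<and> nbr x y}"


section \<open>Simple random walk and its killed Green's function\<close>

definition srw_steps :: "(nat \<Rightarrow> vertex) measure" where
  "srw_steps = PiM UNIV (\<lambda>_. measure_pmf (pmf_of_set {(1, 0), (-1, 0), (0, 1), (0, -1)}))"

definition walk :: "vertex \<Rightarrow> (nat \<Rightarrow> vertex) \<Rightarrow> nat \<Rightarrow> vertex" where
  "walk x \<xi> n = x + (\<Sum>i<n. \<xi> i)"

definition visits_before_exit :: "vertex set \<Rightarrow> vertex \<Rightarrow> vertex \<Rightarrow> (nat \<Rightarrow> vertex) \<Rightarrow> ennreal" where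
  "visits_before_exit A x y \<xi> =
     emeasure (count_space UNIV) {n. walk x \<xi> n = y \<and> (\<forall>k\<le>n. walk x \<xi> k \<in> A)}"

text \<open>For finite \<open>A\<close> the expectation is finite, so \<^const>\<open>enn2real\<close> loses nothing.\<close>

definition green :: "vertex set \<Rightarrow> vertex \<Rightarrow> vertex \<Rightarrow> real" where
  "green A x y = enn2real (\<integral>\<^sup>+ \<xi>. visits_before_exit A x y \<xi> \<partial>srw_steps)"


section \<open>Gaussian fields and Brownian bridges\<close>

text \<open>The case \<open>\<sigma> = 0\<close> is the point mass; \<^const>\<open>normal_density\<close> is only meaningful for
  \<open>\<sigma> > 0\<close>.\<close>

definition normal_law :: "real \<Rightarrow> real \<Rightarrow> real measure" where
  "normal_law \<mu> \<sigma> =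
     (if \<sigma> = 0 then return borel \<mu> else density lborel (\<lambda>x. ennreal (normal_density \<mu> \<sigma> x)))"

definition centred_gaussian_field ::
  "'w measure \<Rightarrow> 'i set \<Rightarrow> ('i \<Rightarrow> 'w \<Rightarrow> real) \<Rightarrow> bool" where
  "centred_gaussian_field M I X \<longleftrightarrow>
     (\<forall>i\<in>I. X i \<in> borel_measurable M) \<and>
     (\<forall>J a. finite J \<and> J \<subseteq> I \<longrightarrow>
        (\<exists>\<sigma>\<ge>0. distr M borel (\<lambda>\<omega>. \<Sum>i\<in>J. a i * X i \<omega>) = normal_law 0 \<sigma>))"

text \<open>Bridge from 0 to 0 of length \<open>l\<close> of \<open>\<sigma>\<close> times a standard Brownian motion \<open>W\<close>: its
  covariance is that of \<open>\<sigma> (W t - (t / l) W l)\<close>.\<close>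

definition brownian_bridge ::
  "'w measure \<Rightarrow> real \<Rightarrow> real \<Rightarrow> (real \<Rightarrow> 'w \<Rightarrow> real) \<Rightarrow> bool" where
  "brownian_bridge M \<sigma> l \<beta> \<longleftrightarrow>
     centred_gaussian_field M {0..l} \<beta> \<and>
     (\<forall>s\<in>{0..l}. \<forall>t\<in>{0..l}.
        (\<integral>\<omega>. \<beta> s \<omega> * \<beta> t \<omega> \<partial>M) = \<sigma>\<^sup>2 * (min s t * (l - max s t) / l)) \<and>
     (\<forall>\<omega>\<in>space M. continuous_on {0..l} (\<lambda>t. \<beta> t \<omega>))"


section \<open>Discrete Gaussian free field\<close>

definition discrete_gff :: "nat \<Rightarrow> 'w measure \<Rightarrow> (vertex \<Rightarrow> 'w \<Rightarrow> real) \<Rightarrow> bool" where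
  "discrete_gff N M \<phi> \<longleftrightarrow>
     prob_space M \<and>
     centred_gaussian_field M (B (N + 1)) \<phi> \<and>
     (\<forall>x\<in>inner_boundary (B (N + 1)). \<forall>\<omega>\<in>space M. \<phi> x \<omega> = 0) \<and>
     (\<forall>x\<in>B N. \<forall>y\<in>B N. (\<integral>\<omega>. \<phi> x \<omega> * \<phi> y \<omega> \<partial>M) = green (B N) x y)"


section \<open>Metric graph and metric-graph Gaussian free field\<close>

text \<open>The metric graph is realised inside the plane, which gives it the right topology. The embedded
  segments have Euclidean length 1, so arc length on the metric graph (edges of length 2) is twice
  the Euclidean one; \<open>edge_pt x y t\<close> is the point at arc length \<open>t \<in> [0, 2]\<close> from \<open>x\<close>.\<close>

definition metric_graph :: "vertex set \<Rightarrow> (real \<times> real) set" where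
  "metric_graph A =
     pt ` A \<union> (\<Union>{closed_segment (pt x) (pt y) | x y. x \<in> A \<and> y \<in> A \<and> nbr x y})"

definition edge_pt :: "vertex \<Rightarrow> vertex \<Rightarrow> real \<Rightarrow> real \<times> real" where
  "edge_pt x y t = (1 - t / 2) *\<^sub>R pt x + (t / 2) *\<^sub>R pt y"

text \<open>The edges that are not contained in the boundary, each with exactly one orientation.\<close>

definition free_edges :: "nat \<Rightarrow> (vertex \<times> vertex) set" where
  "free_edges N =
     {(x, y). x \<in> B (N + 1) \<and> y \<in> B (N + 1) \<and> nbr x y \<and> fst x \<le> fst y \<and> snd x \<le> snd y \<and>
        \<not> (x \<in> inner_boundary (B (N + 1)) \<and> y \<in> inner_boundary (B (N + 1)))}"

text \<open>The field along an edge minus the linear interpolation of its endpoint values. A bridge of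
  length 2 from \<open>a\<close> to \<open>b\<close> is the linear interpolation of \<open>a\<close> and \<open>b\<close> plus a bridge from 0 to 0.
  Hence the conditional description of the field given its values at the vertices says
  that these differences are bridges from 0 to 0 which are independent of each other and,
  jointly, of the values at the vertices.\<close>

definition edge_bridge ::
  "(real \<times> real \<Rightarrow> 'w \<Rightarrow> real) \<Rightarrow> vertex \<times> vertex \<Rightarrow> real \<Rightarrow> 'w \<Rightarrow> real" where
  "edge_bridge \<phi> = (\<lambda>(x, y) t \<omega>.
     \<phi> (edge_pt x y t) \<omega> - ((1 - t / 2) * \<phi> (pt x) \<omega> + (t / 2) * \<phi> (pt y) \<omega>))"

definition metric_graph_gff :: "nat \<Rightarrow> 'w measure \<Rightarrow> (real \<times> real \<Rightarrow> 'w \<Rightarrow> real) \<Rightarrow> bool" where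
  "metric_graph_gff N M \<phi> \<longleftrightarrow>
     prob_space M \<and>
     (\<forall>\<omega>\<in>space M. continuous_on (metric_graph (B (N + 1))) (\<lambda>p. \<phi> p \<omega>)) \<and>
     (\<forall>p\<in>metric_graph (inner_boundary (B (N + 1))). \<forall>\<omega>\<in>space M. \<phi> p \<omega> = 0) \<and>
     discrete_gff N M (\<lambda>x. \<phi> (pt x)) \<and>
     (\<forall>e\<in>free_edges N. brownian_bridge M (sqrt 2) 2 (edge_bridge \<phi> e)) \<and>
     prob_space.indep_vars M (\<lambda>_. PiM {0..2} (\<lambda>_. borel))
       (\<lambda>e \<omega>. \<lambda>t\<in>{0..2}. edge_bridge \<phi> e t \<omega>) (free_edges N) \<and>
     prob_space.indep_set M
       (sets (vimage_algebra (space M) (\<lambda>\<omega>. \<lambda>x\<in>B (N + 1). \<phi> (pt x) \<omega>)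
          (PiM (B (N + 1)) (\<lambda>_. borel))))
       (sets (vimage_algebra (space M)
          (\<lambda>\<omega>. \<lambda>(e, t)\<in>free_edges N \<times> {0..2}. edge_bridge \<phi> e t \<omega>)
          (PiM (free_edges N \<times> {0..2}) (\<lambda>_. borel))))"


section \<open>Connection above a level\<close>

definition connected_above ::
  "nat \<Rightarrow> (real \<times> real \<Rightarrow> real) \<Rightarrow> real \<Rightarrow> (real \<times> real) set \<Rightarrow> (real \<times> real) set \<Rightarrow> bool" where
  "connected_above N f h A1 A2 \<longleftrightarrow>
     (\<exists>K\<in>components {p \<in> metric_graph (B (N + 1)). f p \<ge> h}. K \<inter> A1 \<noteq> {} \<and> K \<inter> A2 \<noteq> {})"

text \<open>A fixed sample space type: with a type variable in its place, constants asserted to exist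
  could depend on that type and would not be universal. There is no loss of generality, since every
  continuous field on the metric graph is realised on this type as the coordinate field under its
  law.\<close>

type_synonym sample = "real \<times> real \<Rightarrow> real"

end

(*
  Write h for the level, g for the variance of the field at 0 and cap(K) for the capacity of a
  compact set K with respect to the boundary. Whether K is the cluster of 0 above the level h
  depends only on the field near K, where subtracting the constant h is a Cameron-Martin shift.
  Its density depends only on the integral of the field against the equilibrium measure of K. As
  the field equals h on the boundary of K, the probability that the cluster is K is
  exp(-h^2 cap(K) / 2) times the same probability at level 0.
  A connected set that joins 0 to the boundary has capacity at least t = c ln N, hence
  P(E_h) <= exp(-h^2 t / 2) P(E_0) for the connection event E_h. Comparing the levels 0 and s gives
  P(E_0) (1 - exp(-s^2 t / 2)) <= P(0 <= phi_0 < s) <= s / sqrt(2 pi g), and the choice s = t^(-1/2)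
  together with g >= c ln N yields P(E_0) <= C / ln N.
  To avoid conditioning on random compact sets, each edge is divided into n parts, so that the
  cluster takes finitely many values. The field on the boundary of the cluster then differs from h
  by at most the largest jump across a small edge, which tends to 0 as n tends to infinity.
*)

theory Submission
  imports Defs
begin

section \<open>Normal laws and characteristic functions\<close>

text \<open>On the boundary of a discretised cluster the field lies in [h - \<epsilon>, h) instead
  of being equal to h, so the exponent of the shift carries an error of at most h \<epsilon> times
  the mass of an equilibrium measure. That mass is at most \<open>total\<close>, which depends on N
  but not on the number n of parts. Hence n tends to infinity first, which removes the jumps larger
  than \<epsilon>, and \<epsilon> tends to 0 afterwards. The sampled cluster of 0 reaches the
  boundary whenever the continuous one does, and this one inclusion links the two models. Edges that
  leave B_N are not divided but enter as killing, because a connection to the inner boundary of B_N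
  is already visible inside B_N. That the sampled field belongs to the divided network means that
  its covariance is inverted by the network Laplacian. In the summation by parts that proves it, the
  lattice Green's function yields the linear interpolation of the end values on an edge and the
  bridge covariance yields the rest. Laws are compared through the real integrals E cos(c + Y): the
  free phase c encodes both parts of a characteristic function.\<close>

lemma real_distribution_normal_law: "0 \<le> \<sigma> \<Longrightarrow> real_distribution (normal_law \<mu> \<sigma>)"
  by (auto simp: normal_law_def real_distribution_def real_distribution_axioms_def
      intro!: prob_space_return prob_space_normal_density)

lemma normal_law_scale:
  assumes "0 \<le> \<sigma>"
  shows "normal_law 0 \<sigma> = distr std_normal_distribution borel (\<lambda>x. \<sigma> * x)"
proof (cases "\<sigma> = 0")
  case True
  interpret prob_space std_normal_distribution
    by (rule prob_space_normal_density) simp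
  show ?thesis using True by (simp add: normal_law_def distr_const)
next
  case False
  interpret prob_space std_normal_distribution
    by (rule prob_space_normal_density) simp
  have "distributed std_normal_distribution lborel (\<lambda>x. x) std_normal_density"
    by (auto simp: distributed_def cong: distr_cong) 
       (metis distr_id2 sets_density sets_lborel)
  from normal_density_affine[OF this, of \<sigma> 0]
  have "distr std_normal_distribution lborel (\<lambda>x. \<sigma> * x) = density lborel (normal_density 0 \<sigma>)"
    using False assms by (simp add: distributed_def)
  then show ?thesis using False
    by (simp add: normal_law_def cong: distr_cong)
qed

lemma char_normal_law:
  assumes "0 \<le> \<sigma>"
  shows "char (normal_law 0 \<sigma>) t = complex_of_real (exp (- (\<sigma>\<^sup>2 * t\<^sup>2) / 2))"
proof -
  have "char (normal_law 0 \<sigma>) t = char std_normal_distribution (t * \<sigma>)"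
    unfolding normal_law_scale[OF assms] char_def
    by (simp add: integral_distr mult.assoc)
  then show ?thesis by (simp add: char_std_normal_distribution power_mult_distrib mult.commute)
qed

lemma normal_law_moments:
  assumes Y: "Y \<in> borel_measurable M" and d: "distr M borel Y = normal_law 0 \<sigma>" and "0 \<le> \<sigma>"
  shows "integrable M (\<lambda>\<omega>. (Y \<omega>)\<^sup>2)" "(\<integral>\<omega>. (Y \<omega>)\<^sup>2 \<partial>M) = \<sigma>\<^sup>2" "(\<integral>\<omega>. Y \<omega> \<partial>M) = 0"
proof -
  have i: "integrable std_normal_distribution (\<lambda>x. (\<sigma> * x)^2)"
    using integrable_std_normal_distribution_moment[of 2] by (simp add: power_mult_distrib)
  have e: "(\<integral>x. x^2 \<partial>std_normal_distribution) = 1"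
    using std_normal_distribution_even_moments(1)[of 1] by (simp add: fact_numeral)
  have "integrable (distr M borel Y) (\<lambda>x. x^2)"
    unfolding d normal_law_scale[OF \<open>0 \<le> \<sigma>\<close>] by (simp add: integrable_distr_eq i)
  then show "integrable M (\<lambda>\<omega>. (Y \<omega>)\<^sup>2)" using Y by (simp add: integrable_distr_eq)
  have "(\<integral>x. x^2 \<partial>distr M borel Y) = \<sigma>\<^sup>2"
    unfolding d normal_law_scale[OF \<open>0 \<le> \<sigma>\<close>] by (simp add: integral_distr power_mult_distrib e)
  then show "(\<integral>\<omega>. (Y \<omega>)\<^sup>2 \<partial>M) = \<sigma>\<^sup>2" using Y by (simp add: integral_distr)
  have "(\<integral>x. x \<partial>distr M borel Y) = 0"
    unfolding d normal_law_scale[OF \<open>0 \<le> \<sigma>\<close>] using integral_std_normal_distribution_moment_odd[of 1]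
    by (simp add: integral_distr)
  then show "(\<integral>\<omega>. Y \<omega> \<partial>M) = 0" using Y by (simp add: integral_distr)
qed

section \<open>Uniqueness of laws from integrals of cosines\<close>

text \<open>The phase 0 gives the real part, and the phase -pi/2 turns the cosine into the sine of
  the imaginary part. The summand \<open>0 +\<close> keeps the shape \<open>c + t * Y\<close> of the
  later hypotheses.\<close>

lemma (in prob_space) char_cos:
  assumes [measurable]: "Y \<in> borel_measurable M"
  shows "char (distr M borel Y) t = complex_of_real (\<integral>\<omega>. cos (0 + t * Y \<omega>) \<partial>M)
    + \<i> * complex_of_real (\<integral>\<omega>. cos (- (pi/2) + t * Y \<omega>) \<partial>M)"
proof -
  have iexp: "iexp x = complex_of_real (cos (0 + x)) + \<i> * complex_of_real (cos (- (pi/2) + x))" for x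
    by (simp add: cis_conv_exp[symmetric] complex_eq_iff cos_diff)
  have i: "integrable M (\<lambda>\<omega>. complex_of_real (cos (c + t * Y \<omega>)))" for c
    by (rule integrable_const_bound[of _ 1]) auto
  have "char (distr M borel Y) t = (\<integral>\<omega>. iexp (t * Y \<omega>) \<partial>M)"
    unfolding char_def by (subst integral_distr) auto
  also have "\<dots> = (\<integral>\<omega>. complex_of_real (cos (0 + t * Y \<omega>)) + \<i> * complex_of_real (cos (- (pi/2) + t * Y \<omega>)) \<partial>M)"
    by (simp only: iexp)
  also have "\<dots> = (\<integral>\<omega>. complex_of_real (cos (0 + t * Y \<omega>)) \<partial>M) + (\<integral>\<omega>. \<i> * complex_of_real (cos (- (pi/2) + t * Y \<omega>)) \<partial>M)"
    by (rule Bochner_Integration.integral_add[OF i integrable_mult_right[OF i]])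
  finally show ?thesis by (simp only: integral_complex_of_real integral_mult_right_zero)
qed

lemma (in prob_space) integrable_abs_le_1:
  fixes f :: "'a \<Rightarrow> real"
  assumes "f \<in> borel_measurable M" "\<And>\<omega>. \<bar>f \<omega>\<bar> \<le> 1"
  shows "integrable M f"
  using assms by (intro integrable_const_bound[of _ 1]) auto

text \<open>\<open>D\<close> is the image under \<open>Y\<close> of the measure with density W / m.
  Dividing by the mass produces a probability, to which uniqueness of characteristic functions
  applies.\<close>

lemma (in prob_space) weighted_law:
  fixes W Y :: "'a \<Rightarrow> real"
  assumes [measurable]: "W \<in> borel_measurable M" "Y \<in> borel_measurable M"
    and W: "integrable M W" "\<And>\<omega>. 0 \<le> W \<omega>" and m: "m = (\<integral>\<omega>. W \<omega> \<partial>M)" "0 < m"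
  obtains D where "real_distribution D"
    "\<And>f :: real \<Rightarrow> real. f \<in> borel_measurable borel \<Longrightarrow> (\<integral>x. f x \<partial>D) = (\<integral>\<omega>. W \<omega> * f (Y \<omega>) \<partial>M) / m"
proof -
  define D where "D = density M (\<lambda>\<omega>. ennreal (W \<omega> / m))"
  have "emeasure D (space D) = (\<integral>\<^sup>+\<omega>. ennreal (W \<omega> / m) \<partial>M)"
    unfolding D_def by (subst emeasure_density) (auto intro!: nn_integral_cong)
  also have "\<dots> = ennreal (\<integral>\<omega>. W \<omega> / m \<partial>M)"
    using W m by (intro nn_integral_eq_integral) auto
  also have "\<dots> = 1" using m by simp
  finally interpret D: prob_space D by (rule prob_spaceI)
  have [measurable]: "Y \<in> borel_measurable D" by (simp add: D_def)
  show thesis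
  proof (rule that[of "distr D borel Y"])
    show "real_distribution (distr D borel Y)" by simp
    fix f :: "real \<Rightarrow> real" assume [measurable]: "f \<in> borel_measurable borel"
    show "(\<integral>x. f x \<partial>distr D borel Y) = (\<integral>\<omega>. W \<omega> * f (Y \<omega>) \<partial>M) / m"
      unfolding D_def using W m by (subst integral_distr, simp, simp, subst integral_density) auto
  qed
qed

lemma levy_weighted:
  fixes W Y :: "'a \<Rightarrow> real" and W' Y' :: "'b \<Rightarrow> real"
  assumes M: "prob_space M" "prob_space M'"
    and meas: "W \<in> borel_measurable M" "Y \<in> borel_measurable M" "W' \<in> borel_measurable M'" "Y' \<in> borel_measurable M'"
    and W: "integrable M W" "\<And>\<omega>. 0 \<le> W \<omega>" and W': "integrable M' W'" "\<And>\<omega>. 0 \<le> W' \<omega>"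
    and eq: "\<And>c s. (\<integral>\<omega>. W \<omega> * cos (c + s * Y \<omega>) \<partial>M) = (\<integral>\<omega>. W' \<omega> * cos (c + s * Y' \<omega>) \<partial>M')"
    and S: "S \<in> sets borel"
  shows "(\<integral>\<omega>. W \<omega> * indicat_real S (Y \<omega>) \<partial>M) = (\<integral>\<omega>. W' \<omega> * indicat_real S (Y' \<omega>) \<partial>M')"
proof -
  define m where "m = (\<integral>\<omega>. W \<omega> \<partial>M)"
  have m': "m = (\<integral>\<omega>. W' \<omega> \<partial>M')" using eq[of 0 0] by (simp add: m_def)
  show ?thesis
  proof (cases "m = 0")
    \<comment> \<open>A weight of mass zero cannot be normalised, but it vanishes almost
      everywhere.\<close>
    case True
    then have "AE \<omega> in M. W \<omega> = 0" "AE \<omega> in M'. W' \<omega> = 0"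
      using integral_nonneg_eq_0_iff_AE[OF W(1)] integral_nonneg_eq_0_iff_AE[OF W'(1)] W(2) W'(2) m'
      by (auto simp: m_def)
    then have "(\<integral>\<omega>. W \<omega> * indicat_real S (Y \<omega>) \<partial>M) = 0" "(\<integral>\<omega>. W' \<omega> * indicat_real S (Y' \<omega>) \<partial>M') = 0"
      by (auto intro!: integral_eq_zero_AE elim: eventually_mono)
    then show ?thesis by simp
  next
    case False
    then have "0 < m" using W(2) by (simp add: m_def less_le)
    obtain D where D: "real_distribution D"
      "\<And>f :: real \<Rightarrow> real. f \<in> borel_measurable borel \<Longrightarrow> (\<integral>x. f x \<partial>D) = (\<integral>\<omega>. W \<omega> * f (Y \<omega>) \<partial>M) / m"
      using prob_space.weighted_law[OF M(1) meas(1,2) W m_def \<open>0 < m\<close>] by blast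
    obtain D' where D': "real_distribution D'"
      "\<And>f :: real \<Rightarrow> real. f \<in> borel_measurable borel \<Longrightarrow> (\<integral>x. f x \<partial>D') = (\<integral>\<omega>. W' \<omega> * f (Y' \<omega>) \<partial>M') / m"
      using prob_space.weighted_law[OF M(2) meas(3,4) W' m' \<open>0 < m\<close>] by blast
    interpret D: real_distribution D by fact
    interpret D': real_distribution D' by fact
    have id: "distr D borel (\<lambda>x. x) = D" "distr D' borel (\<lambda>x. x) = D'"
      by (rule distr_id2; simp)+
    have "char D t = char D' t" for t
      using D.char_cos[of "\<lambda>x. x" t] D'.char_cos[of "\<lambda>x. x" t] eq[of 0 t] eq[of "- (pi / 2)" t] unfolding id by (simp add: D(2) D'(2))
    then have "D = D'" using D(1) D'(1) by (intro Levy_uniqueness ext)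
    then show ?thesis using D(2)[of "indicat_real S"] D'(2)[of "indicat_real S"] S \<open>0 < m\<close> by (simp del: integral_indicator)
  qed
qed

text \<open>A cosine is signed, whereas 1 + cos is an admissible weight for
  \<open>levy_weighted\<close>. The product of two cosines is the mean of the cosines of sum and
  difference, so every term on the right is again \<open>P\<close> times one cosine.\<close>

lemma (in prob_space) cos_weight_expand:
  fixes P Y Z :: "'a \<Rightarrow> real"
  assumes [measurable]: "P \<in> borel_measurable M" "Y \<in> borel_measurable M" "Z \<in> borel_measurable M" and P: "\<And>\<omega>. \<bar>P \<omega>\<bar> \<le> 1"
  shows "(\<integral>\<omega>. P \<omega> * (1 + cos (c + Z \<omega>)) * cos (c' + s * Y \<omega>) \<partial>M) = (\<integral>\<omega>. P \<omega> * cos (c' + s * Y \<omega>) \<partial>M)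
    + ((\<integral>\<omega>. P \<omega> * cos ((c' + c) + s * Y \<omega> + Z \<omega>) \<partial>M) + (\<integral>\<omega>. P \<omega> * cos ((c' - c) + s * Y \<omega> + - Z \<omega>) \<partial>M)) / 2"
proof -
  have split: "p * (1 + cos (c + z)) * cos (c' + y) = p * cos (c' + y) + (p * cos ((c' + c) + y + z) + p * cos ((c' - c) + y + - z)) / 2"
    for p z y :: real
  proof -
    have "cos ((c' + c) + y + z) + cos ((c' - c) + y + - z) = 2 * cos (c + z) * cos (c' + y)"
      using cos_add[of "c' + y" "c + z"] cos_diff[of "c' + y" "c + z"] by (simp add: algebra_simps)
    then have "p * cos ((c' + c) + y + z) + p * cos ((c' - c) + y + - z) = p * (2 * cos (c + z) * cos (c' + y))"
      by (metis distrib_left)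
    then show ?thesis by (simp add: algebra_simps)
  qed
  have i: "integrable M (\<lambda>\<omega>. P \<omega> * cos (f \<omega>))" if [measurable]: "f \<in> borel_measurable M" for f
    using P by (intro integrable_abs_le_1) (auto simp: abs_mult intro!: mult_le_one)
  show ?thesis
    unfolding split by (subst Bochner_Integration.integral_add, (auto intro!: i Bochner_Integration.integrable_add)[2],
      subst integral_divide_zero, subst Bochner_Integration.integral_add) (auto intro!: i)
qed

lemma (in prob_space) weight_split:
  fixes P Q R :: "'a \<Rightarrow> real"
  assumes [measurable]: "P \<in> borel_measurable M" "Q \<in> borel_measurable M" "R \<in> borel_measurable M"
    and b: "\<And>\<omega>. \<bar>P \<omega>\<bar> \<le> 1" "\<And>\<omega>. \<bar>Q \<omega>\<bar> \<le> 1" "\<And>\<omega>. \<bar>R \<omega>\<bar> \<le> 1"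
  shows "(\<integral>\<omega>. P \<omega> * (1 + Q \<omega>) * R \<omega> \<partial>M) = (\<integral>\<omega>. P \<omega> * R \<omega> \<partial>M) + (\<integral>\<omega>. P \<omega> * R \<omega> * Q \<omega> \<partial>M)"
proof -
  have "integrable M (\<lambda>\<omega>. P \<omega> * R \<omega>)" "integrable M (\<lambda>\<omega>. P \<omega> * R \<omega> * Q \<omega>)"
    using b by (auto intro!: integrable_abs_le_1 mult_le_one simp: abs_mult)
  then show ?thesis by (subst Bochner_Integration.integral_add[symmetric]) (auto simp: algebra_simps)
qed

text \<open>Joint laws are compared by the one-dimensional uniqueness theorem, one coordinate at a
  time: in the induction, coordinates in \<open>J\<close> already enter through indicators, and the
  remaining ones still through a cosine of a linear form.\<close>

lemma rectangle_eq_of_cos_eq: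
  fixes X :: "'i \<Rightarrow> 'a \<Rightarrow> real" and X' :: "'i \<Rightarrow> 'b \<Rightarrow> real"
  assumes M: "prob_space M" "prob_space M'" and I: "finite I"
    and X: "\<And>i. i \<in> I \<Longrightarrow> X i \<in> borel_measurable M"
    and X': "\<And>i. i \<in> I \<Longrightarrow> X' i \<in> borel_measurable M'"
    and eq: "\<And>t c. (\<integral>\<omega>. cos (c + (\<Sum>i\<in>I. t i * X i \<omega>)) \<partial>M) = (\<integral>\<omega>. cos (c + (\<Sum>i\<in>I. t i * X' i \<omega>)) \<partial>M')"
    and S: "\<And>i. i \<in> I \<Longrightarrow> S i \<in> sets borel"
  shows "measure M {\<omega> \<in> space M. \<forall>i\<in>I. X i \<omega> \<in> S i} = measure M' {\<omega> \<in> space M'. \<forall>i\<in>I. X' i \<omega> \<in> S i}"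
proof -
  interpret M: prob_space M by fact
  interpret M': prob_space M' by fact
  note [measurable] = X X' S
  define P where "P J \<omega> = (\<Prod>j\<in>J. indicat_real (S j) (X j \<omega>))" for J \<omega>
  define P' where "P' J \<omega> = (\<Prod>j\<in>J. indicat_real (S j) (X' j \<omega>))" for J \<omega>
  have P01: "0 \<le> P J \<omega>" "P J \<omega> \<le> 1" "0 \<le> P' J \<omega>'" "P' J \<omega>' \<le> 1" for J \<omega> \<omega>'
    unfolding P_def P'_def by (auto intro!: prod_nonneg prod_le_1 simp: indicator_def)
  have Pabs: "\<bar>P J \<omega>\<bar> \<le> 1" "\<bar>P' J \<omega>'\<bar> \<le> 1" for J \<omega> \<omega>' using P01 by auto
  have Pm[measurable]: "P J \<in> borel_measurable M" "P' J \<in> borel_measurable M'" if "J \<subseteq> I" for J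
    using that unfolding P_def P'_def by (auto intro!: borel_measurable_prod)
  have "\<forall>t c. (\<integral>\<omega>. P J \<omega> * cos (c + (\<Sum>i\<in>I - J. t i * X i \<omega>)) \<partial>M)
      = (\<integral>\<omega>. P' J \<omega> * cos (c + (\<Sum>i\<in>I - J. t i * X' i \<omega>)) \<partial>M')" if "J \<subseteq> I" for J
    using finite_subset[OF that I] that
  proof (induction J rule: finite_induct)
    case empty
    then show ?case using eq by (simp add: P_def P'_def)
  next
    case (insert k J)
    let ?R = "I - insert k J"
    have kJ: "I - J = insert k ?R" "k \<notin> ?R" "k \<in> I" "J \<subseteq> I" "finite ?R"
      using insert.hyps insert.prems I by auto
    note [measurable] = Pm[OF kJ(4)] X[OF kJ(3)] X'[OF kJ(3)] S[OF kJ(3)]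
    define Z where "Z t \<omega> = (\<Sum>i\<in>?R. t i * X i \<omega>)" for t \<omega>
    define Z' where "Z' t \<omega> = (\<Sum>i\<in>?R. t i * X' i \<omega>)" for t \<omega>
    have Zm[measurable]: "Z t \<in> borel_measurable M" "Z' t \<in> borel_measurable M'" for t
      unfolding Z_def Z'_def by measurable
    have IH: "(\<integral>\<omega>. P J \<omega> * cos (c + s * X k \<omega> + Z t \<omega>) \<partial>M) = (\<integral>\<omega>. P' J \<omega> * cos (c + s * X' k \<omega> + Z' t \<omega>) \<partial>M')" for c s t
    proof -
      have "(\<Sum>i\<in>I - J. (if i = k then s else t i) * f i) = s * f k + (\<Sum>i\<in>?R. t i * f i)" for f :: "_ \<Rightarrow> real"
        unfolding kJ(1) using kJ(2,5) by (auto intro!: sum.cong)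
      with insert.IH[OF kJ(4), rule_format, of c "\<lambda>i. if i = k then s else t i"]
      show ?thesis by (simp add: Z_def Z'_def add.assoc)
    qed
    have IH0: "(\<integral>\<omega>. P J \<omega> * cos (c + s * X k \<omega>) \<partial>M) = (\<integral>\<omega>. P' J \<omega> * cos (c + s * X' k \<omega>) \<partial>M')" for c s
      using IH[of c s "\<lambda>_. 0"] by (simp add: Z_def Z'_def)
    have IH1: "(\<integral>\<omega>. P J \<omega> * cos (c + s * X k \<omega> + - Z t \<omega>) \<partial>M) = (\<integral>\<omega>. P' J \<omega> * cos (c + s * X' k \<omega> + - Z' t \<omega>) \<partial>M')" for c s t
      using IH[of c s "\<lambda>i. - t i"] by (simp add: Z_def Z'_def sum_negf)
    have iP: "integrable M (P J)" "integrable M' (P' J)"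
      using Pabs by (auto intro!: M.integrable_abs_le_1 M'.integrable_abs_le_1)
    have w0: "(\<integral>\<omega>. P J \<omega> * indicat_real (S k) (X k \<omega>) \<partial>M) = (\<integral>\<omega>. P' J \<omega> * indicat_real (S k) (X' k \<omega>) \<partial>M')"
      by (rule levy_weighted[OF M _ _ _ _ iP(1) P01(1) iP(2) P01(3) IH0]) measurable
    \<comment> \<open>The wanted weight \<open>P J * cos (c + Z t)\<close> may be negative. Adding
      \<open>P J\<close> makes it nonnegative, and \<open>w0\<close> provides the part that is
      subtracted again below.\<close>
    have w1: "(\<integral>\<omega>. (P J \<omega> * (1 + cos (c + Z t \<omega>))) * indicat_real (S k) (X k \<omega>) \<partial>M)
      = (\<integral>\<omega>. (P' J \<omega> * (1 + cos (c + Z' t \<omega>))) * indicat_real (S k) (X' k \<omega>) \<partial>M')" for c t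
    proof (rule levy_weighted[OF M])
      have c1: "0 \<le> 1 + cos x" "1 + cos x \<le> 2" for x :: real
        using cos_ge_minus_one[of x] cos_le_one[of x] by linarith+
      show "0 \<le> P J \<omega> * (1 + cos (c + Z t \<omega>))" "0 \<le> P' J \<omega>' * (1 + cos (c + Z' t \<omega>'))" for \<omega> \<omega>'
        using P01 c1 by auto
      have "\<bar>P J \<omega> * (1 + cos x)\<bar> \<le> 2" "\<bar>P' J \<omega>' * (1 + cos x)\<bar> \<le> 2" for \<omega> \<omega>' x
        using P01 c1 mult_mono[OF P01(2) c1(2)] mult_mono[OF P01(4) c1(2)] by (auto simp: abs_mult)
      then show "integrable M (\<lambda>\<omega>. P J \<omega> * (1 + cos (c + Z t \<omega>)))" "integrable M' (\<lambda>\<omega>. P' J \<omega> * (1 + cos (c + Z' t \<omega>)))"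
        by (auto intro!: M.integrable_const_bound[of _ 2] M'.integrable_const_bound[of _ 2])
      show "(\<integral>\<omega>. P J \<omega> * (1 + cos (c + Z t \<omega>)) * cos (c' + s * X k \<omega>) \<partial>M)
        = (\<integral>\<omega>. P' J \<omega> * (1 + cos (c + Z' t \<omega>)) * cos (c' + s * X' k \<omega>) \<partial>M')" for c' s
        using Pabs by (subst M.cos_weight_expand, simp_all, subst M'.cos_weight_expand, simp_all add: IH IH0 IH1[simplified])
    qed measurable
    show ?case
    proof (intro allI)
      fix t c
      have PP: "P (insert k J) \<omega> = P J \<omega> * indicat_real (S k) (X k \<omega>)" 
         "P' (insert k J) \<omega>' = P' J \<omega>' * indicat_real (S k) (X' k \<omega>')" for \<omega> \<omega>'
        using insert.hyps by (auto simp: P_def P'_def)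
      have "(\<integral>\<omega>. P (insert k J) \<omega> * cos (c + Z t \<omega>) \<partial>M) = (\<integral>\<omega>. P' (insert k J) \<omega> * cos (c + Z' t \<omega>) \<partial>M')"
        using w1[of c t] w0 Pabs M.weight_split[of "P J" "\<lambda>\<omega>. cos (c + Z t \<omega>)" "\<lambda>\<omega>. indicat_real (S k) (X k \<omega>)"]
          M'.weight_split[of "P' J" "\<lambda>\<omega>. cos (c + Z' t \<omega>)" "\<lambda>\<omega>. indicat_real (S k) (X' k \<omega>)"]
        by (simp add: PP indicator_abs_le_1)
      then show "(\<integral>\<omega>. P (insert k J) \<omega> * cos (c + (\<Sum>i\<in>?R. t i * X i \<omega>)) \<partial>M)
        = (\<integral>\<omega>. P' (insert k J) \<omega> * cos (c + (\<Sum>i\<in>?R. t i * X' i \<omega>)) \<partial>M')"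
        by (simp add: Z_def Z'_def)
    qed
  qed
  from spec[OF spec[OF this[OF subset_refl], of "\<lambda>_. 0"], of 0]
  have "(\<integral>\<omega>. P I \<omega> \<partial>M) = (\<integral>\<omega>. P' I \<omega> \<partial>M')"
    by simp
  moreover have "P I \<omega> = indicat_real {\<omega> \<in> space M. \<forall>i\<in>I. X i \<omega> \<in> S i} \<omega>" if "\<omega> \<in> space M" for \<omega>
    using that I unfolding P_def by (auto simp: indicator_def prod_zero_iff)
  moreover have "P' I \<omega> = indicat_real {\<omega> \<in> space M'. \<forall>i\<in>I. X' i \<omega> \<in> S i} \<omega>" if "\<omega> \<in> space M'" for \<omega>
    using that I unfolding P'_def by (auto simp: indicator_def prod_zero_iff)
  ultimately have "(\<integral>\<omega>. indicat_real {\<omega> \<in> space M. \<forall>i\<in>I. X i \<omega> \<in> S i} \<omega> \<partial>M)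
      = (\<integral>\<omega>. indicat_real {\<omega> \<in> space M'. \<forall>i\<in>I. X' i \<omega> \<in> S i} \<omega> \<partial>M')"
    by (simp cong: Bochner_Integration.integral_cong del: integral_indicator)
  moreover have "{\<omega> \<in> space M. Q \<omega>} \<inter> space M = {\<omega> \<in> space M. Q \<omega>}" for Q by auto
  moreover have "{\<omega> \<in> space M'. Q \<omega>} \<inter> space M' = {\<omega> \<in> space M'. Q \<omega>}" for Q by auto
  ultimately show ?thesis
    by simp
qed

section \<open>The Cameron-Martin shift\<close>

definition centred_normal :: "'w measure \<Rightarrow> ('w \<Rightarrow> real) \<Rightarrow> bool" where
  "centred_normal M Y \<longleftrightarrow> Y \<in> borel_measurable M \<and> (\<exists>\<sigma>\<ge>0. distr M borel Y = normal_law 0 \<sigma>)"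

lemma centred_normal_measurable[measurable_dest]: "centred_normal M Y \<Longrightarrow> Y \<in> borel_measurable M"
  by (simp add: centred_normal_def)

lemma centred_normal_moments:
  assumes "centred_normal M Y"
  shows "integrable M (\<lambda>\<omega>. (Y \<omega>)\<^sup>2)" "(\<integral>\<omega>. Y \<omega> \<partial>M) = 0"
  using assms normal_law_moments unfolding centred_normal_def by blast+

lemma centred_normal_law:
  assumes "centred_normal M Y"
  shows "distr M borel Y = normal_law 0 (sqrt (\<integral>\<omega>. (Y \<omega>)\<^sup>2 \<partial>M))"
  using assms normal_law_moments(2) unfolding centred_normal_def by (metis real_sqrt_abs abs_of_nonneg)

lemma centred_normal_char:
  assumes "centred_normal M Y"
  shows "char (distr M borel Y) t = complex_of_real (exp (- ((\<integral>\<omega>. (Y \<omega>)\<^sup>2 \<partial>M) * t\<^sup>2) / 2))"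
  by (subst centred_normal_law[OF assms], subst char_normal_law) simp_all

text \<open>The characteristic function is real, so the sine of \<open>Y\<close> has mean zero and
  only the cosine part of the addition formula survives.\<close>

lemma (in prob_space) centred_normal_cos:
  assumes "centred_normal M Y"
  shows "(\<integral>\<omega>. cos (c + Y \<omega>) \<partial>M) = cos c * exp (- (\<integral>\<omega>. (Y \<omega>)\<^sup>2 \<partial>M) / 2)"
proof -
  have [measurable]: "Y \<in> borel_measurable M" using assms by (rule centred_normal_measurable)
  have "complex_of_real (exp (- (\<integral>\<omega>. (Y \<omega>)\<^sup>2 \<partial>M) / 2)) = complex_of_real (\<integral>\<omega>. cos (0 + 1 * Y \<omega>) \<partial>M)
    + \<i> * complex_of_real (\<integral>\<omega>. cos (- (pi/2) + 1 * Y \<omega>) \<partial>M)"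
    using centred_normal_char[OF assms, of 1] char_cos[of Y 1] by simp
  then have e: "(\<integral>\<omega>. cos (Y \<omega>) \<partial>M) = exp (- (\<integral>\<omega>. (Y \<omega>)\<^sup>2 \<partial>M) / 2)"
    "(\<integral>\<omega>. cos (- (pi/2) + Y \<omega>) \<partial>M) = 0"
    by (auto simp: complex_eq_iff)
  have s: "sin x = cos (- (pi/2) + x)" for x :: real by (simp add: cos_diff)
  have "(\<integral>\<omega>. cos (c + Y \<omega>) \<partial>M) = (\<integral>\<omega>. cos c * cos (Y \<omega>) - sin c * cos (- (pi/2) + Y \<omega>) \<partial>M)"
    by (simp only: cos_add[of c] s[of "Y _"])
  also have "\<dots> = (\<integral>\<omega>. cos c * cos (Y \<omega>) \<partial>M) - (\<integral>\<omega>. sin c * cos (- (pi/2) + Y \<omega>) \<partial>M)"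
    by (rule Bochner_Integration.integral_diff; rule integrable_const_bound[of _ 1])
       (auto simp: abs_mult intro!: mult_le_one AE_I2)
  finally show ?thesis using e by simp
qed

lemma centred_normal_normal_law:
  assumes "0 \<le> \<sigma>"
  shows "centred_normal (normal_law 0 \<sigma>) (\<lambda>z. a * z)"
proof -
  have eq: "(\<lambda>x. a * (\<sigma> * x)) = (\<lambda>x. (a * \<sigma>) * x)" by auto
  have "distr (normal_law 0 \<sigma>) borel (\<lambda>z. a * z) = distr std_normal_distribution borel (\<lambda>x. (a * \<sigma>) * x)"
    unfolding normal_law_scale[OF assms] by (subst distr_distr) (auto simp: comp_def eq)
  also have "\<dots> = distr std_normal_distribution borel (\<lambda>x. \<bar>a * \<sigma>\<bar> * x)"
  proof (cases "a * \<sigma> \<ge> 0")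
    \<comment> \<open>A negative factor leaves the law unchanged, because the standard normal law is
      symmetric.\<close>
    case False
    interpret prob_space std_normal_distribution by (rule prob_space_normal_density) simp
    have 1: "char (distr std_normal_distribution borel (\<lambda>x. s * x)) = (\<lambda>t. char std_normal_distribution (t * s))" for s
      by (auto simp: char_def integral_distr mult.assoc)
    show ?thesis
      by (rule Levy_uniqueness) (auto simp: 1 char_std_normal_distribution power_mult_distrib)
  qed simp
  also have "\<dots> = normal_law 0 \<bar>a * \<sigma>\<bar>" by (rule normal_law_scale[symmetric]) simp
  finally show ?thesis
    unfolding centred_normal_def by (auto simp: normal_law_def split: if_splits intro!: exI[of _ "\<bar>a * \<sigma>\<bar>"])
qed

lemma centred_gaussian_field_sum:
  assumes "centred_gaussian_field M I X" "finite I"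
  shows "centred_normal M (\<lambda>\<omega>. \<Sum>i\<in>I. a i * X i \<omega>)"
proof -
  have "(\<lambda>\<omega>. \<Sum>i\<in>I. a i * X i \<omega>) \<in> borel_measurable M"
    using assms by (auto simp: centred_gaussian_field_def intro!: borel_measurable_sum)
  then show ?thesis using assms unfolding centred_normal_def centred_gaussian_field_def by blast
qed

lemma centred_gaussian_field_single:
  assumes "centred_gaussian_field M I X" "i \<in> I"
  shows "centred_normal M (X i)"
proof -
  have "centred_gaussian_field M {i} X" using assms by (auto simp: centred_gaussian_field_def)
  from centred_gaussian_field_sum[OF this, of "\<lambda>_. 1"] show ?thesis by simp
qed

lemma integrable_mult_of_squares:
  fixes X Y :: "'a \<Rightarrow> real"
  assumes [measurable]: "X \<in> borel_measurable M" "Y \<in> borel_measurable M"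
    and "integrable M (\<lambda>\<omega>. (X \<omega>)\<^sup>2)" "integrable M (\<lambda>\<omega>. (Y \<omega>)\<^sup>2)"
  shows "integrable M (\<lambda>\<omega>. X \<omega> * Y \<omega>)"
proof (rule Bochner_Integration.integrable_bound)
  show "integrable M (\<lambda>\<omega>. (X \<omega>)\<^sup>2 + (Y \<omega>)\<^sup>2)" using assms by simp
  have "\<bar>x * y\<bar> \<le> x\<^sup>2 + y\<^sup>2" for x y :: real
  proof -
    have "0 \<le> (x - y)\<^sup>2" "0 \<le> (x + y)\<^sup>2" "0 \<le> x\<^sup>2 + y\<^sup>2" by auto
    then show ?thesis by (simp add: power2_eq_square algebra_simps abs_if)
  qed
  then show "AE \<omega> in M. norm (X \<omega> * Y \<omega>) \<le> norm ((X \<omega>)\<^sup>2 + (Y \<omega>)\<^sup>2)" by auto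
qed simp

lemma centred_normal_mult_integrable:
  "centred_normal M X \<Longrightarrow> centred_normal M Y \<Longrightarrow> integrable M (\<lambda>\<omega>. X \<omega> * Y \<omega>)"
  by (intro integrable_mult_of_squares centred_normal_measurable centred_normal_moments)

lemma normal_density_shift:
  assumes "0 < v"
  shows "normal_density 0 (sqrt v) (z + h * v) = normal_density 0 (sqrt v) z * exp (- h * z - h\<^sup>2 * v / 2)"
proof -
  have "- (z + h * v)\<^sup>2 / (2 * v) = - z\<^sup>2 / (2 * v) + (- h * z - h\<^sup>2 * v / 2)"
    using assms by (simp add: field_simps power2_eq_square)
  then show ?thesis using assms by (simp add: normal_density_def exp_add[symmetric])
qed

text \<open>Writing \<open>Z = \<Sum>i. e i * X i\<close> and \<open>v\<close> for its variance, \<open>X i - Z / v\<close> is uncorrelated with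
  \<open>Z\<close>, so a constant shift of the field is a shift of the Gaussian variable \<open>Z\<close> alone.\<close>

lemma cameron_martin_rectangle:
  fixes X :: "'i \<Rightarrow> 'a \<Rightarrow> real"
  assumes M: "prob_space M" and I: "finite I" and X: "centred_gaussian_field M I X"
    and one: "\<And>i. i \<in> I \<Longrightarrow> (\<integral>\<omega>. (\<Sum>j\<in>I. e j * X j \<omega>) * X i \<omega> \<partial>M) = 1"
    and v: "v = (\<Sum>i\<in>I. e i)" "0 < v"
    and S: "\<And>i. i \<in> I \<Longrightarrow> S i \<in> sets borel"
    and low: "\<And>x. (\<And>i. i \<in> I \<Longrightarrow> x i \<in> S i) \<Longrightarrow> - \<eta> \<le> (\<Sum>i\<in>I. e i * x i)"
    and h: "0 \<le> h"
  shows "measure M {\<omega> \<in> space M. \<forall>i\<in>I. X i \<omega> - h \<in> S i}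
     \<le> exp (h * \<eta> - h\<^sup>2 * v / 2) * measure M {\<omega> \<in> space M. \<forall>i\<in>I. X i \<omega> \<in> S i}"
proof -
  interpret M: prob_space M by fact
  define N where "N = normal_law 0 (sqrt v)"
  have N: "N = density lborel (\<lambda>x. ennreal (normal_density 0 (sqrt v) x))"
    using v by (simp add: N_def normal_law_def)
  interpret N: prob_space N unfolding N using v by (intro prob_space_normal_density) simp
  interpret MN: pair_prob_space M N ..
  have sN[simp, measurable_cong]: "sets N = sets borel" and [simp]: "space N = UNIV" by (simp_all add: N)
  have Xm[measurable]: "X i \<in> borel_measurable M" if "i \<in> I" for i
    using X that by (simp add: centred_gaussian_field_def)
  note [measurable] = S
  define Z where "Z \<omega> = (\<Sum>j\<in>I. e j * X j \<omega>)" for \<omega>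
  have [measurable]: "Z \<in> borel_measurable M" by (simp add: Z_def[abs_def])
  define \<psi> where "\<psi> i \<omega> = X i \<omega> - Z \<omega> / v" for i \<omega>
  have [measurable]: "\<psi> i \<in> borel_measurable M" if "i \<in> I" for i
    using that by (simp add: \<psi>_def[abs_def])
  \<comment> \<open>On the product space \<open>Z\<close> is resampled: the independent coordinate
    \<open>z\<close> takes its place, while the part \<psi> uncorrelated with \<open>Z\<close> is
    kept. \<open>cos_eq\<close> shows that this preserves the joint law.\<close>
  define X' where "X' i = (\<lambda>(\<omega>, z). z / v + \<psi> i \<omega>)" for i
  have X'm[measurable]: "X' i \<in> borel_measurable (M \<Otimes>\<^sub>M N)" if "i \<in> I" for i
    using that unfolding X'_def by measurable
  have cnZ: "centred_normal M Z" unfolding Z_def by (rule centred_gaussian_field_sum[OF X I])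
  have cnX: "centred_normal M (X i)" if "i \<in> I" for i by (rule centred_gaussian_field_single[OF X that])
  have cov: "(\<integral>\<omega>. (\<Sum>i\<in>I. a i * X i \<omega>) * Z \<omega> \<partial>M) = (\<Sum>i\<in>I. a i)" for a
  proof -
    have "(\<integral>\<omega>. (\<Sum>i\<in>I. a i * X i \<omega>) * Z \<omega> \<partial>M) = (\<integral>\<omega>. (\<Sum>i\<in>I. a i * (Z \<omega> * X i \<omega>)) \<partial>M)"
      by (intro Bochner_Integration.integral_cong refl) (simp add: sum_distrib_left mult_ac)
    also have "\<dots> = (\<Sum>i\<in>I. a i * (\<integral>\<omega>. Z \<omega> * X i \<omega> \<partial>M))"
      by (subst Bochner_Integration.integral_sum)
         (auto intro!: integrable_mult_right centred_normal_mult_integrable cnZ cnX)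
    finally show ?thesis using one by (simp add: Z_def)
  qed
  have Z2: "(\<integral>\<omega>. (Z \<omega>)\<^sup>2 \<partial>M) = v" using cov[of e] v by (simp add: Z_def[symmetric] power2_eq_square)
  have cos_eq: "(\<integral>\<omega>. cos (c + (\<Sum>i\<in>I. t i * X i \<omega>)) \<partial>M) = (\<integral>p. cos (c + (\<Sum>i\<in>I. t i * X' i p)) \<partial>(M \<Otimes>\<^sub>M N))" for t c
  proof -
    define T where "T = (\<Sum>i\<in>I. t i)"
    \<comment> \<open>T / v is the regression coefficient of the linear combination on
      \<open>Z\<close>, so \<open>U\<close> is uncorrelated with \<open>Z\<close> and the two
      variances add.\<close>
    define U where "U \<omega> = (\<Sum>i\<in>I. (t i - e i * T / v) * X i \<omega>)" for \<omega>
    have cnU: "centred_normal M U" unfolding U_def by (rule centred_gaussian_field_sum[OF X I])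
    note [measurable] = centred_normal_measurable[OF cnU]
    have UT: "(\<Sum>i\<in>I. t i * X i \<omega>) = U \<omega> + T / v * Z \<omega>" for \<omega>
      by (simp add: U_def Z_def algebra_simps sum_subtractf sum_distrib_left sum_divide_distrib)
    have UX': "(\<Sum>i\<in>I. t i * X' i (\<omega>, z)) = U \<omega> + T / v * z" for \<omega> z
    proof -
      have "(\<Sum>i\<in>I. t i * X' i (\<omega>, z)) = (\<Sum>i\<in>I. t i * X i \<omega>) - T / v * Z \<omega> + T / v * z"
        by (simp add: X'_def \<psi>_def T_def algebra_simps sum_subtractf sum.distrib sum_distrib_left sum_divide_distrib)
      then show ?thesis by (simp add: UT)
    qed
    have UZ: "(\<integral>\<omega>. U \<omega> * Z \<omega> \<partial>M) = 0"
      using v by (simp add: U_def cov sum_subtractf T_def sum_distrib_right[symmetric] sum_divide_distrib[symmetric])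
    have var: "(\<integral>\<omega>. (\<Sum>i\<in>I. t i * X i \<omega>)\<^sup>2 \<partial>M) = (\<integral>\<omega>. (U \<omega>)\<^sup>2 \<partial>M) + T\<^sup>2 / v"
    proof -
      have "(\<integral>\<omega>. (\<Sum>i\<in>I. t i * X i \<omega>)\<^sup>2 \<partial>M) = (\<integral>\<omega>. (U \<omega>)\<^sup>2 + (2 * T / v) * (U \<omega> * Z \<omega>) + (T / v)\<^sup>2 * (Z \<omega>)\<^sup>2 \<partial>M)"
        unfolding UT by (intro Bochner_Integration.integral_cong refl) (simp add: power2_eq_square algebra_simps)
      also have "\<dots> = (\<integral>\<omega>. (U \<omega>)\<^sup>2 \<partial>M) + (2 * T / v) * (\<integral>\<omega>. U \<omega> * Z \<omega> \<partial>M) + (T / v)\<^sup>2 * (\<integral>\<omega>. (Z \<omega>)\<^sup>2 \<partial>M)"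
        using centred_normal_mult_integrable[OF cnU cnZ] centred_normal_moments[OF cnU] centred_normal_moments[OF cnZ]
        by simp
      finally have "(\<integral>\<omega>. (\<Sum>i\<in>I. t i * X i \<omega>)\<^sup>2 \<partial>M) = (\<integral>\<omega>. (U \<omega>)\<^sup>2 \<partial>M) + (T / v)\<^sup>2 * v"
        by (simp only: UZ Z2 mult_zero_right add_0_right)
      moreover have "(T / v)\<^sup>2 * v = T\<^sup>2 / v" using v(2) by (simp add: power2_eq_square)
      ultimately show ?thesis by simp
    qed
    have cnz: "centred_normal N (\<lambda>z. T / v * z)" unfolding N_def by (rule centred_normal_normal_law) (use v in simp)
    have dN: "distr N borel (\<lambda>z. z) = normal_law 0 (sqrt v)"
      unfolding N_def[symmetric] by (rule distr_id2) simp
    have mN: "(\<lambda>z. z) \<in> borel_measurable N" by measurable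
    have "(\<integral>z. z\<^sup>2 \<partial>N) = v"
      using normal_law_moments(2)[OF mN dN] v(2) by simp
    then have zvar: "(\<integral>z. (T / v * z)\<^sup>2 \<partial>N) = T\<^sup>2 / v" 
    proof -
      have "(T / v * z)\<^sup>2 = (T\<^sup>2 / v\<^sup>2) * z\<^sup>2" for z by (simp add: power_mult_distrib power_divide)
      then show ?thesis using \<open>(\<integral>z. z\<^sup>2 \<partial>N) = v\<close> v(2) by (simp only: integral_mult_right_zero) (simp add: power2_eq_square)
    qed
    have "integrable (M \<Otimes>\<^sub>M N) (\<lambda>p. cos (c + (\<Sum>i\<in>I. t i * X' i p)))"
      by (rule MN.integrable_const_bound[of _ 1]) auto
    then have "(\<integral>p. cos (c + (\<Sum>i\<in>I. t i * X' i p)) \<partial>(M \<Otimes>\<^sub>M N)) = (\<integral>\<omega>. (\<integral>z. cos ((c + U \<omega>) + T / v * z) \<partial>N) \<partial>M)"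
      by (subst MN.integral_fst'[symmetric]) (auto simp: UX' add.assoc)
    also have "\<dots> = (\<integral>\<omega>. cos (c + U \<omega>) \<partial>M) * exp (- (T\<^sup>2 / v) / 2)"
      unfolding N.centred_normal_cos[OF cnz] zvar by simp
    also have "\<dots> = cos c * (exp (- (\<integral>\<omega>. (U \<omega>)\<^sup>2 \<partial>M) / 2) * exp (- (T\<^sup>2 / v) / 2))"
      unfolding M.centred_normal_cos[OF cnU] by simp
    also have "\<dots> = cos c * exp (- (\<integral>\<omega>. (\<Sum>i\<in>I. t i * X i \<omega>)\<^sup>2 \<partial>M) / 2)"
      unfolding var by (simp add: exp_add[symmetric] add_divide_distrib)
    also have "\<dots> = (\<integral>\<omega>. cos (c + (\<Sum>i\<in>I. t i * X i \<omega>)) \<partial>M)"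
      by (rule M.centred_normal_cos[symmetric], rule centred_gaussian_field_sum[OF X I])
    finally show ?thesis by simp
  qed
  have rect: "measure M {\<omega> \<in> space M. \<forall>i\<in>I. X i \<omega> \<in> R i} 
      = measure (M \<Otimes>\<^sub>M N) {p \<in> space (M \<Otimes>\<^sub>M N). \<forall>i\<in>I. X' i p \<in> R i}"
    if "\<And>i. i \<in> I \<Longrightarrow> R i \<in> sets borel" for R
    by (rule rectangle_eq_of_cos_eq[OF M MN.prob_space_axioms I Xm X'm cos_eq that])
  \<comment> \<open>The weighted sum of the coordinates recovers \<open>z\<close>; this turns the
    hypothesis \<open>low\<close> into a lower bound for \<open>z\<close> itself.\<close>
  have sum_e: "(\<Sum>i\<in>I. e i * (z / v + \<psi> i \<omega>)) = z" for z \<omega>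
  proof -
    have "(\<Sum>i\<in>I. e i * (z / v + \<psi> i \<omega>)) = (\<Sum>i\<in>I. e i * (z / v - Z \<omega> / v) + e i * X i \<omega>)"
      by (simp add: \<psi>_def algebra_simps)
    also have "\<dots> = v * (z / v - Z \<omega> / v) + Z \<omega>"
      unfolding sum.distrib sum_distrib_right[symmetric] v(1) Z_def ..
    also have "\<dots> = z" using v(2) by (simp add: right_diff_distrib)
    finally show ?thesis .
  qed
  define K where "K = exp (h * \<eta> - h\<^sup>2 * v / 2)"
  define A where "A \<omega> = {z. \<forall>i\<in>I. z / v + \<psi> i \<omega> \<in> S i}" for \<omega>
  have Am[measurable]: "A \<omega> \<in> sets borel" if "\<omega> \<in> space M" for \<omega>
    unfolding A_def using I by measurable
  \<comment> \<open>For fixed \<omega>, raising all coordinates by h is a translation of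
    \<open>z\<close> by h v. The density changes by the factor exp(- h z - h^2 v / 2), which is at
    most \<open>K\<close> because z is at least -\<eta> on \<open>A \<omega>\<close>.\<close>
  have slice: "emeasure N {z. z - h * v \<in> A \<omega>} \<le> ennreal K * emeasure N (A \<omega>)" if \<omega>: "\<omega> \<in> space M" for \<omega>
  proof -
    note [measurable] = Am[OF \<omega>]
    have "emeasure N {z. z - h * v \<in> A \<omega>} 
       = (\<integral>\<^sup>+z. ennreal (normal_density 0 (sqrt v) z) * indicator (A \<omega>) (z - h * v) \<partial>lborel)"
      unfolding N by (subst emeasure_density) (auto intro!: nn_integral_cong simp: indicator_def)
    also have "\<dots> = (\<integral>\<^sup>+z. ennreal (normal_density 0 (sqrt v) (h * v + 1 * z)) * indicator (A \<omega>) ((h * v + 1 * z) - h * v) \<partial>lborel)"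
      using nn_integral_real_affine[of "\<lambda>z. ennreal (normal_density 0 (sqrt v) z) * indicator (A \<omega>) (z - h * v)" 1 "h * v"]
      by simp
    also have "\<dots> \<le> (\<integral>\<^sup>+z. ennreal K * (ennreal (normal_density 0 (sqrt v) z) * indicator (A \<omega>) z) \<partial>lborel)"
    proof (rule nn_integral_mono)
      fix z
      show "ennreal (normal_density 0 (sqrt v) (h * v + 1 * z)) * indicator (A \<omega>) ((h * v + 1 * z) - h * v)
        \<le> ennreal K * (ennreal (normal_density 0 (sqrt v) z) * indicator (A \<omega>) z)"
      proof (cases "z \<in> A \<omega>")
        case True
        then have "- \<eta> \<le> (\<Sum>i\<in>I. e i * (z / v + \<psi> i \<omega>))" by (intro low) (auto simp: A_def)
        then have "- \<eta> \<le> z" by (simp add: sum_e)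
        then have "- h * z - h\<^sup>2 * v / 2 \<le> h * \<eta> - h\<^sup>2 * v / 2"
          using h mult_left_mono[of "- \<eta>" z h] by simp
        then have "normal_density 0 (sqrt v) (z + h * v) \<le> normal_density 0 (sqrt v) z * K"
          unfolding normal_density_shift[OF v(2)] K_def by (intro mult_left_mono) auto
        then show ?thesis using True
          by (simp add: ennreal_mult[symmetric] K_def add.commute mult.commute)
      qed simp
    qed
    also have "\<dots> = ennreal K * emeasure N (A \<omega>)"
      unfolding N by (subst emeasure_density) (auto simp: nn_integral_cmult)
    finally show ?thesis .
  qed
  let ?E1 = "{p \<in> space (M \<Otimes>\<^sub>M N). \<forall>i\<in>I. X' i p \<in> {x. x - h \<in> S i}}"
  let ?E0 = "{p \<in> space (M \<Otimes>\<^sub>M N). \<forall>i\<in>I. X' i p \<in> S i}"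
  have [measurable]: "{x. x - h \<in> S i} \<in> sets borel" if "i \<in> I" for i
    using that by measurable
  have E[measurable]: "?E1 \<in> sets (M \<Otimes>\<^sub>M N)" "?E0 \<in> sets (M \<Otimes>\<^sub>M N)"
    using I by measurable
  have "emeasure (M \<Otimes>\<^sub>M N) ?E1 = (\<integral>\<^sup>+\<omega>. emeasure N {z. z - h * v \<in> A \<omega>} \<partial>M)"
    unfolding N.emeasure_pair_measure_alt[OF E(1)]
  proof (intro nn_integral_cong arg_cong[of _ _ "emeasure N"])
    fix \<omega> assume "\<omega> \<in> space M"
    have eq: "(z - h * v) / v + \<psi> i \<omega> = z / v + \<psi> i \<omega> - h" for z i
      using v(2) by (simp add: diff_divide_distrib)
    have "{z. z - h * v \<in> A \<omega>} = {z. \<forall>i\<in>I. z / v + \<psi> i \<omega> - h \<in> S i}"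
      unfolding A_def mem_Collect_eq eq ..
    then show "Pair \<omega> -` ?E1 = {z. z - h * v \<in> A \<omega>}"
      using \<open>\<omega> \<in> space M\<close> by (auto simp: space_pair_measure X'_def A_def)
  qed
  also have "\<dots> \<le> (\<integral>\<^sup>+\<omega>. ennreal K * emeasure N (A \<omega>) \<partial>M)"
    by (intro nn_integral_mono slice)
  also have "\<dots> = (\<integral>\<^sup>+\<omega>. ennreal K * emeasure N (Pair \<omega> -` ?E0) \<partial>M)"
    by (intro nn_integral_cong arg_cong[of _ _ "\<lambda>x. ennreal K * emeasure N x"])
       (auto simp: space_pair_measure X'_def A_def)
  also have "\<dots> = ennreal K * emeasure (M \<Otimes>\<^sub>M N) ?E0"
    unfolding N.emeasure_pair_measure_alt[OF E(2)]
    by (rule nn_integral_cmult) (rule N.measurable_emeasure_Pair[OF E(2)])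
  finally have "measure (M \<Otimes>\<^sub>M N) ?E1 \<le> K * measure (M \<Otimes>\<^sub>M N) ?E0"
    by (simp add: MN.emeasure_eq_measure ennreal_mult[symmetric] K_def)
  then show ?thesis
    using rect[of S] rect[of "\<lambda>i. {x. x - h \<in> S i}"] by (simp add: S K_def)
qed

section \<open>Gaussian fields on finite networks\<close>

text \<open>The level set takes finitely many values, so an arbitrary predicate of it, such as one
  about its clusters, defines a measurable event.\<close>

lemma measurable_finite_level_set:
  fixes X :: "'v \<Rightarrow> 'a \<Rightarrow> real"
  assumes V: "finite V" and X: "\<And>p. p \<in> V \<Longrightarrow> X p \<in> borel_measurable M"
  shows "{\<omega> \<in> space M. Q {p \<in> V. h \<le> X p \<omega>}} \<in> sets M"
proof -
  have "{\<omega> \<in> space M. Q {p \<in> V. h \<le> X p \<omega>}}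
      = (\<Union>S\<in>{S \<in> Pow V. Q S}. {\<omega> \<in> space M. \<forall>p\<in>V. h \<le> X p \<omega> \<longleftrightarrow> p \<in> S})"
  proof (intro set_eqI iffI)
    fix \<omega> assume "\<omega> \<in> {\<omega> \<in> space M. Q {p \<in> V. h \<le> X p \<omega>}}"
    then show "\<omega> \<in> (\<Union>S\<in>{S \<in> Pow V. Q S}. {\<omega> \<in> space M. \<forall>p\<in>V. h \<le> X p \<omega> \<longleftrightarrow> p \<in> S})"
      by (intro UN_I[of "{p \<in> V. h \<le> X p \<omega>}"]) auto
  next
    fix \<omega> assume "\<omega> \<in> (\<Union>S\<in>{S \<in> Pow V. Q S}. {\<omega> \<in> space M. \<forall>p\<in>V. h \<le> X p \<omega> \<longleftrightarrow> p \<in> S})"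
    then obtain S where S: "S \<subseteq> V" "Q S" "\<omega> \<in> space M" "\<forall>p\<in>V. h \<le> X p \<omega> \<longleftrightarrow> p \<in> S" by auto
    then have "{p \<in> V. h \<le> X p \<omega>} = S" by auto
    then show "\<omega> \<in> {\<omega> \<in> space M. Q {p \<in> V. h \<le> X p \<omega>}}" using S by auto
  qed
  moreover have "{\<omega> \<in> space M. \<forall>p\<in>V. h \<le> X p \<omega> \<longleftrightarrow> p \<in> S} \<in> sets M" for S
  proof -
    note [measurable] = X
    show ?thesis using V by measurable
  qed
  ultimately show ?thesis using V by (auto intro!: sets.finite_UN)
qed

text \<open>All edges have the same conductance \<open>w\<close>, and \<kappa> is the conductance to
  a grounded vertex outside \<open>V\<close>. Edges have their own index type, so that summing over
  them does not require identifying them by their ends.\<close>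

locale network =
  fixes V :: "'v set" and EE :: "'e set" and src tgt :: "'e \<Rightarrow> 'v" and w :: real and \<kappa> :: "'v \<Rightarrow> real"
  assumes finV: "finite V" and finE: "finite EE"
    and src_in: "\<And>e. e \<in> EE \<Longrightarrow> src e \<in> V" and tgt_in: "\<And>e. e \<in> EE \<Longrightarrow> tgt e \<in> V"
    and w_pos: "0 < w" and \<kappa>_nonneg: "\<And>p. 0 \<le> \<kappa> p"
begin

definition cond :: "'v \<Rightarrow> 'v \<Rightarrow> real" where
  "cond p q = (\<Sum>e\<in>EE. w * (of_bool (src e = p \<and> tgt e = q) + of_bool (src e = q \<and> tgt e = p)))"

definition adj :: "'v \<Rightarrow> 'v \<Rightarrow> bool" where
  "adj p q \<longleftrightarrow> (\<exists>e\<in>EE. src e = p \<and> tgt e = q \<or> src e = q \<and> tgt e = p)"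

definition L :: "('v \<Rightarrow> real) \<Rightarrow> 'v \<Rightarrow> real" where
  "L f p = (\<Sum>q\<in>V. cond p q * (f p - f q)) + \<kappa> p * f p"

definition energy :: "('v \<Rightarrow> real) \<Rightarrow> ('v \<Rightarrow> real) \<Rightarrow> real" where
  "energy f g = (\<Sum>e\<in>EE. w * ((f (src e) - f (tgt e)) * (g (src e) - g (tgt e)))) + (\<Sum>p\<in>V. \<kappa> p * (f p * g p))"

lemma cond_nonneg: "0 \<le> cond p q"
  unfolding cond_def using w_pos by (intro sum_nonneg mult_nonneg_nonneg add_nonneg_nonneg) simp_all

text \<open>Summation by parts: \<open>cond\<close> sees every edge from both of its ends, and the
  two contributions combine into a product of differences.\<close>

lemma sum_L: "(\<Sum>p\<in>V. L f p * g p) = energy f g"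
proof -
  have "(\<Sum>p\<in>V. (\<Sum>q\<in>V. cond p q * (f p - f q)) * g p)
    = (\<Sum>p\<in>V. \<Sum>q\<in>V. \<Sum>e\<in>EE. w * (of_bool (src e = p \<and> tgt e = q) + of_bool (src e = q \<and> tgt e = p)) * (f p - f q) * g p)"
    by (simp add: cond_def sum_distrib_right)
  also have "\<dots> = (\<Sum>e\<in>EE. \<Sum>p\<in>V. \<Sum>q\<in>V. w * (of_bool (src e = p \<and> tgt e = q) + of_bool (src e = q \<and> tgt e = p)) * (f p - f q) * g p)"
    by (subst sum.swap[of _ EE]) (intro sum.cong refl sum.swap)
  also have "\<dots> = (\<Sum>e\<in>EE. w * ((f (src e) - f (tgt e)) * (g (src e) - g (tgt e))))"
  proof (intro sum.cong refl)
    fix e assume e: "e \<in> EE"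
    have "(\<Sum>p\<in>V. \<Sum>q\<in>V. w * (of_bool (src e = p \<and> tgt e = q) + of_bool (src e = q \<and> tgt e = p)) * (f p - f q) * g p)
      = (\<Sum>p\<in>V. \<Sum>q\<in>V. if src e = p then if tgt e = q then w * (f p - f q) * g p else 0 else 0)
      + (\<Sum>p\<in>V. \<Sum>q\<in>V. if tgt e = p then if src e = q then w * (f p - f q) * g p else 0 else 0)"
      unfolding sum.distrib[symmetric] by (intro sum.cong refl) (auto simp: algebra_simps)
    also have "\<dots> = w * (f (src e) - f (tgt e)) * g (src e) + w * (f (tgt e) - f (src e)) * g (tgt e)"
    proof -
      have *: "(\<Sum>q\<in>V. if a then F q else 0) = (if a then \<Sum>q\<in>V. F q else 0)" for a and F :: "'v \<Rightarrow> real" by simp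
      show ?thesis unfolding * using finV src_in[OF e] tgt_in[OF e] by (simp add: sum.delta')
    qed
    finally show "(\<Sum>p\<in>V. \<Sum>q\<in>V. w * (of_bool (src e = p \<and> tgt e = q) + of_bool (src e = q \<and> tgt e = p)) * (f p - f q) * g p)
       = w * ((f (src e) - f (tgt e)) * (g (src e) - g (tgt e)))" by (simp add: algebra_simps)
  qed
  finally have eq: "(\<Sum>p\<in>V. (\<Sum>q\<in>V. cond p q * (f p - f q)) * g p)
    = (\<Sum>e\<in>EE. w * ((f (src e) - f (tgt e)) * (g (src e) - g (tgt e))))" .
  have "(\<Sum>p\<in>V. L f p * g p) = (\<Sum>p\<in>V. (\<Sum>q\<in>V. cond p q * (f p - f q)) * g p) + (\<Sum>p\<in>V. \<kappa> p * f p * g p)"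
    unfolding L_def distrib_right sum.distrib ..
  then show ?thesis unfolding eq energy_def mult.assoc[of "\<kappa> _"] .
qed

text \<open>\<open>F k p\<close> is the probability that the killed walk with these conductances
  reaches \<open>A\<close> within k steps. The iterates increase and stay below 1, and their limit
  satisfies the mean value equation off \<open>A\<close>.\<close>

lemma equilibrium:
  assumes "A \<subseteq> V"
  obtains f where "\<And>p. p \<in> A \<Longrightarrow> f p = 1" "\<And>p. 0 \<le> f p \<and> f p \<le> 1" "\<And>p. p \<in> V - A \<Longrightarrow> L f p = 0"
proof -
  define d where "d p = (\<Sum>q\<in>V. cond p q) + \<kappa> p" for p
  have d0: "0 \<le> d p" for p using cond_nonneg \<kappa>_nonneg by (auto simp: d_def intro!: add_nonneg_nonneg sum_nonneg)
  define F where "F = rec_nat (\<lambda>p. of_bool (p \<in> A)) (\<lambda>_ f p. if p \<in> A then 1 else (\<Sum>q\<in>V. cond p q * f q) / d p :: real)"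
  have F0: "F 0 p = of_bool (p \<in> A)" and FS: "F (Suc k) p = (if p \<in> A then 1 else (\<Sum>q\<in>V. cond p q * F k q) / d p)" for k p
    by (auto simp: F_def)
  have nn: "0 \<le> F k p" for k p
    by (induction k arbitrary: p) (auto simp: F0 FS intro!: divide_nonneg_nonneg sum_nonneg mult_nonneg_nonneg cond_nonneg d0)
  have le1: "F k p \<le> 1" for k p
  proof (induction k arbitrary: p)
    case (Suc k)
    have "(\<Sum>q\<in>V. cond p q * F k q) \<le> (\<Sum>q\<in>V. cond p q)"
      using Suc by (intro sum_mono) (simp add: cond_nonneg mult_left_le)
    also have "\<dots> \<le> d p" using \<kappa>_nonneg by (simp add: d_def)
    finally have le: "(\<Sum>q\<in>V. cond p q * F k q) \<le> d p" .
    have "x / d p \<le> 1" if "x \<le> d p" for x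
      using that d0[of p] by (cases "d p = 0") auto
    from this[OF le] show ?case unfolding FS by simp
  qed (simp add: F0)
  have mono: "F k p \<le> F (Suc k) p" for k p
  proof (induction k arbitrary: p)
    case 0
    show ?case
    proof (cases "p \<in> A")
      case True
      then show ?thesis unfolding FS F0 by simp
    next
      case False
      then show ?thesis using nn[of "Suc 0" p] unfolding F0 by simp
    qed
  next
    case (Suc k)
    then have "(\<Sum>q\<in>V. cond p q * F k q) / d p \<le> (\<Sum>q\<in>V. cond p q * F (Suc k) q) / d p"
      by (intro divide_right_mono sum_mono mult_left_mono cond_nonneg d0)
    then show ?case unfolding FS[of "Suc k"] FS[of k p] by simp
  qed
  have "\<exists>l. (\<lambda>k. F k p) \<longlonglongrightarrow> l" for p
    by (rule incseq_convergent[of "\<lambda>k. F k p" 1]) (auto intro: incseq_SucI mono le1)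
  then obtain f where f: "\<And>p. (\<lambda>k. F k p) \<longlonglongrightarrow> f p" by metis
  show thesis
  proof
    show "f p = 1" if "p \<in> A" for p
    proof -
      have "F k p = 1" for k using that by (cases k) (auto simp: F0 FS)
      then show ?thesis using LIMSEQ_unique[OF f[of p]] by simp
    qed
    show "0 \<le> f p \<and> f p \<le> 1" for p
      using f[of p] nn le1 by (auto intro: LIMSEQ_le_const LIMSEQ_le_const2)
    show "L f p = 0" if "p \<in> V - A" for p
    proof -
      have "(\<lambda>k. F (Suc k) p) \<longlonglongrightarrow> (\<Sum>q\<in>V. cond p q * f q) / d p" if "d p \<noteq> 0"
        using \<open>p \<in> V - A\<close> that unfolding FS by (auto intro!: tendsto_intros f)
      then have eq: "f p * d p = (\<Sum>q\<in>V. cond p q * f q)" if "d p \<noteq> 0"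
        using LIMSEQ_unique[OF LIMSEQ_Suc[OF f[of p]]] that by (simp add: field_simps)
      have "L f p = f p * d p - (\<Sum>q\<in>V. cond p q * f q)"
        by (simp add: L_def d_def algebra_simps sum_subtractf sum_distrib_left)
      \<comment> \<open>If \<open>d p = 0\<close>, the iteration divided by zero and says nothing
        about \<open>p\<close>; but then all conductances at \<open>p\<close> vanish and the
        equation is trivial.\<close>
      moreover have "(\<Sum>q\<in>V. cond p q * f q) = 0" if "d p = 0"
      proof -
        have "(\<Sum>q\<in>V. cond p q) = 0" using that \<kappa>_nonneg[of p] sum_nonneg[of V "cond p"] cond_nonneg
          by (simp add: d_def add_nonneg_eq_0_iff)
        then show ?thesis using finV cond_nonneg by (simp add: sum_nonneg_eq_0_iff)
      qed
      ultimately show ?thesis using eq by fastforce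
    qed
  qed
qed

section \<open>Clusters and their outer boundary\<close>

definition cluster :: "'v \<Rightarrow> 'v set \<Rightarrow> 'v set" where
  "cluster x S = {q. x \<in> S \<and> (x, q) \<in> {(p, q). adj p q \<and> p \<in> S \<and> q \<in> S}\<^sup>*}"

definition bdry :: "'v set \<Rightarrow> 'v set" where
  "bdry K = {q \<in> V - K. \<exists>p\<in>K. adj p q}"

lemma cluster_self: "x \<in> S \<Longrightarrow> x \<in> cluster x S"
  by (simp add: cluster_def)

lemma cluster_subset: "cluster x S \<subseteq> S"
proof
  fix q assume "q \<in> cluster x S"
  then have "(x, q) \<in> {(p, q). adj p q \<and> p \<in> S \<and> q \<in> S}\<^sup>*" "x \<in> S" by (auto simp: cluster_def)
  then show "q \<in> S" by (induction rule: rtrancl_induct) auto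
qed

lemma cluster_step:
  assumes "p \<in> cluster x S" "adj p q" "q \<in> S"
  shows "q \<in> cluster x S"
proof -
  let ?R = "{(p, q). adj p q \<and> p \<in> S \<and> q \<in> S}"
  have "(p, q) \<in> ?R" using assms cluster_subset[of x S] by blast
  moreover have "(x, p) \<in> ?R\<^sup>*" "x \<in> S" using assms(1) by (simp_all add: cluster_def)
  ultimately have "(x, q) \<in> ?R\<^sup>*" by (meson rtrancl_into_rtrancl)
  with \<open>x \<in> S\<close> show ?thesis by (simp add: cluster_def)
qed

lemma cluster_induct [consumes 1, case_names base step]:
  assumes "q \<in> cluster x S" "P x"
    and "\<And>p q. p \<in> cluster x S \<Longrightarrow> q \<in> cluster x S \<Longrightarrow> adj p q \<Longrightarrow> P p \<Longrightarrow> P q"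
  shows "P q"
proof -
  have "(x, q) \<in> {(p, q). adj p q \<and> p \<in> S \<and> q \<in> S}\<^sup>*" "x \<in> S" using assms(1) by (auto simp: cluster_def)
  then have "P q \<and> q \<in> cluster x S"
  proof (induction rule: rtrancl_induct)
    case base
    then show ?case using assms(2) cluster_self by auto
  next
    case (step p q)
    then show ?case using assms(3)[of p q] cluster_step[of p x S q] by auto
  qed
  then show ?thesis ..
qed

text \<open>Locality: whether the cluster is \<open>K\<close> depends only on the state of the
  vertices of \<open>K\<close> and \<open>bdry K\<close>. That \<open>K\<close> is a cluster of some
  \<open>S0\<close> expresses that it is connected and contains \<open>x\<close>; a path inside
  \<open>K\<close> stays available in \<open>S\<close>, and a path that left \<open>K\<close> would
  have to use \<open>bdry K\<close>.\<close>

lemma cluster_eq: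
  assumes K: "K = cluster x S0" "x \<in> S0" and sub: "K \<subseteq> S" "S \<subseteq> V" "bdry K \<inter> S = {}"
  shows "cluster x S = K"
proof
  have xS: "x \<in> S" using K sub cluster_self by auto
  show "cluster x S \<subseteq> K"
  proof
    fix q assume "q \<in> cluster x S"
    then show "q \<in> K"
    proof (induction rule: cluster_induct)
      case base
      then show ?case using K cluster_self by auto
    next
      case (step p q)
      then show ?case using sub cluster_subset[of x S] by (auto simp: bdry_def)
    qed
  qed
  show "K \<subseteq> cluster x S"
  proof
    fix q assume "q \<in> K"
    then have "q \<in> cluster x S0" using K by simp
    then show "q \<in> cluster x S"
    proof (induction rule: cluster_induct)
      case base
      then show ?case using xS cluster_self by auto
    next
      case (step p q)
      then show ?case using K sub by (auto intro: cluster_step)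
    qed
  qed
qed

lemma bdry_cluster: "S \<subseteq> V \<Longrightarrow> bdry (cluster x S) \<inter> S = {}"
  unfolding bdry_def using cluster_step by blast

text \<open>The total killing bounds the mass of every equilibrium measure, hence the coefficient of
  \<epsilon> in the shift.\<close>

definition total :: real where "total = (\<Sum>p\<in>V. \<kappa> p)"

end

section \<open>Gaussian fields whose covariance inverts the network Laplacian\<close>

text \<open>\<open>green_inverse\<close> states in weak form that the covariance matrix is the
  inverse of \<open>L\<close>: the field integrated against \<open>L f\<close> has covariance
  \<open>f r\<close> with the value at \<open>r\<close>.\<close>

locale gaussian_network = network V EE src tgt w \<kappa> + prob_space M
  for V :: "'v set" and EE :: "'e set" and src tgt w \<kappa> and M :: "'a measure" +
  fixes X :: "'v \<Rightarrow> 'a \<Rightarrow> real"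
  assumes X: "centred_gaussian_field M V X"
    and green_inverse: "\<And>f r. r \<in> V \<Longrightarrow> (\<integral>\<omega>. (\<Sum>p\<in>V. L f p * X p \<omega>) * X r \<omega> \<partial>M) = f r"
begin

lemma X_measurable: "p \<in> V \<Longrightarrow> X p \<in> borel_measurable M"
  using X by (auto simp: centred_gaussian_field_def)

definition functional :: "('v \<Rightarrow> real) \<Rightarrow> 'a \<Rightarrow> real" where
  "functional f \<omega> = (\<Sum>p\<in>V. L f p * X p \<omega>)"

lemma centred_normal_X: "p \<in> V \<Longrightarrow> centred_normal M (X p)"
  by (rule centred_gaussian_field_single[OF X])

lemma centred_normal_functional: "centred_normal M (functional f)"
  unfolding functional_def by (rule centred_gaussian_field_sum[OF X finV])

lemma functional_cov: "r \<in> V \<Longrightarrow> (\<integral>\<omega>. functional f \<omega> * X r \<omega> \<partial>M) = f r"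
  unfolding functional_def by (rule green_inverse)

lemma functional_variance: "(\<integral>\<omega>. (functional f \<omega>)\<^sup>2 \<partial>M) = energy f f"
proof -
  have "(\<integral>\<omega>. (functional f \<omega>)\<^sup>2 \<partial>M) = (\<integral>\<omega>. (\<Sum>p\<in>V. L f p * (functional f \<omega> * X p \<omega>)) \<partial>M)"
    by (intro Bochner_Integration.integral_cong refl)
       (simp add: power2_eq_square functional_def[of f] sum_distrib_left mult_ac)
  also have "\<dots> = (\<Sum>p\<in>V. L f p * (\<integral>\<omega>. functional f \<omega> * X p \<omega> \<partial>M))"
    by (subst Bochner_Integration.integral_sum)
       (auto intro!: integrable_mult_right centred_normal_mult_integrable centred_normal_functional centred_normal_X)
  finally show ?thesis by (simp add: functional_cov sum_L)
qed

text \<open>Expand E (functional f - X r)^2, which is nonnegative. Every test function thus gives a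
  lower bound for the variance.\<close>

lemma variance_lower:
  assumes r: "r \<in> V"
  shows "2 * f r - energy f f \<le> (\<integral>\<omega>. (X r \<omega>)\<^sup>2 \<partial>M)"
proof -
  let ?W = "functional f"
  note cn = centred_normal_functional[of f] centred_normal_X[OF r]
  have "0 \<le> (\<integral>\<omega>. (?W \<omega> - X r \<omega>)\<^sup>2 \<partial>M)" by simp
  also have "\<dots> = (\<integral>\<omega>. (?W \<omega>)\<^sup>2 - 2 * (?W \<omega> * X r \<omega>) + (X r \<omega>)\<^sup>2 \<partial>M)"
    by (intro Bochner_Integration.integral_cong refl) (simp add: power2_diff)
  also have "\<dots> = energy f f - 2 * f r + (\<integral>\<omega>. (X r \<omega>)\<^sup>2 \<partial>M)"
    using centred_normal_moments(1)[OF cn(1)] centred_normal_moments(1)[OF cn(2)] centred_normal_mult_integrable[OF cn]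
    by (simp add: functional_variance functional_cov[OF r])
  finally show ?thesis by simp
qed

text \<open>For the equilibrium potential \<open>f\<close> of \<open>K\<close> and its boundary,
  \<open>L f\<close> is the equilibrium measure: it is nonnegative, carried by that set, and the
  field integrated against it has covariance 1 with the field there. So it provides the weights of
  \<open>cameron_martin_rectangle\<close>.\<close>

lemma cylinder_shift:
  assumes K: "K \<subseteq> V" "x \<in> K" and h: "0 \<le> h" and \<epsilon>: "0 \<le> \<epsilon>"
    and cap: "\<And>f. (\<And>p. p \<in> K \<Longrightarrow> f p = 1) \<Longrightarrow> \<tau> \<le> energy f f"
  shows "prob {\<omega> \<in> space M. (\<forall>p\<in>K. h \<le> X p \<omega>) \<and> (\<forall>p\<in>bdry K. h - \<epsilon> \<le> X p \<omega> \<and> X p \<omega> < h)}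
    \<le> exp (h * \<epsilon> * total - h\<^sup>2 * \<tau> / 2) * 
      prob {\<omega> \<in> space M. (\<forall>p\<in>K. 0 \<le> X p \<omega>) \<and> (\<forall>p\<in>bdry K. - \<epsilon> \<le> X p \<omega> \<and> X p \<omega> < 0)}"
proof -
  define A where "A = K \<union> bdry K"
  have A: "A \<subseteq> V" "finite A" "K \<subseteq> A" using K finV by (auto simp: A_def bdry_def intro: finite_subset)
  obtain f where f: "\<And>p. p \<in> A \<Longrightarrow> f p = 1" "\<And>p. 0 \<le> f p \<and> f p \<le> 1" "\<And>p. p \<in> V - A \<Longrightarrow> L f p = 0"
    using equilibrium[OF A(1)] by metis
  have L0: "0 \<le> L f p" if "p \<in> A" for p
    unfolding L_def using f(1)[OF that] f(2) cond_nonneg \<kappa>_nonneg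
    by (auto intro!: add_nonneg_nonneg sum_nonneg mult_nonneg_nonneg)
  have sumA: "(\<Sum>p\<in>A. L f p * g p) = (\<Sum>p\<in>V. L f p * g p)" for g
    using A finV f(3) by (intro sum.mono_neutral_left) auto
  define v where "v = (\<Sum>p\<in>A. L f p)"
  have "v = (\<Sum>p\<in>A. L f p * f p)" unfolding v_def using f(1) by simp
  then have v_energy: "v = energy f f" by (simp add: sumA sum_L)
  then have "\<tau> \<le> v" using cap[of f] f(1) A by auto
  have "v = energy f (\<lambda>_. 1)" unfolding v_def using sumA[of "\<lambda>_. 1"] by (simp add: sum_L[symmetric])
  also have "\<dots> \<le> total"
    using f(2) \<kappa>_nonneg by (auto simp: energy_def total_def intro!: sum_mono mult_left_le)
  finally have "v \<le> total" .
  have XA: "centred_gaussian_field M A X" using X A unfolding centred_gaussian_field_def by blast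
  have Z: "(\<Sum>p\<in>A. L f p * X p \<omega>) = functional f \<omega>" for \<omega>
    unfolding functional_def by (rule sumA)
  have one: "(\<integral>\<omega>. functional f \<omega> * X p \<omega> \<partial>M) = 1" if "p \<in> A" for p
    using functional_cov[of p f] that A f(1) by auto
  \<comment> \<open>Capacity zero would make the functional vanish almost surely, although its
    covariance with \<open>X x\<close> is 1.\<close>
  have "0 < v"
  proof (rule ccontr)
    assume "\<not> 0 < v"
    moreover have "0 \<le> v" unfolding v_def using L0 by (rule sum_nonneg)
    ultimately have "(\<integral>\<omega>. (functional f \<omega>)\<^sup>2 \<partial>M) = 0" using v_energy by (simp add: functional_variance)
    then have "AE \<omega> in M. (functional f \<omega>)\<^sup>2 = 0"
      using integral_nonneg_eq_0_iff_AE[OF centred_normal_moments(1)[OF centred_normal_functional]] by simp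
    then have "(\<integral>\<omega>. functional f \<omega> * X x \<omega> \<partial>M) = 0" by (intro integral_eq_zero_AE) auto
    then show False using one[of x] K A by auto
  qed
  define S where "S p = (if p \<in> K then {0..} else {- \<epsilon>..<0::real})" for p
  \<comment> \<open>After subtraction of the level all coordinates are at least -\<epsilon>, and the
    nonnegative weights add up to v, which is at most \<open>total\<close>.\<close>
  have low: "- (\<epsilon> * total) \<le> (\<Sum>p\<in>A. L f p * y p)" if "\<And>p. p \<in> A \<Longrightarrow> y p \<in> S p" for y
  proof -
    have "- (\<epsilon> * total) \<le> - \<epsilon> * v" using \<open>v \<le> total\<close> \<epsilon> by (simp add: mult_left_mono)
    also have "\<dots> = (\<Sum>p\<in>A. L f p * (- \<epsilon>))" by (simp add: v_def sum_distrib_left sum_negf mult.commute)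
    also have "\<dots> \<le> (\<Sum>p\<in>A. L f p * y p)"
      using that \<epsilon> by (intro sum_mono mult_left_mono L0) (force simp: S_def split: if_splits)+
    finally show ?thesis .
  qed
  have "prob {\<omega> \<in> space M. \<forall>p\<in>A. X p \<omega> - h \<in> S p}
     \<le> exp (h * (\<epsilon> * total) - h\<^sup>2 * v / 2) * prob {\<omega> \<in> space M. \<forall>p\<in>A. X p \<omega> \<in> S p}"
    by (rule cameron_martin_rectangle[OF prob_space_axioms A(2) XA _ v_def \<open>0 < v\<close> _ low h])
       (auto simp: Z one S_def)
  also have "\<dots> \<le> exp (h * \<epsilon> * total - h\<^sup>2 * \<tau> / 2) * prob {\<omega> \<in> space M. \<forall>p\<in>A. X p \<omega> \<in> S p}"
    using \<open>\<tau> \<le> v\<close> by (intro mult_right_mono) (auto intro!: mult_left_mono)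
  finally have *: "prob {\<omega> \<in> space M. \<forall>p\<in>A. X p \<omega> - h \<in> S p}
     \<le> exp (h * \<epsilon> * total - h\<^sup>2 * \<tau> / 2) * prob {\<omega> \<in> space M. \<forall>p\<in>A. X p \<omega> \<in> S p}" .
  have S_iff: "(\<forall>p\<in>A. y p - c \<in> S p) \<longleftrightarrow> (\<forall>p\<in>K. c \<le> y p) \<and> (\<forall>p\<in>bdry K. c - \<epsilon> \<le> y p \<and> y p < c)" for y c
    unfolding A_def S_def by (auto simp: bdry_def algebra_simps)
  show ?thesis using * unfolding S_iff using S_iff[of _ 0] by simp
qed

definition level :: "real \<Rightarrow> 'a \<Rightarrow> 'v set" where
  "level h \<omega> = {p \<in> V. h \<le> X p \<omega>}"

definition jump :: "real \<Rightarrow> 'a set" where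
  "jump \<epsilon> = {\<omega> \<in> space M. \<exists>e\<in>EE. \<epsilon> < \<bar>X (src e) \<omega> - X (tgt e) \<omega>\<bar>}"

lemma level_measurable: "{\<omega> \<in> space M. Q (level h \<omega>)} \<in> events"
  unfolding level_def by (rule measurable_finite_level_set[OF finV X_measurable])

lemma jump_measurable: "jump \<epsilon> \<in> events"
proof -
  have [measurable]: "e \<in> EE \<Longrightarrow> X (src e) \<in> borel_measurable M" "e \<in> EE \<Longrightarrow> X (tgt e) \<in> borel_measurable M" for e
    using X_measurable src_in tgt_in by auto
  show ?thesis unfolding jump_def using finE by measurable
qed

text \<open>The events \<open>D h K\<close> force the cluster to be \<open>K\<close>. Outside
  \<open>jump \<epsilon>\<close> they cover the event at level h; at level 0 they are disjoint and
  contained in the event, so the bounds for single \<open>K\<close> can be summed. \<open>Q\<close>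
  is kept arbitrary because it is applied both to clusters that meet a target and to clusters that
  avoid it.\<close>

lemma level_shift:
  assumes x: "x \<in> V" and h: "0 \<le> h" and \<epsilon>: "0 \<le> \<epsilon>"
    and cap: "\<And>S f. S \<subseteq> V \<Longrightarrow> x \<in> S \<Longrightarrow> Q (cluster x S) \<Longrightarrow> (\<And>p. p \<in> cluster x S \<Longrightarrow> f p = 1) \<Longrightarrow> \<tau> \<le> energy f f"
  shows "prob {\<omega> \<in> space M. x \<in> level h \<omega> \<and> Q (cluster x (level h \<omega>))}
    \<le> exp (h * \<epsilon> * total - h\<^sup>2 * \<tau> / 2) * prob {\<omega> \<in> space M. x \<in> level 0 \<omega> \<and> Q (cluster x (level 0 \<omega>))}
      + prob (jump \<epsilon>)"
proof -
  let ?c = "exp (h * \<epsilon> * total - h\<^sup>2 * \<tau> / 2)"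
  define E where "E h = {\<omega> \<in> space M. x \<in> level h \<omega> \<and> Q (cluster x (level h \<omega>))}" for h
  define \<C> where "\<C> = {K \<in> Pow V. \<exists>S\<subseteq>V. x \<in> S \<and> K = cluster x S \<and> Q K}"
  have fin: "finite \<C>" using finV by (simp add: \<C>_def)
  define D where "D h K = {\<omega> \<in> space M. (\<forall>p\<in>K. h \<le> X p \<omega>) \<and> (\<forall>p\<in>bdry K. h - \<epsilon> \<le> X p \<omega> \<and> X p \<omega> < h)}" for h K
  have Dm: "D h K \<in> events" if "K \<in> \<C>" for h K
  proof -
    have "K \<subseteq> V" "finite K" "bdry K \<subseteq> V" "finite (bdry K)" 
      using that finV by (auto simp: \<C>_def bdry_def intro: finite_subset)
    then have [measurable]: "p \<in> K \<Longrightarrow> X p \<in> borel_measurable M" "p \<in> bdry K \<Longrightarrow> X p \<in> borel_measurable M" for p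
      using X_measurable by auto
    show ?thesis unfolding D_def using \<open>finite K\<close> \<open>finite (bdry K)\<close> by measurable
  qed
  have UDm: "(\<Union>K\<in>\<C>. D h K) \<in> events" for h
    using fin Dm by (rule sets.finite_UN)
  have Dcl: "cluster x (level h \<omega>) = K" if "K \<in> \<C>" "\<omega> \<in> D h K" for K h \<omega>
  proof -
    obtain S0 where "K = cluster x S0" "x \<in> S0" "K \<subseteq> V" using \<open>K \<in> \<C>\<close> by (auto simp: \<C>_def)
    then show ?thesis
      using \<open>\<omega> \<in> D h K\<close> by (intro cluster_eq) (force simp: D_def level_def)+
  qed
  have K: "K \<subseteq> V" "x \<in> K" "Q K" if "K \<in> \<C>" for K
    using that cluster_self by (auto simp: \<C>_def)
  have "E h \<subseteq> (\<Union>K\<in>\<C>. D h K) \<union> jump \<epsilon>"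
  proof
    fix \<omega> assume "\<omega> \<in> E h"
    then have \<omega>: "\<omega> \<in> space M" "x \<in> level h \<omega>" "Q (cluster x (level h \<omega>))" by (simp_all add: E_def)
    let ?S = "level h \<omega>"
    let ?K = "cluster x ?S"
    have SV: "?S \<subseteq> V" by (auto simp: level_def)
    have KC: "?K \<in> \<C>" using \<omega> SV cluster_subset[of x ?S] unfolding \<C>_def by blast
    show "\<omega> \<in> (\<Union>K\<in>\<C>. D h K) \<union> jump \<epsilon>"
    proof (cases "\<omega> \<in> jump \<epsilon>")
      case False
      have "\<omega> \<in> D h ?K"
      proof -
        have "h \<le> X p \<omega>" if "p \<in> ?K" for p using cluster_subset[of x ?S] that by (auto simp: level_def)
        moreover have "h - \<epsilon> \<le> X q \<omega> \<and> X q \<omega> < h" if q: "q \<in> bdry ?K" for q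
        proof
          have "q \<in> V" "q \<notin> ?S" using q bdry_cluster[OF SV] by (auto simp: bdry_def)
          then show "X q \<omega> < h" by (auto simp: level_def)
          obtain p where p: "p \<in> ?K" "adj p q" using q by (auto simp: bdry_def)
          then obtain e where e: "e \<in> EE" "src e = p \<and> tgt e = q \<or> src e = q \<and> tgt e = p"
            by (auto simp: adj_def)
          have "\<bar>X (src e) \<omega> - X (tgt e) \<omega>\<bar> \<le> \<epsilon>" using False e(1) \<omega> by (force simp: jump_def)
          moreover have "h \<le> X p \<omega>" using p(1) cluster_subset[of x ?S] by (auto simp: level_def)
          ultimately show "h - \<epsilon> \<le> X q \<omega>" using e(2) by auto
        qed
        ultimately show ?thesis using \<omega> by (simp add: D_def)
      qed
      with KC show ?thesis by blast
    qed simp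
  qed
  then have "prob (E h) \<le> prob ((\<Union>K\<in>\<C>. D h K) \<union> jump \<epsilon>)"
    using UDm jump_measurable by (intro finite_measure_mono) auto
  also have "\<dots> \<le> prob (\<Union>K\<in>\<C>. D h K) + prob (jump \<epsilon>)"
    using UDm jump_measurable by (intro measure_Un_le)
  also have "prob (\<Union>K\<in>\<C>. D h K) \<le> (\<Sum>K\<in>\<C>. prob (D h K))"
    using fin Dm by (intro finite_measure_subadditive_finite) auto
  also have "\<dots> \<le> (\<Sum>K\<in>\<C>. ?c * prob (D 0 K))"
  proof (rule sum_mono)
    fix K assume KC: "K \<in> \<C>"
    have "\<tau> \<le> energy f f" if "\<And>p. p \<in> K \<Longrightarrow> f p = 1" for f
      using cap[of _ f] KC that by (auto simp: \<C>_def)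
    from cylinder_shift[OF K(1,2)[OF KC] h \<epsilon> this]
    show "prob (D h K) \<le> ?c * prob (D 0 K)"
      by (simp add: D_def)
  qed
  also have "\<dots> = ?c * prob (\<Union>K\<in>\<C>. D 0 K)"
  proof -
    have "disjoint_family_on (D 0) \<C>" using Dcl[of _ _ 0] unfolding disjoint_family_on_def by blast
    then show ?thesis
      using fin Dm by (subst finite_measure_finite_Union) (auto simp: sum_distrib_left)
  qed
  also have "prob (\<Union>K\<in>\<C>. D 0 K) \<le> prob (E 0)"
  proof (rule finite_measure_mono)
    show "(\<Union>K\<in>\<C>. D 0 K) \<subseteq> E 0"
    proof
      fix \<omega> assume "\<omega> \<in> (\<Union>K\<in>\<C>. D 0 K)"
      then obtain K where KC: "K \<in> \<C>" and \<omega>: "\<omega> \<in> D 0 K" by blast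
      have "x \<in> level 0 \<omega>" using K(1,2)[OF KC] \<omega> by (auto simp: D_def level_def)
      then show "\<omega> \<in> E 0"
        using \<omega> Dcl[OF KC \<omega>] K(3)[OF KC] by (simp add: D_def E_def)
    qed
    show "E 0 \<in> events" unfolding E_def
      by (rule level_measurable)
  qed
  finally show ?thesis by (simp add: E_def)
qed

text \<open>For the clusters of \<open>x\<close> that avoid \<open>T\<close>, the previous lemma with \<open>\<tau> = 0\<close> shows that
  raising the level from 0 to \<open>s\<close> does not make them more likely, up to jumps. Hence the connection
  probability drops by at most \<open>P(0 \<le> X x < s)\<close>, whereas by the first bound it drops by a fixed factor.\<close>

lemma connection_bounds:
  assumes x: "x \<in> V" and \<epsilon>: "0 \<le> \<epsilon>"
    and cap: "\<And>S f. S \<subseteq> V \<Longrightarrow> x \<in> S \<Longrightarrow> cluster x S \<inter> T \<noteq> {} \<Longrightarrow> (\<And>p. p \<in> cluster x S \<Longrightarrow> f p = 1) \<Longrightarrow> \<tau> \<le> energy f f"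
  defines "E \<equiv> \<lambda>h. {\<omega> \<in> space M. cluster x (level h \<omega>) \<inter> T \<noteq> {}}"
  shows "0 \<le> h \<Longrightarrow> prob (E h) \<le> exp (h * \<epsilon> * total - h\<^sup>2 * \<tau> / 2) * prob (E 0) + prob (jump \<epsilon>)"
    and "0 \<le> s \<Longrightarrow> prob (E 0) * (1 - exp (s * \<epsilon> * total - s\<^sup>2 * \<tau> / 2)) 
      \<le> prob {\<omega> \<in> space M. 0 \<le> X x \<omega> \<and> X x \<omega> < s} + (exp (s * \<epsilon> * total) - 1) + 2 * prob (jump \<epsilon>)"
proof -
  have E: "E h = {\<omega> \<in> space M. x \<in> level h \<omega> \<and> cluster x (level h \<omega>) \<inter> T \<noteq> {}}" for h
    unfolding E_def by (auto simp: cluster_def)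
  define F where "F h = {\<omega> \<in> space M. x \<in> level h \<omega> \<and> \<not> cluster x (level h \<omega>) \<inter> T \<noteq> {}}" for h
  have E_le: "prob (E h) \<le> exp (h * \<epsilon> * total - h\<^sup>2 * \<tau> / 2) * prob (E 0) + prob (jump \<epsilon>)" if "0 \<le> h" for h
    unfolding E by (rule level_shift[OF x that \<epsilon>]) (rule cap)
  then show "0 \<le> h \<Longrightarrow> prob (E h) \<le> exp (h * \<epsilon> * total - h\<^sup>2 * \<tau> / 2) * prob (E 0) + prob (jump \<epsilon>)" .
  have energy0: "0 \<le> energy f f" for f
    using w_pos \<kappa>_nonneg unfolding energy_def power2_eq_square[symmetric]
    by (auto intro!: add_nonneg_nonneg sum_nonneg mult_nonneg_nonneg)
  have total0: "0 \<le> total" unfolding total_def using \<kappa>_nonneg by (rule sum_nonneg)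
  assume s: "0 \<le> s"
  have "prob (F s) \<le> exp (s * \<epsilon> * total - s\<^sup>2 * 0 / 2) * prob (F 0) + prob (jump \<epsilon>)"
    unfolding F_def by (rule level_shift[OF x s \<epsilon>]) (rule energy0)
  \<comment> \<open>Since \<open>prob (F 0)\<close> is at most 1, the factor in front of it becomes
    an additive error that vanishes with \<epsilon>.\<close>
  moreover have "(exp (s * \<epsilon> * total) - 1) * prob (F 0) \<le> exp (s * \<epsilon> * total) - 1"
    using s \<epsilon> total0 by (intro mult_left_le) auto
  ultimately have F: "prob (F s) \<le> prob (F 0) + (exp (s * \<epsilon> * total) - 1) + prob (jump \<epsilon>)"
    by (simp add: algebra_simps)
  have EF: "prob {\<omega> \<in> space M. x \<in> level h \<omega>} = prob (E h) + prob (F h)" for h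
  proof -
    have "{\<omega> \<in> space M. x \<in> level h \<omega>} = E h \<union> F h" "E h \<inter> F h = {}" unfolding E F_def by auto
    moreover have "E h \<in> events" "F h \<in> events" unfolding E F_def by (rule level_measurable)+
    ultimately show ?thesis by (simp add: finite_measure_Union)
  qed
  have [measurable]: "X x \<in> borel_measurable M" by (rule X_measurable[OF x])
  have "prob {\<omega> \<in> space M. x \<in> level 0 \<omega>} = prob {\<omega> \<in> space M. 0 \<le> X x \<omega> \<and> X x \<omega> < s} + prob {\<omega> \<in> space M. x \<in> level s \<omega>}"
  proof -
    have "{\<omega> \<in> space M. x \<in> level 0 \<omega>} = {\<omega> \<in> space M. 0 \<le> X x \<omega> \<and> X x \<omega> < s} \<union> {\<omega> \<in> space M. x \<in> level s \<omega>}"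
      using x s by (auto simp: level_def)
    moreover have "{\<omega> \<in> space M. 0 \<le> X x \<omega> \<and> X x \<omega> < s} \<inter> {\<omega> \<in> space M. x \<in> level s \<omega>} = {}"
      by (auto simp: level_def)
    ultimately show ?thesis using level_measurable by (simp add: finite_measure_Union)
  qed
  then show "prob (E 0) * (1 - exp (s * \<epsilon> * total - s\<^sup>2 * \<tau> / 2)) 
      \<le> prob {\<omega> \<in> space M. 0 \<le> X x \<omega> \<and> X x \<omega> < s} + (exp (s * \<epsilon> * total) - 1) + 2 * prob (jump \<epsilon>)"
    using E_le[OF s] F by (simp add: EF algebra_simps)
qed

end

section \<open>Dirichlet energy on a square\<close>

definition square :: "int \<Rightarrow> vertex set" where
  "square N = {-N..N} \<times> {-N..N}"

text \<open>The range from -N-1 to N includes the two edges by which each row leaves the square, so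
  for functions that vanish outside this is the Dirichlet form with zero boundary values.\<close>

definition hform :: "int \<Rightarrow> (vertex \<Rightarrow> real) \<Rightarrow> (vertex \<Rightarrow> real) \<Rightarrow> real" where
  "hform N f g = (\<Sum>b\<in>{-N..N}. \<Sum>a\<in>{-N-1..N}. (f (a + 1, b) - f (a, b)) * (g (a + 1, b) - g (a, b)))"

definition vform :: "int \<Rightarrow> (vertex \<Rightarrow> real) \<Rightarrow> (vertex \<Rightarrow> real) \<Rightarrow> real" where
  "vform N f g = (\<Sum>a\<in>{-N..N}. \<Sum>b\<in>{-N-1..N}. (f (a, b + 1) - f (a, b)) * (g (a, b + 1) - g (a, b)))"

lemma sum_int_Suc_top: "l \<le> k + 1 \<Longrightarrow> (\<Sum>a\<in>{l..k + 1}. F a) = (\<Sum>a\<in>{l..k}. F a) + (F (k + 1) :: real)" for l k :: int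
proof -
  assume "l \<le> k + 1"
  then have "{l..k + 1} = insert (k + 1) {l..k}" by auto
  then show ?thesis by simp
qed

lemma summation_by_parts_int:
  fixes u w :: "int \<Rightarrow> real"
  assumes "l \<le> k"
  shows "(\<Sum>a\<in>{l..k}. (u (a + 1) - u a) * (w (a + 1) - w a))
    = u (k + 1) * (w (k + 1) - w k) - u l * (w (l + 1) - w l) + (\<Sum>a\<in>{l + 1..k}. u a * (2 * w a - w (a + 1) - w (a - 1)))"
  using assms
proof (induction k rule: int_ge_induct)
  case base
  then show ?case by (simp add: algebra_simps)
next
  case (step k)
  then show ?case by (simp add: sum_int_Suc_top) (simp add: algebra_simps)
qed

lemma summation_by_parts_dirichlet:
  fixes u w :: "int \<Rightarrow> real"
  assumes "0 \<le> N" "u (N + 1) = 0" "u (- N - 1) = 0"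
  shows "(\<Sum>a\<in>{-N-1..N}. (u (a + 1) - u a) * (w (a + 1) - w a)) = (\<Sum>a\<in>{-N..N}. u a * (2 * w a - w (a + 1) - w (a - 1)))"
  using summation_by_parts_int[of "-N-1" N u w] assms by simp

lemma dirichlet_form_laplacian:
  assumes N: "0 \<le> N" and f: "\<And>x. x \<notin> square N \<Longrightarrow> f x = 0"
  shows "hform N f g + vform N f g
    = (\<Sum>(a, b)\<in>square N. f (a, b) * (4 * g (a, b) - g (a + 1, b) - g (a - 1, b) - g (a, b + 1) - g (a, b - 1)))"
proof -
  have h: "hform N f g = (\<Sum>b\<in>{-N..N}. \<Sum>a\<in>{-N..N}. f (a, b) * (2 * g (a, b) - g (a + 1, b) - g (a - 1, b)))"
    unfolding hform_def using N f
    by (intro sum.cong refl summation_by_parts_dirichlet[where u = "\<lambda>a. f (a, b)" and w = "\<lambda>a. g (a, b)" for b]) (auto simp: square_def)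
  have v: "vform N f g = (\<Sum>a\<in>{-N..N}. \<Sum>b\<in>{-N..N}. f (a, b) * (2 * g (a, b) - g (a, b + 1) - g (a, b - 1)))"
    unfolding vform_def using N f
    by (intro sum.cong refl summation_by_parts_dirichlet[where u = "\<lambda>b. f (a, b)" and w = "\<lambda>b. g (a, b)" for a]) (auto simp: square_def)
  show ?thesis
    unfolding h v square_def sum.cartesian_product[symmetric]
    by (subst sum.swap) (simp add: sum.distrib[symmetric] algebra_simps)
qed

section \<open>Hardy's inequality and the lower bound for the energy\<close>

text \<open>The boundary term 2 (v m)^2 / m strengthens the claim enough for induction. With a = v m
  / m and a' the next such quotient, the step says that (2 (v (m+1) - v m) - a')^2 + 2 m (a - a')^2
  is nonnegative.\<close>

lemma hardy_nat:
  fixes v :: "nat \<Rightarrow> real"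
  assumes "v 0 = 0"
  shows "(\<Sum>d=1..m. (v d)\<^sup>2 / (real d)\<^sup>2) + 2 * (v m)\<^sup>2 / real m \<le> 4 * (\<Sum>d=1..m. (v d - v (d - 1))\<^sup>2)"
proof (induction m)
  case 0
  then show ?case by simp
next
  case (Suc m)
  have "(v (Suc m))\<^sup>2 / (real (Suc m))\<^sup>2 + 2 * (v (Suc m))\<^sup>2 / real (Suc m)
    \<le> 4 * (v (Suc m) - v m)\<^sup>2 + 2 * (v m)\<^sup>2 / real m"
  proof (cases "m = 0")
    case True
    then show ?thesis using assms by simp
  next
    case False
    define a where "a = v m / real m"
    define a' where "a' = v (Suc m) / real (Suc m)"
    have eq: "v m = real m * a" "v (Suc m) = (real m + 1) * a'"
      using False by (auto simp: a_def a'_def field_simps)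
    have "0 \<le> (2 * (v (Suc m) - v m) - a')\<^sup>2 + 2 * real m * (a - a')\<^sup>2" by simp
    also have "\<dots> = 4 * (v (Suc m) - v m)\<^sup>2 + 2 * real m * a\<^sup>2 - a'\<^sup>2 - 2 * (real m + 1) * a'\<^sup>2"
      unfolding eq by (simp add: power2_eq_square algebra_simps)
    finally have "a'\<^sup>2 + 2 * (real m + 1) * a'\<^sup>2 \<le> 4 * (v (Suc m) - v m)\<^sup>2 + 2 * real m * a\<^sup>2" by simp
    moreover have "(v (Suc m))\<^sup>2 / (real (Suc m))\<^sup>2 = a'\<^sup>2" by (simp add: a'_def power_divide)
    moreover have "2 * (v (Suc m))\<^sup>2 / real (Suc m) = 2 * (real m + 1) * a'\<^sup>2"
      unfolding eq(2) by (simp add: power2_eq_square field_simps)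
    moreover have "2 * (v m)\<^sup>2 / real m = 2 * real m * a\<^sup>2"
      using False by (simp add: a_def power2_eq_square)
    ultimately show ?thesis by linarith
  qed
  then show ?case using Suc.IH by (simp add: algebra_simps)
qed

text \<open>N + 1 - a is the distance to the column N + 1, the first one beyond the right side,
  where \<open>u\<close> vanishes.\<close>

lemma hardy_row:
  fixes u :: "int \<Rightarrow> real"
  assumes N: "0 \<le> N" and "u (N + 1) = 0"
  shows "(\<Sum>a\<in>{-N..N}. (u a)\<^sup>2 / (real_of_int (N + 1 - a))\<^sup>2) \<le> 4 * (\<Sum>a\<in>{-N-1..N}. (u (a + 1) - u a)\<^sup>2)"
proof -
  define v where "v d = u (N + 1 - int d)" for d
  let ?m = "nat (2 * N + 1)"
  have bij: "bij_betw (\<lambda>d. N + 1 - int d) {1..?m} {-N..N}"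
    using N by (intro bij_betwI[where g = "\<lambda>a. nat (N + 1 - a)"]) auto
  have "(\<Sum>a\<in>{-N..N}. (u a)\<^sup>2 / (real_of_int (N + 1 - a))\<^sup>2) = (\<Sum>d=1..?m. (v d)\<^sup>2 / (real d)\<^sup>2)"
    by (subst sum.reindex_bij_betw[OF bij, symmetric]) (simp add: v_def)
  also have "\<dots> \<le> 4 * (\<Sum>d=1..?m. (v d - v (d - 1))\<^sup>2)"
    using assms by (intro order_trans[OF _ hardy_nat]) (auto simp: v_def)
  also have "(\<Sum>d=1..?m. (v d - v (d - 1))\<^sup>2) = (\<Sum>a\<in>{-N..N}. (u (a + 1) - u a)\<^sup>2)"
    by (subst sum.reindex_bij_betw[OF bij, symmetric])
       (auto simp: v_def of_nat_diff power2_commute algebra_simps intro!: sum.cong)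
  also have "\<dots> \<le> (\<Sum>a\<in>{-N-1..N}. (u (a + 1) - u a)\<^sup>2)"
    by (intro sum_mono2) auto
  finally show ?thesis by simp
qed

lemma sum_telescope_int: "l - 1 \<le> k \<Longrightarrow> (\<Sum>b\<in>{l..k}. F b - F (b + 1)) = F l - (F (k + 1) :: real)" for l k :: int
proof (induction k rule: int_ge_induct)
  case base
  then show ?case by simp
next
  case (step k)
  then show ?case by (simp add: sum_int_Suc_top)
qed

text \<open>The differences of u^2 from y to N + 1 telescope to 1, and each is the product (p - q)(p
  + q), estimated by the weighted inequality between the means with weight d.\<close>

lemma column_bound:
  fixes u :: "int \<Rightarrow> real"
  assumes y: "u y = 1" "-N \<le> y" "y \<le> N" and z: "u (N + 1) = 0" and d: "0 < d"
  shows "1 / d \<le> (\<Sum>b\<in>{-N-1..N}. (u (b + 1) - u b)\<^sup>2) + (\<Sum>b\<in>{-N..N}. (u b)\<^sup>2) / d\<^sup>2"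
proof -
  \<comment> \<open>The estimate produces (p^2 + q^2) / (2 d). The last term rewrites this through
    p^2 / d; its sum telescopes to -1 / (2 d) and may be dropped.\<close>
  have pt: "(u b)\<^sup>2 - (u (b + 1))\<^sup>2 \<le> d * (u (b + 1) - u b)\<^sup>2 + (u b)\<^sup>2 / d - ((u b)\<^sup>2 - (u (b + 1))\<^sup>2) / (2 * d)" for b
  proof -
    define p q where "p = u b" and "q = u (b + 1)"
    have "0 \<le> (2 * d * (p - q) - (p + q))\<^sup>2 / (4 * d) + (p - q)\<^sup>2 / (4 * d)" using d by simp
    also have "\<dots> = d * (q - p)\<^sup>2 + p\<^sup>2 / d - (p\<^sup>2 - q\<^sup>2) / (2 * d) - (p\<^sup>2 - q\<^sup>2)"
      using d by (simp add: power2_eq_square field_simps)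
    finally show ?thesis unfolding p_def q_def by linarith
  qed
  have "(\<Sum>b\<in>{y..N}. (u b)\<^sup>2 - (u (b + 1))\<^sup>2) 
    \<le> (\<Sum>b\<in>{y..N}. d * (u (b + 1) - u b)\<^sup>2 + (u b)\<^sup>2 / d - ((u b)\<^sup>2 - (u (b + 1))\<^sup>2) / (2 * d))"
    by (intro sum_mono pt)
  also have "\<dots> = d * (\<Sum>b\<in>{y..N}. (u (b + 1) - u b)\<^sup>2) + (\<Sum>b\<in>{y..N}. (u b)\<^sup>2) / d
     - (\<Sum>b\<in>{y..N}. (u b)\<^sup>2 - (u (b + 1))\<^sup>2) / (2 * d)"
    by (simp add: sum.distrib sum_subtractf sum_distrib_left sum_divide_distrib diff_divide_distrib)
  also have "(\<Sum>b\<in>{y..N}. (u b)\<^sup>2 - (u (b + 1))\<^sup>2) = 1"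
    using sum_telescope_int[of y N "\<lambda>b. (u b)\<^sup>2"] y z by simp
  finally have "1 \<le> d * (\<Sum>b\<in>{y..N}. (u (b + 1) - u b)\<^sup>2) + (\<Sum>b\<in>{y..N}. (u b)\<^sup>2) / d"
    using d by (smt (verit) divide_pos_pos)
  also have "\<dots> \<le> d * (\<Sum>b\<in>{-N-1..N}. (u (b + 1) - u b)\<^sup>2) + (\<Sum>b\<in>{-N..N}. (u b)\<^sup>2) / d"
    using d y by (intro add_mono mult_left_mono divide_right_mono sum_mono2) auto
  finally have "1 / d \<le> (d * (\<Sum>b\<in>{-N-1..N}. (u (b + 1) - u b)\<^sup>2) + (\<Sum>b\<in>{-N..N}. (u b)\<^sup>2) / d) / d"
    using d by (intro divide_right_mono) auto
  then show ?thesis using d by (simp add: add_divide_distrib power2_eq_square)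
qed

text \<open>\<open>column_bound\<close> is used in column r with its distance d = N + 1 - r from the
  column N + 1. The terms f^2 / d^2 that it costs are summed along rows, where Hardy's inequality
  turns them into 4 \<open>hform\<close>.\<close>

lemma one_sided_bound:
  assumes N: "0 \<le> N" and f: "\<And>x. x \<notin> square N \<Longrightarrow> f x = 0"
    and R: "R \<subseteq> {0..N}" "\<And>r. r \<in> R \<Longrightarrow> \<exists>b\<in>{-N..N}. f (r, b) = 1"
  shows "(\<Sum>r\<in>R. 1 / real_of_int (N + 1 - r)) \<le> vform N f f + 4 * hform N f f"
proof -
  have "(\<Sum>r\<in>R. 1 / real_of_int (N + 1 - r)) 
    \<le> (\<Sum>r\<in>R. (\<Sum>b\<in>{-N-1..N}. (f (r, b + 1) - f (r, b))\<^sup>2) + (\<Sum>b\<in>{-N..N}. (f (r, b))\<^sup>2) / (real_of_int (N + 1 - r))\<^sup>2)"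
  proof (rule sum_mono)
    fix r assume "r \<in> R"
    then obtain b where b: "b \<in> {-N..N}" "f (r, b) = 1" using R(2) by blast
    show "1 / real_of_int (N + 1 - r) \<le> (\<Sum>b\<in>{-N-1..N}. (f (r, b + 1) - f (r, b))\<^sup>2) + (\<Sum>b\<in>{-N..N}. (f (r, b))\<^sup>2) / (real_of_int (N + 1 - r))\<^sup>2"
      using b R(1) \<open>r \<in> R\<close> by (intro column_bound[where y = b]) (auto intro!: f simp: square_def)
  qed
  also have "\<dots> \<le> (\<Sum>r\<in>{-N..N}. (\<Sum>b\<in>{-N-1..N}. (f (r, b + 1) - f (r, b))\<^sup>2) + (\<Sum>b\<in>{-N..N}. (f (r, b))\<^sup>2) / (real_of_int (N + 1 - r))\<^sup>2)"
    using R N by (intro sum_mono2) (auto intro!: add_nonneg_nonneg sum_nonneg divide_nonneg_nonneg)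
  also have "\<dots> = vform N f f + (\<Sum>b\<in>{-N..N}. \<Sum>a\<in>{-N..N}. (f (a, b))\<^sup>2 / (real_of_int (N + 1 - a))\<^sup>2)"
    unfolding sum.distrib vform_def sum_divide_distrib
    by (subst (2) sum.swap) (simp add: power2_eq_square)
  also have "\<dots> \<le> vform N f f + (\<Sum>b\<in>{-N..N}. 4 * (\<Sum>a\<in>{-N-1..N}. (f (a + 1, b) - f (a, b))\<^sup>2))"
    using N by (intro add_mono order_refl sum_mono hardy_row[where u = "\<lambda>a. f (a, b)" for b]) (auto intro!: f simp: square_def)
  also have "\<dots> = vform N f f + 4 * hform N f f"
    by (simp add: hform_def sum_distrib_left power2_eq_square)
  finally show ?thesis .
qed

lemma sum_reflect: "(\<Sum>a\<in>{-N..N}. F (- a)) = (\<Sum>a\<in>{-N..N}. F a :: real)" for N :: int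
  by (rule sum.reindex_bij_witness[of _ uminus uminus]) auto

lemma sum_reflect': "(\<Sum>a\<in>{-N-1..N}. F (- a - 1)) = (\<Sum>a\<in>{-N-1..N}. F a :: real)" for N :: int
  by (rule sum.reindex_bij_witness[of _ "\<lambda>a. - a - 1" "\<lambda>a. - a - 1"]) auto

lemma form_swap: "hform N (\<lambda>(a, b). f (b, a)) (\<lambda>(a, b). f (b, a)) = vform N f f"
  "vform N (\<lambda>(a, b). f (b, a)) (\<lambda>(a, b). f (b, a)) = hform N f f"
  by (simp_all add: hform_def vform_def)

lemma form_reflect: "hform N (\<lambda>(a, b). f (- a, b)) (\<lambda>(a, b). f (- a, b)) = hform N f f"
  "vform N (\<lambda>(a, b). f (- a, b)) (\<lambda>(a, b). f (- a, b)) = vform N f f"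
proof -
  show "vform N (\<lambda>(a, b). f (- a, b)) (\<lambda>(a, b). f (- a, b)) = vform N f f"
    unfolding vform_def prod.case by (rule sum_reflect)
  have "(\<Sum>a\<in>{-N-1..N}. (f (- (a + 1), b) - f (- a, b)) * (f (- (a + 1), b) - f (- a, b)))
     = (\<Sum>a\<in>{-N-1..N}. (f (a + 1, b) - f (a, b)) * (f (a + 1, b) - f (a, b)))" for b
    using sum_reflect'[where N = N and F = "\<lambda>a. (f (a + 1, b) - f (a, b)) * (f (a + 1, b) - f (a, b))"]
    by (simp add: algebra_simps)
  then show "hform N (\<lambda>(a, b). f (- a, b)) (\<lambda>(a, b). f (- a, b)) = hform N f f"
    unfolding hform_def prod.case by simp
qed

lemma sup_norm_cases: "sup_norm x = r \<Longrightarrow> fst x = r \<or> fst x = - r \<or> snd x = r \<or> snd x = - r"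
  by (auto simp: sup_norm_def max_def abs_if split: if_splits)

lemma harm_sum_int: "0 \<le> N \<Longrightarrow> (\<Sum>r\<in>{0..N}. 1 / real_of_int (N + 1 - r)) = harm (nat (N + 1))"
  unfolding harm_def
  by (rule sum.reindex_bij_witness[of _ "\<lambda>k. N + 1 - int k" "\<lambda>r. nat (N + 1 - r)"]) (auto simp: field_simps)

text \<open>Hardy's inequality in the direction of the nearest side, and the elementary estimate 
  \<open>1 / d \<le> \<Sum>(u (b + 1) - u b)\<^sup>2 + \<Sum>(u b)\<^sup>2 / d\<^sup>2\<close> along the perpendicular line at distance \<open>d\<close> from it,
  replace the multiscale estimate of the capacity of a connected set.\<close>

lemma dirichlet_energy_lower:
  assumes N: "1 \<le> N" and f: "\<And>x. x \<notin> square N \<Longrightarrow> f x = 0"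
    and one: "\<And>r. r \<in> {0..N} \<Longrightarrow> \<exists>x\<in>square N. sup_norm x = r \<and> f x = 1"
  shows "ln (real_of_int N) / 10 \<le> hform N f f + vform N f f"
proof -
  have N0: "0 \<le> N" using N by simp
  define R where "R g = {r \<in> {0..N}. \<exists>b\<in>{-N..N}. g (r, b) = (1::real)}" for g
  let ?f1 = "f" and ?f2 = "\<lambda>(a, b). f (- a, b)" and ?f3 = "\<lambda>(a, b). f (b, a)"
  let ?f4 = "\<lambda>(a, b). ?f3 (- a, b)"
  define c where "c r = 1 / real_of_int (N + 1 - r)" for r
  have fin: "finite (R g)" for g unfolding R_def by (rule finite_subset[of _ "{0..N}"]) auto
  have b: "(\<Sum>r\<in>R g. c r) \<le> vform N g g + 4 * hform N g g" if "\<And>x. x \<notin> square N \<Longrightarrow> g x = 0" for g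
    unfolding c_def by (rule one_sided_bound[OF N0 that]) (auto simp: R_def)
  have b1: "(\<Sum>r\<in>R ?f1. c r) \<le> vform N f f + 4 * hform N f f" by (rule b) (rule f)
  have z2: "?f2 x = 0" if "x \<notin> square N" for x using that by (cases x) (auto simp: square_def intro!: f)
  have z3: "?f3 x = 0" if "x \<notin> square N" for x using that by (cases x) (auto simp: square_def intro!: f)
  have z4: "?f4 x = 0" if "x \<notin> square N" for x using that by (cases x) (auto simp: square_def intro!: f)
  have b2: "(\<Sum>r\<in>R ?f2. c r) \<le> vform N f f + 4 * hform N f f"
    using b[of ?f2, OF z2] unfolding form_reflect .
  have b3: "(\<Sum>r\<in>R ?f3. c r) \<le> hform N f f + 4 * vform N f f"
    using b[of ?f3, OF z3] unfolding form_swap .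
  have b4: "(\<Sum>r\<in>R ?f4. c r) \<le> hform N f f + 4 * vform N f f"
    using b[of ?f4, OF z4] unfolding form_reflect form_swap .
  \<comment> \<open>A point of sup norm r lies on one of four sides; a swap of coordinates and a
    reflection carry each of them to the right side.\<close>
  have cov: "{0..N} \<subseteq> R ?f1 \<union> R ?f2 \<union> R ?f3 \<union> R ?f4"
  proof
    fix r assume r: "r \<in> {0..N}"
    then obtain x where x: "x \<in> square N" "sup_norm x = r" "f x = 1" using one by blast
    obtain a b where ab: "x = (a, b)" by (cases x)
    from sup_norm_cases[OF x(2)] show "r \<in> R ?f1 \<union> R ?f2 \<union> R ?f3 \<union> R ?f4"
      using x r by (auto simp: R_def ab square_def)
  qed
  have c0: "0 \<le> c r" if "r \<in> {0..N}" for r using that by (simp add: c_def)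
  have un: "(\<Sum>r\<in>A \<union> B. c r) \<le> (\<Sum>r\<in>A. c r) + (\<Sum>r\<in>B. c r)" if "A \<subseteq> {0..N}" "B \<subseteq> {0..N}" for A B
  proof -
    have "finite A" "finite B" using that by (auto intro: finite_subset)
    then have "(\<Sum>r\<in>A \<union> B. c r) = (\<Sum>r\<in>A. c r) + (\<Sum>r\<in>B. c r) - (\<Sum>r\<in>A \<inter> B. c r)"
      by (rule sum_Un)
    moreover have "0 \<le> (\<Sum>r\<in>A \<inter> B. c r)" using that by (intro sum_nonneg c0) auto
    ultimately show ?thesis by simp
  qed
  have R: "R g \<subseteq> {0..N}" for g by (auto simp: R_def)
  have "ln (real_of_int N) \<le> ln (real (nat (N + 1)) + 1)" using N by (intro ln_mono) auto
  also have "\<dots> \<le> harm (nat (N + 1))" by (rule ln_le_harm)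
  also have "\<dots> = (\<Sum>r\<in>{0..N}. c r)" unfolding c_def by (rule harm_sum_int[OF N0, symmetric])
  also have "\<dots> \<le> (\<Sum>r\<in>R ?f1 \<union> R ?f2 \<union> R ?f3 \<union> R ?f4. c r)"
    by (intro sum_mono2 cov c0) (use R fin in blast)+
  also have "\<dots> \<le> (\<Sum>r\<in>R ?f1. c r) + (\<Sum>r\<in>R ?f2. c r) + (\<Sum>r\<in>R ?f3. c r) + (\<Sum>r\<in>R ?f4. c r)"
    using un[OF Un_least[OF Un_least[OF R[of ?f1] R[of ?f2]] R[of ?f3]] R[of ?f4]]
      un[OF Un_least[OF R[of ?f1] R[of ?f2]] R[of ?f3]] un[OF R[of ?f1] R[of ?f2]] by linarith
  \<comment> \<open>Two bounds have weights 1 and 4 on the two forms, and two have them exchanged: 2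
    (1 + 4) = 10.\<close>
  also have "\<dots> \<le> 10 * (hform N f f + vform N f f)" using b1 b2 b3 b4 by argo
  finally show ?thesis by simp
qed

section \<open>A test function for the variance at the origin\<close>

text \<open>There are 4 (2 k + 1) edges between the rings of sup norm k and k + 1. This function
  drops by 1 / (2 k + 1) along each of them, as the potential of a current of strength 4 spread
  evenly over the edges between consecutive rings.\<close>

definition radial :: "int \<Rightarrow> vertex \<Rightarrow> real" where
  "radial N x = (\<Sum>k\<in>{sup_norm x..N}. 1 / real_of_int (2 * k + 1))"

lemma radial_outside:
  assumes "x \<notin> square N"
  shows "radial N x = 0"
proof -
  have "N < sup_norm x" using assms by (cases x) (auto simp: square_def sup_norm_def)
  then show ?thesis by (simp add: radial_def)
qed

lemma radial_swap: "radial N (b, a) = radial N (a, b)"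
  by (simp add: radial_def sup_norm_def max.commute)

lemma radial_hform:
  assumes N: "0 \<le> N"
  shows "hform N (radial N) (radial N) = 2 * radial N (0, 0)"
proof -
  \<comment> \<open>Both signs of \<open>a\<close> are covered: the horizontal edge from column a to
    a + 1 changes rings exactly if |b| is at most \<open>m a\<close>, and then its ends lie on the
    rings \<open>m a\<close> and \<open>m a + 1\<close>.\<close>
  define m where "m a = (if 0 \<le> a then a else - a - 1 :: int)" for a
  have step: "(radial N (a + 1, b) - radial N (a, b)) * (radial N (a + 1, b) - radial N (a, b)) 
      = (if b \<in> {- m a..m a} then 1 / (real_of_int (2 * m a + 1))\<^sup>2 else 0)" if a: "a \<in> {-N-1..N}" for a b
  proof (cases "\<bar>b\<bar> \<le> m a")
    case True
    have m: "0 \<le> m a" "m a \<le> N" using a by (auto simp: m_def)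
    have rr: "(\<Sum>k\<in>{m a..N}. 1 / real_of_int (2 * k + 1)) = 1 / real_of_int (2 * m a + 1) + (\<Sum>k\<in>{m a + 1..N}. 1 / real_of_int (2 * k + 1))"
    proof -
      have "{m a..N} = insert (m a) {m a + 1..N}" using m by auto
      then show ?thesis by simp
    qed
    have "(sup_norm (a + 1, b) = m a + 1 \<and> sup_norm (a, b) = m a) \<or> (sup_norm (a + 1, b) = m a \<and> sup_norm (a, b) = m a + 1)"
      using True by (auto simp: sup_norm_def m_def split: if_splits)
    then have "\<bar>radial N (a + 1, b) - radial N (a, b)\<bar> = \<bar>1 / real_of_int (2 * m a + 1)\<bar>"
      unfolding radial_def using rr by auto
    then have "(radial N (a + 1, b) - radial N (a, b))\<^sup>2 = (1 / real_of_int (2 * m a + 1))\<^sup>2"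
      by (metis power2_abs)
    moreover have "b \<in> {- m a..m a}" using True by auto
    ultimately show ?thesis by (simp add: power2_eq_square)
  next
    case False
    then have "sup_norm (a + 1, b) = sup_norm (a, b)"
      by (auto simp: sup_norm_def m_def split: if_splits)
    moreover have "b \<notin> {- m a..m a}" using False by auto
    ultimately show ?thesis by (simp add: radial_def)
  qed
  have "hform N (radial N) (radial N) = (\<Sum>a\<in>{-N-1..N}. \<Sum>b\<in>{-N..N}. if b \<in> {- m a..m a} then 1 / (real_of_int (2 * m a + 1))\<^sup>2 else 0)"
    unfolding hform_def by (subst sum.swap) (intro sum.cong refl step)
  also have "\<dots> = (\<Sum>a\<in>{-N-1..N}. 1 / real_of_int (2 * m a + 1))"
  proof (intro sum.cong refl)
    fix a assume a: "a \<in> {-N-1..N}"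
    then have m: "0 \<le> m a" "m a \<le> N" by (auto simp: m_def)
    then have "{-N..N} \<inter> {- m a..m a} = {- m a..m a}" by auto
    then have "(\<Sum>b\<in>{-N..N}. if b \<in> {- m a..m a} then 1 / (real_of_int (2 * m a + 1))\<^sup>2 else 0) 
      = real_of_int (2 * m a + 1) * (1 / (real_of_int (2 * m a + 1))\<^sup>2)"
      using m by (subst sum.inter_restrict[symmetric]) auto
    then show "(\<Sum>b\<in>{-N..N}. if b \<in> {- m a..m a} then 1 / (real_of_int (2 * m a + 1))\<^sup>2 else 0) = 1 / real_of_int (2 * m a + 1)"
      using m by (simp add: power2_eq_square)
  qed
  also have "\<dots> = (\<Sum>a\<in>{0..N}. 1 / real_of_int (2 * m a + 1)) + (\<Sum>a\<in>{-N-1..-1}. 1 / real_of_int (2 * m a + 1))"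
    using N by (subst sum.union_disjoint[symmetric]) (auto intro!: sum.cong)
  also have "(\<Sum>a\<in>{-N-1..-1}. 1 / real_of_int (2 * m a + 1)) = (\<Sum>a\<in>{0..N}. 1 / real_of_int (2 * a + 1))"
    by (rule sum.reindex_bij_witness[of _ "\<lambda>a. - a - 1" "\<lambda>a. - a - 1"]) (auto simp: m_def)
  also have "(\<Sum>a\<in>{0..N}. 1 / real_of_int (2 * m a + 1)) = (\<Sum>a\<in>{0..N}. 1 / real_of_int (2 * a + 1))"
    by (intro sum.cong refl) (auto simp: m_def)
  moreover have "radial N (0, 0) = (\<Sum>a\<in>{0..N}. 1 / real_of_int (2 * a + 1))"
    by (simp add: radial_def sup_norm_def)
  ultimately show ?thesis by simp
qed

lemma radial_energy:
  assumes N: "0 \<le> N"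
  shows "hform N (radial N) (radial N) + vform N (radial N) (radial N) = 4 * radial N (0, 0)"
proof -
  have "(\<lambda>(a, b). radial N (b, a)) = radial N" by (auto simp: radial_swap)
  then have "vform N (radial N) (radial N) = hform N (radial N) (radial N)"
    using form_swap(2)[of N "radial N"] by simp
  then show ?thesis using radial_hform[OF N] by simp
qed

lemma radial_0_lower:
  assumes N: "1 \<le> N"
  shows "ln (real_of_int N) / 2 \<le> radial N (0, 0)"
proof -
  have "ln (real_of_int N) \<le> ln (real (nat (N + 1)) + 1)" using N by (intro ln_mono) auto
  also have "\<dots> \<le> harm (nat (N + 1))" by (rule ln_le_harm)
  also have "\<dots> = (\<Sum>k\<in>{0..N}. 1 / real_of_int (k + 1))"
    unfolding harm_def using N
    by (intro sum.reindex_bij_witness[of _ "\<lambda>r. nat (r + 1)" "\<lambda>k. int k - 1"]) (auto simp: field_simps)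
  finally have "ln (real_of_int N) / 2 \<le> (\<Sum>k\<in>{0..N}. 1 / real_of_int (k + 1)) / 2" by simp
  also have "\<dots> \<le> (\<Sum>k\<in>{0..N}. 1 / real_of_int (2 * k + 1))"
    unfolding sum_divide_distrib by (intro sum_mono) (simp add: field_simps)
  finally show ?thesis by (simp add: radial_def sup_norm_def)
qed

section \<open>The Green's function of the killed walk\<close>

definition steps :: "vertex set" where
  "steps = {(1, 0), (-1, 0), (0, 1), (0, -1)}"

lemma sum_steps: "(\<Sum>d\<in>steps. F d) = F (1, 0) + F (-1, 0) + F (0, 1) + F (0, -1)"
  for F :: "vertex \<Rightarrow> 'b::comm_monoid_add"
  by (simp add: steps_def add.assoc)

interpretation srw: sequence_space "measure_pmf (pmf_of_set steps)"
  by unfold_locales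

lemma srw_steps_eq: "srw_steps = PiM UNIV (\<lambda>_. measure_pmf (pmf_of_set steps))"
  by (simp add: srw_steps_def steps_def)

lemma walk_0: "walk x \<xi> 0 = x"
  by (simp add: walk_def)

lemma walk_case_nat: "walk x (case_nat s \<xi>) (Suc n) = walk (x + s) \<xi> n"
  by (simp add: walk_def sum.lessThan_Suc_shift add.assoc del: sum.lessThan_Suc)

lemma walk_measurable[measurable]: "(\<lambda>\<xi>. walk x \<xi> n) \<in> measurable srw_steps (count_space UNIV)"
proof (induction n)
  case 0
  then show ?case by (simp add: walk_0)
next
  case (Suc n)
  have c: "(\<lambda>\<xi>. \<xi> n) \<in> measurable srw_steps (count_space UNIV)"
    unfolding srw_steps_eq by (rule measurable_compose[OF measurable_component_singleton[of n]]) auto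
  have "(\<lambda>\<xi>. walk x \<xi> n + \<xi> n) \<in> measurable srw_steps (count_space UNIV)"
    by (rule measurable_compose_countable[where f = "\<lambda>i \<xi>. i + \<xi> n", OF _ Suc])
       (rule measurable_compose[OF c], simp)
  then show ?case by (simp add: walk_def add.assoc)
qed

definition stay :: "vertex set \<Rightarrow> vertex \<Rightarrow> nat \<Rightarrow> vertex \<Rightarrow> (nat \<Rightarrow> vertex) set" where
  "stay A y n x = {\<xi> \<in> space srw_steps. walk x \<xi> n = y \<and> (\<forall>k\<le>n. walk x \<xi> k \<in> A)}"

lemma stay_sets[measurable]: "stay A y n x \<in> sets srw_steps"
  unfolding stay_def by measurable

lemma space_srw: "space srw_steps = UNIV"
  by (simp add: srw_steps_eq space_PiM)

lemma emeasure_stay_0: "emeasure srw_steps (stay A y 0 x) = of_bool (x = y \<and> x \<in> A)"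
proof -
  have "stay A y 0 x = (if x = y \<and> x \<in> A then space srw_steps else {})" by (auto simp: stay_def walk_0)
  then show ?thesis using srw.P.emeasure_space_1 by (auto simp: srw_steps_eq)
qed

text \<open>The Markov property at time 1: \<open>srw.PiM_iter\<close> splits the sequence of steps
  into the first step and an independent copy of the whole sequence.\<close>

lemma emeasure_stay_Suc:
  "emeasure srw_steps (stay A y (Suc n) x)
    = of_bool (x \<in> A) * ((\<Sum>d\<in>steps. emeasure srw_steps (stay A y n (x + d))) / 4)"
proof -
  let ?p = "measure_pmf (pmf_of_set steps)"
  have pre: "case_nat s \<xi> \<in> stay A y (Suc n) x \<longleftrightarrow> x \<in> A \<and> \<xi> \<in> stay A y n (x + s)" for s \<xi>
  proof -
    have "(\<forall>k\<le>Suc n. walk x (case_nat s \<xi>) k \<in> A) \<longleftrightarrow> x \<in> A \<and> (\<forall>k\<le>n. walk (x + s) \<xi> k \<in> A)"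
    proof safe
      assume *: "\<forall>k\<le>Suc n. walk x (case_nat s \<xi>) k \<in> A"
      show "x \<in> A" using *[rule_format, of 0] by (simp add: walk_0)
      show "walk (x + s) \<xi> k \<in> A" if "k \<le> n" for k
        using *[rule_format, of "Suc k"] that by (simp add: walk_case_nat)
    next
      fix k assume "x \<in> A" "\<forall>k\<le>n. walk (x + s) \<xi> k \<in> A" "k \<le> Suc n"
      then show "walk x (case_nat s \<xi>) k \<in> A" by (cases k) (auto simp: walk_0 walk_case_nat)
    qed
    then show ?thesis by (auto simp: stay_def space_srw walk_case_nat)
  qed
  have [measurable]: "(\<lambda>(s, \<xi>). case_nat s \<xi>) \<in> measurable (?p \<Otimes>\<^sub>M srw_steps) srw_steps"
    unfolding srw_steps_eq by measurable
  have "emeasure srw_steps (stay A y (Suc n) x) 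
      = emeasure (distr (?p \<Otimes>\<^sub>M srw_steps) srw_steps (\<lambda>(s, \<xi>). case_nat s \<xi>)) (stay A y (Suc n) x)"
    using srw.PiM_iter by (simp add: srw_steps_eq)
  also have "\<dots> = (\<integral>\<^sup>+z. indicator (stay A y (Suc n) x) (case z of (s, \<xi>) \<Rightarrow> case_nat s \<xi>) \<partial>(?p \<Otimes>\<^sub>M srw_steps))"
    by (subst nn_integral_indicator[symmetric], simp, subst nn_integral_distr) simp_all
  also have "\<dots> = (\<integral>\<^sup>+s. \<integral>\<^sup>+\<xi>. indicator (stay A y (Suc n) x) (case_nat s \<xi>) \<partial>srw_steps \<partial>?p)"
    unfolding srw_steps_eq
    by (subst srw.P.nn_integral_fst[symmetric]) (auto simp: srw_steps_eq[symmetric])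
  also have "\<dots> = (\<integral>\<^sup>+s. of_bool (x \<in> A) * emeasure srw_steps (stay A y n (x + s)) \<partial>?p)"
  proof (intro nn_integral_cong)
    fix s
    have "(\<integral>\<^sup>+\<xi>. indicator (stay A y (Suc n) x) (case_nat s \<xi>) \<partial>srw_steps)
       = (\<integral>\<^sup>+\<xi>. of_bool (x \<in> A) * indicator (stay A y n (x + s)) \<xi> \<partial>srw_steps)"
      by (intro nn_integral_cong) (auto simp: indicator_def pre)
    then show "(\<integral>\<^sup>+\<xi>. indicator (stay A y (Suc n) x) (case_nat s \<xi>) \<partial>srw_steps) = of_bool (x \<in> A) * emeasure srw_steps (stay A y n (x + s))"
      by (simp add: nn_integral_cmult)
  qed
  also have "\<dots> = (\<Sum>s\<in>steps. of_bool (x \<in> A) * emeasure srw_steps (stay A y n (x + s))) / 4"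
  proof -
    have "finite steps" "steps \<noteq> {}" "card steps = 4" by (auto simp: steps_def)
    then show ?thesis by (subst nn_integral_pmf_of_set) auto
  qed
  also have "\<dots> = of_bool (x \<in> A) * ((\<Sum>d\<in>steps. emeasure srw_steps (stay A y n (x + d))) / 4)"
    by (cases "x \<in> A") auto
  finally show ?thesis .
qed

text \<open>Values in \<open>ennreal\<close> allow the one-step equation to be derived before
  finiteness is known.\<close>

definition egreen :: "vertex set \<Rightarrow> vertex \<Rightarrow> vertex \<Rightarrow> ennreal" where
  "egreen A y x = (\<Sum>n. emeasure srw_steps (stay A y n x))"

lemma egreen_eq: "(\<integral>\<^sup>+\<xi>. visits_before_exit A x y \<xi> \<partial>srw_steps) = egreen A y x"
proof -
  have "visits_before_exit A x y \<xi> = (\<Sum>n. indicator (stay A y n x) \<xi>)" for \<xi>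
  proof -
    have "visits_before_exit A x y \<xi> = (\<integral>\<^sup>+n. indicator {n. walk x \<xi> n = y \<and> (\<forall>k\<le>n. walk x \<xi> k \<in> A)} n \<partial>count_space UNIV)"
      unfolding visits_before_exit_def by simp
    also have "\<dots> = (\<Sum>n. indicator {n. walk x \<xi> n = y \<and> (\<forall>k\<le>n. walk x \<xi> k \<in> A)} n)"
      by (rule nn_integral_count_space_nat)
    finally show ?thesis by (simp add: stay_def space_srw indicator_def)
  qed
  then show ?thesis
    unfolding egreen_def by (simp add: nn_integral_suminf)
qed

lemma egreen_step:
  "egreen A y x = of_bool (x = y \<and> x \<in> A) + of_bool (x \<in> A) * ((\<Sum>d\<in>steps. egreen A y (x + d)) / 4)"
proof -
  let ?q = "\<lambda>n x. emeasure srw_steps (stay A y n x)"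
  have "egreen A y x = ?q 0 x + (\<Sum>n. ?q (Suc n) x)"
    unfolding egreen_def by (subst suminf_offset[of _ 1]) auto
  also have "(\<Sum>n. ?q (Suc n) x) = of_bool (x \<in> A) * ((\<Sum>d\<in>steps. egreen A y (x + d)) / 4)"
    unfolding emeasure_stay_Suc egreen_def divide_ennreal_def
    by (subst ennreal_suminf_cmult, subst ennreal_suminf_multc, subst suminf_sum) auto
  finally show ?thesis by (simp add: emeasure_stay_0)
qed

lemma egreen_outside: "x \<notin> A \<Longrightarrow> egreen A y x = 0"
  using egreen_step[of A y x] by simp

text \<open>The squared Euclidean norm of the walk grows by 1 per step on average, so the mean of
  \<open>u\<close> after one step is u - 1. The constant 2 (N + 1)^2 keeps \<open>u\<close>
  nonnegative also one step outside the square; hence \<open>u\<close> dominates all partial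
  sums.\<close>

lemma egreen_finite: "egreen (square N) y x < \<infinity>"
proof (cases "x \<in> square N")
  case True
  define u where "u z = 2 * (real_of_int (N + 1))\<^sup>2 - (real_of_int (fst z))\<^sup>2 - (real_of_int (snd z))\<^sup>2" for z :: vertex
  let ?q = "\<lambda>n x. emeasure srw_steps (stay (square N) y n x)"
  have u0: "0 \<le> u (x + d)" if x: "x \<in> square N" and d: "d \<in> steps" for x d
  proof -
    have "\<bar>fst (x + d)\<bar> \<le> \<bar>N + 1\<bar>" "\<bar>snd (x + d)\<bar> \<le> \<bar>N + 1\<bar>" using x d by (auto simp: square_def steps_def)
    then have "(real_of_int (fst (x + d)))\<^sup>2 \<le> (real_of_int (N + 1))\<^sup>2" "(real_of_int (snd (x + d)))\<^sup>2 \<le> (real_of_int (N + 1))\<^sup>2"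
      by (simp_all only: abs_le_square_iff[symmetric])
    then show ?thesis by (simp add: u_def)
  qed
  have "(\<Sum>n<m. ?q n x) \<le> ennreal (u x)" if "x \<in> square N" for m x
    using that
  proof (induction m arbitrary: x)
    case (Suc m)
    have "(\<Sum>n<Suc m. ?q n x) = ?q 0 x + (\<Sum>n<m. ?q (Suc n) x)"
      by (rule sum.lessThan_Suc_shift)
    also have "(\<Sum>n<m. ?q (Suc n) x) = (\<Sum>d\<in>steps. (\<Sum>n<m. ?q n (x + d))) / 4"
      unfolding emeasure_stay_Suc divide_ennreal_def using Suc.prems
      by (simp add: sum_distrib_right[symmetric]) (subst sum.swap, rule refl)
    also have "\<dots> \<le> (\<Sum>d\<in>steps. ennreal (u (x + d))) / 4"
    proof (intro divide_right_mono_ennreal sum_mono)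
      fix d assume "d \<in> steps"
      show "(\<Sum>n<m. ?q n (x + d)) \<le> ennreal (u (x + d))"
      proof (cases "x + d \<in> square N")
        case False
        then have "?q n (x + d) = 0" for n by (cases n) (simp_all add: emeasure_stay_0 emeasure_stay_Suc)
        then show ?thesis by simp
      qed (rule Suc.IH)
    qed
    also have "\<dots> = ennreal ((\<Sum>d\<in>steps. u (x + d)) / 4)"
      using u0[OF Suc.prems] by (subst sum_ennreal) (auto simp: divide_ennreal[symmetric] sum_nonneg)
    also have "(\<Sum>d\<in>steps. u (x + d)) / 4 = u x - 1"
    proof -
      have "(\<Sum>d\<in>steps. u (x + d)) = 4 * (u x - 1)"
        by (simp add: sum_steps u_def power2_eq_square algebra_simps)
      then show ?thesis by simp
    qed
    finally have "(\<Sum>n<Suc m. ?q n x) \<le> ?q 0 x + ennreal (u x - 1)"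
      by (simp add: add_mono)
    also have "\<dots> \<le> 1 + ennreal (u x - 1)"
      by (intro add_mono) (simp_all add: emeasure_stay_0)
    also have "\<dots> = ennreal (u x)"
    proof -
      have "0 \<le> u x - 1"
        using sum_nonneg[of steps "\<lambda>d. u (x + d)", OF u0[OF Suc.prems]] \<open>(\<Sum>d\<in>steps. u (x + d)) / 4 = u x - 1\<close> by simp
      then have "ennreal 1 + ennreal (u x - 1) = ennreal (1 + (u x - 1))" by (subst ennreal_plus) auto
      then show ?thesis by simp
    qed
    finally show ?case .
  qed simp
  then have "egreen (square N) y x \<le> ennreal (u x)"
    unfolding egreen_def using True by (intro suminf_le_const summableI) auto
  then show ?thesis by (simp add: le_less_trans)
qed (simp add: egreen_outside)

lemma green_egreen: "green A x y = enn2real (egreen A y x)"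
  by (simp add: green_def egreen_eq)

lemma green_outside: "x \<notin> A \<Longrightarrow> green A x y = 0"
  by (simp add: green_egreen egreen_outside)

lemma green_laplacian:
  assumes "(a, b) \<in> square N"
  shows "4 * green (square N) (a, b) y - green (square N) (a + 1, b) y - green (square N) (a - 1, b) y
    - green (square N) (a, b + 1) y - green (square N) (a, b - 1) y = 4 * of_bool ((a, b) = y)"
proof -
  let ?g = "\<lambda>x. green (square N) x y"
  have e: "egreen (square N) y x = ennreal (?g x)" for x
    unfolding green_egreen using egreen_finite by (simp add: ennreal_enn2real_if less_top)
  have g0: "0 \<le> ?g x" for x by (simp add: green_egreen)
  have "ennreal (?g (a, b)) = of_bool ((a, b) = y) + (\<Sum>d\<in>steps. ennreal (?g ((a, b) + d))) / 4"
    using egreen_step[of "square N" y "(a, b)"] assms by (simp add: e)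
  also have "\<dots> = ennreal (of_bool ((a, b) = y) + (\<Sum>d\<in>steps. ?g ((a, b) + d)) / 4)"
    using g0 by (subst sum_ennreal) (auto simp: ennreal_plus divide_ennreal[symmetric] sum_nonneg)
  finally have "?g (a, b) = of_bool ((a, b) = y) + (\<Sum>d\<in>steps. ?g ((a, b) + d)) / 4"
    using g0 by (subst (asm) ennreal_inj) (auto intro!: add_nonneg_nonneg sum_nonneg divide_nonneg_nonneg)
  then have "?g (a, b) = of_bool ((a, b) = y) + (?g (a + 1, b) + ?g (a - 1, b) + ?g (a, b + 1) + ?g (a, b - 1)) / 4"
    by (simp add: sum_steps)
  moreover have "4 * g - p - q - r - s = 4 * i" if "g = i + (p + q + r + s) / 4" for g p q r s i :: real
    using that by argo
  ultimately show ?thesis by blast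
qed

section \<open>The subdivided square\<close>

text \<open>Both ends lie in the square, and each edge is oriented to the right or upwards. Edges
  that leave the square appear only through \<open>kill\<close>.\<close>

definition grid_edges :: "int \<Rightarrow> (vertex \<times> vertex) set" where
  "grid_edges N = (\<lambda>(a, b). ((a, b), (a + 1, b))) ` ({-N..N - 1} \<times> {-N..N})
     \<union> (\<lambda>(a, b). ((a, b), (a, b + 1))) ` ({-N..N} \<times> {-N..N - 1})"

text \<open>The points that divide each edge of \<open>square N\<close> into \<open>n\<close> parts, in coordinates scaled by \<open>n\<close>.\<close>

definition node :: "nat \<Rightarrow> vertex \<times> vertex \<Rightarrow> nat \<Rightarrow> vertex" where
  "node n = (\<lambda>(x, y) j. (int n * fst x + int j * (fst y - fst x), int n * snd x + int j * (snd y - snd x)))"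

definition dilate :: "nat \<Rightarrow> vertex \<Rightarrow> vertex" where
  "dilate n x = (int n * fst x, int n * snd x)"

definition sub_edges :: "int \<Rightarrow> nat \<Rightarrow> ((vertex \<times> vertex) \<times> nat) set" where
  "sub_edges N n = grid_edges N \<times> {..<n}"

definition sub_src :: "nat \<Rightarrow> (vertex \<times> vertex) \<times> nat \<Rightarrow> vertex" where
  "sub_src n = (\<lambda>(e, j). node n e j)"

definition sub_tgt :: "nat \<Rightarrow> (vertex \<times> vertex) \<times> nat \<Rightarrow> vertex" where
  "sub_tgt n = (\<lambda>(e, j). node n e (Suc j))"

definition sub_verts :: "int \<Rightarrow> nat \<Rightarrow> vertex set" where
  "sub_verts N n = (\<lambda>(e, j). node n e j) ` (grid_edges N \<times> {..n})"

definition sides :: "int \<Rightarrow> vertex \<Rightarrow> real" where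
  "sides N x = of_bool (\<bar>fst x\<bar> = N) + of_bool (\<bar>snd x\<bar> = N)"

text \<open>\<open>sides\<close> counts the edges that leave the square, two at a corner, each of
  conductance 1/4. The membership test is essential: division points of edges along a side also have
  a coordinate of absolute value n N, but no edge leaves the square there.\<close>

definition kill :: "int \<Rightarrow> nat \<Rightarrow> vertex \<Rightarrow> real" where
  "kill N n p = (if p \<in> dilate n ` square N then sides (int n * N) p / 4 else 0)"

lemma finite_grid_edges: "finite (grid_edges N)"
  by (simp add: grid_edges_def)

lemma grid_edges_cases:
  assumes "e \<in> grid_edges N"
  obtains a b where "e = ((a, b), (a + 1, b))" "-N \<le> a" "a < N" "-N \<le> b" "b \<le> N"
  | a b where "e = ((a, b), (a, b + 1))" "-N \<le> a" "a \<le> N" "-N \<le> b" "b < N"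
  using assms by (auto simp: grid_edges_def)

lemma grid_edges_square: "(x, y) \<in> grid_edges N \<Longrightarrow> x \<in> square N \<and> y \<in> square N"
  by (auto simp: grid_edges_def square_def)

lemma node_0: "node n (x, y) 0 = dilate n x" and node_n: "node n (x, y) n = dilate n y"
  by (simp_all add: node_def dilate_def algebra_simps)

lemma inj_dilate: "0 < n \<Longrightarrow> inj (dilate n)"
  by (auto simp: inj_def dilate_def prod_eq_iff)

lemma square_endpoint:
  assumes "1 \<le> N" "x \<in> square N"
  shows "\<exists>e\<in>grid_edges N. fst e = x \<or> snd e = x"
proof (cases "fst x < N")
  case True
  then have "(x, (fst x + 1, snd x)) \<in> grid_edges N" using assms by (auto simp: grid_edges_def square_def image_iff)
  then show ?thesis by force
next
  case False
  then have "((fst x - 1, snd x), x) \<in> grid_edges N" using assms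
    by (cases x) (auto simp: grid_edges_def square_def image_iff)
  then show ?thesis by force
qed

lemma dilate_in_sub_verts:
  assumes "1 \<le> N" "x \<in> square N"
  shows "dilate n x \<in> sub_verts N n"
proof -
  obtain e where e: "e \<in> grid_edges N" "fst e = x \<or> snd e = x" using square_endpoint[OF assms] by blast
  obtain y z where yz: "e = (y, z)" by (cases e)
  show ?thesis
  proof (cases "x = y")
    case True
    then have "dilate n x = node n e 0" by (simp add: node_0 yz)
    then show ?thesis using e(1) by (force simp: sub_verts_def)
  next
    case False
    then have "dilate n x = node n e n" using e(2) by (simp add: node_n yz)
    then show ?thesis using e(1) by (force simp: sub_verts_def)
  qed
qed

text \<open>The walk's Green's function belongs to edges of conductance 1/4; n pieces in series give
  this if each has conductance n/4.\<close>

lemma network_sub: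
  assumes "0 < n"
  shows "network (sub_verts N n) (sub_edges N n) (sub_src n) (sub_tgt n) (real n / 4) (kill N n)"
proof
  show "finite (sub_verts N n)" "finite (sub_edges N n)"
    by (simp_all add: sub_verts_def sub_edges_def finite_grid_edges)
  show "sub_src n e \<in> sub_verts N n" "sub_tgt n e \<in> sub_verts N n" if "e \<in> sub_edges N n" for e
    using that by (force simp: sub_src_def sub_tgt_def sub_verts_def sub_edges_def split: prod.split_asm)+
  show "0 < real n / 4" using assms by simp
  show "0 \<le> kill N n p" for p by (simp add: kill_def sides_def)
qed

lemma sum_grid_edges:
  "(\<Sum>(x, y)\<in>grid_edges N. F x y) = (\<Sum>b\<in>{-N..N}. \<Sum>a\<in>{-N..N - 1}. F (a, b) (a + 1, b))
     + (\<Sum>a\<in>{-N..N}. \<Sum>b\<in>{-N..N - 1}. F (a, b) (a, b + 1) :: real)"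
proof -
  have "(\<Sum>(x, y)\<in>grid_edges N. F x y)
    = (\<Sum>(x, y)\<in>(\<lambda>(a, b). ((a, b), (a + 1, b))) ` ({-N..N - 1} \<times> {-N..N}). F x y)
     + (\<Sum>(x, y)\<in>(\<lambda>(a, b). ((a, b), (a, b + 1))) ` ({-N..N} \<times> {-N..N - 1}). F x y)"
    unfolding grid_edges_def by (rule sum.union_disjoint) auto
  also have "(\<Sum>(x, y)\<in>(\<lambda>(a, b). ((a, b), (a + 1, b))) ` ({-N..N - 1} \<times> {-N..N}). F x y)
     = (\<Sum>(a, b)\<in>{-N..N - 1} \<times> {-N..N}. F (a, b) (a + 1, b))"
    by (subst sum.reindex) (auto simp: inj_on_def case_prod_unfold)
  also have "\<dots> = (\<Sum>b\<in>{-N..N}. \<Sum>a\<in>{-N..N - 1}. F (a, b) (a + 1, b))"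
    by (subst sum.swap) (rule sum.cartesian_product[symmetric])
  also have "(\<Sum>(x, y)\<in>(\<lambda>(a, b). ((a, b), (a, b + 1))) ` ({-N..N} \<times> {-N..N - 1}). F x y)
     = (\<Sum>(a, b)\<in>{-N..N} \<times> {-N..N - 1}. F (a, b) (a, b + 1))"
    by (subst sum.reindex) (auto simp: inj_on_def case_prod_unfold)
  also have "\<dots> = (\<Sum>a\<in>{-N..N}. \<Sum>b\<in>{-N..N - 1}. F (a, b) (a, b + 1))"
    by (rule sum.cartesian_product[symmetric])
  finally show ?thesis .
qed

lemma sum_split_ends:
  fixes F :: "int \<Rightarrow> real"
  assumes "0 \<le> N"
  shows "(\<Sum>a\<in>{-N-1..N}. F a) = F (- N - 1) + (\<Sum>a\<in>{-N..N - 1}. F a) + F N"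
proof -
  have "{-N-1..N} = insert (-N-1) (insert N {-N..N - 1})" using assms by auto
  then show ?thesis using assms by simp
qed

lemma sum_of_bool_abs:
  fixes F :: "int \<Rightarrow> real"
  assumes "1 \<le> N"
  shows "(\<Sum>a\<in>{-N..N}. of_bool (\<bar>a\<bar> = N) * F a) = F (- N) + F N"
proof -
  have "(\<Sum>a\<in>{-N..N}. of_bool (\<bar>a\<bar> = N) * F a) = (\<Sum>a\<in>{-N, N}. of_bool (\<bar>a\<bar> = N) * F a)"
    using assms by (intro sum.mono_neutral_right) auto
  then show ?thesis using assms by simp
qed

text \<open>An edge that leaves the square has value 0 at its outer end and contributes f x * g x,
  which \<open>sides\<close> collects.\<close>

lemma grid_energy:
  assumes N: "1 \<le> N" and f: "\<And>x. x \<notin> square N \<Longrightarrow> f x = 0" and g: "\<And>x. x \<notin> square N \<Longrightarrow> g x = 0"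
  shows "(\<Sum>(x, y)\<in>grid_edges N. (f x - f y) * (g x - g y)) + (\<Sum>x\<in>square N. sides N x * (f x * g x)) 
    = hform N f g + vform N f g"
proof -
  have N0: "0 \<le> N" using N by simp
  have out: "f (N + 1, b) = 0" "f (- N - 1, b) = 0" "f (b, N + 1) = 0" "f (b, - N - 1) = 0" 
     "g (N + 1, b) = 0" "g (- N - 1, b) = 0" "g (b, N + 1) = 0" "g (b, - N - 1) = 0" for b
    by (auto intro!: f g simp: square_def)
  have sw: "(p - q) * (r - s) = (q - p) * (s - r)" for p q r s :: real by (simp add: algebra_simps)
  have h: "hform N f g = (\<Sum>b\<in>{-N..N}. \<Sum>a\<in>{-N..N - 1}. (f (a, b) - f (a + 1, b)) * (g (a, b) - g (a + 1, b)))
     + (\<Sum>b\<in>{-N..N}. \<Sum>a\<in>{-N..N}. of_bool (\<bar>a\<bar> = N) * (f (a, b) * g (a, b)))"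
    unfolding hform_def sum_split_ends[OF N0] sum_of_bool_abs[OF N] sum.distrib
    by (simp add: out sw)
  have v: "vform N f g = (\<Sum>a\<in>{-N..N}. \<Sum>b\<in>{-N..N - 1}. (f (a, b) - f (a, b + 1)) * (g (a, b) - g (a, b + 1)))
     + (\<Sum>a\<in>{-N..N}. \<Sum>b\<in>{-N..N}. of_bool (\<bar>b\<bar> = N) * (f (a, b) * g (a, b)))"
    unfolding vform_def sum_split_ends[OF N0] sum_of_bool_abs[OF N] sum.distrib
    by (simp add: out sw)
  have "(\<Sum>x\<in>square N. sides N x * (f x * g x)) = 
     (\<Sum>a\<in>{-N..N}. \<Sum>b\<in>{-N..N}. of_bool (\<bar>a\<bar> = N) * (f (a, b) * g (a, b)))
     + (\<Sum>a\<in>{-N..N}. \<Sum>b\<in>{-N..N}. of_bool (\<bar>b\<bar> = N) * (f (a, b) * g (a, b)))"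
    unfolding square_def sum.cartesian_product' sides_def sum.distrib[symmetric]
    by (intro sum.cong refl) (auto simp: algebra_simps)
  then show ?thesis
    unfolding h v sum_grid_edges
    by (subst (asm) (1) sum.swap) simp
qed

locale subdivided_grid =
  fixes N :: int and n :: nat
  assumes N: "1 \<le> N" and n: "0 < n"
begin

sublocale network "sub_verts N n" "sub_edges N n" "sub_src n" "sub_tgt n" "real n / 4" "kill N n"
  by (rule network_sub[OF n])

definition vals :: "(vertex \<Rightarrow> real) \<Rightarrow> vertex \<Rightarrow> real" where
  "vals f x = (if x \<in> square N then f (dilate n x) else 0)"

definition edge_form :: "(vertex \<Rightarrow> real) \<Rightarrow> (vertex \<Rightarrow> real) \<Rightarrow> vertex \<times> vertex \<Rightarrow> real" where
  "edge_form f g e = real n / 4 * (\<Sum>j<n. (f (node n e j) - f (node n e (Suc j))) * (g (node n e j) - g (node n e (Suc j))))"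

lemma energy_sum:
  "energy f g = (\<Sum>e\<in>grid_edges N. edge_form f g e)
    + (\<Sum>x\<in>square N. sides N x / 4 * (vals f x * vals g x))"
proof -
  have "(\<Sum>p\<in>sub_verts N n. kill N n p * (f p * g p)) = (\<Sum>p\<in>dilate n ` square N. kill N n p * (f p * g p))"
    using dilate_in_sub_verts[OF N] finV by (intro sum.mono_neutral_right) (auto simp: kill_def)
  also have "\<dots> = (\<Sum>x\<in>square N. kill N n (dilate n x) * (f (dilate n x) * g (dilate n x)))"
    using inj_dilate[OF n] by (subst sum.reindex) (auto simp: inj_on_def inj_def)
  also have "\<dots> = (\<Sum>x\<in>square N. sides N x / 4 * (vals f x * vals g x))"
  proof (intro sum.cong refl)
    fix x assume "x \<in> square N"
    moreover have "sides (int n * N) (dilate n x) = sides N x"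
      using n by (simp add: sides_def dilate_def abs_mult)
    ultimately show "kill N n (dilate n x) * (f (dilate n x) * g (dilate n x)) = sides N x / 4 * (vals f x * vals g x)"
      by (simp add: kill_def vals_def)
  qed
  finally have k: "(\<Sum>p\<in>sub_verts N n. kill N n p * (f p * g p)) = (\<Sum>x\<in>square N. sides N x / 4 * (vals f x * vals g x))" .
  show ?thesis
    unfolding energy_def k unfolding sub_edges_def sum.cartesian_product'
    by (simp add: sub_src_def sub_tgt_def sum_distrib_left edge_form_def)
qed

lemma trace_node: "(x, y) \<in> grid_edges N \<Longrightarrow> f (node n (x, y) 0) = vals f x \<and> f (node n (x, y) n) = vals f y"
  using grid_edges_square[of x y N] by (simp add: node_0 node_n vals_def)

lemma trace_form: "(\<Sum>(x, y)\<in>grid_edges N. (vals f x - vals f y) * (vals g x - vals g y)) 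
    + (\<Sum>x\<in>square N. sides N x * (vals f x * vals g x)) = hform N (vals f) (vals g) + vform N (vals f) (vals g)"
  by (rule grid_energy[OF N]) (auto simp: vals_def)

text \<open>Cauchy-Schwarz on each divided edge: n conductances n/4 in series cost at least as much
  as a single conductance 1/4 between the same end values. Lattice bounds therefore hold for every
  n.\<close>

lemma energy_trace: "(hform N (vals f) (vals f) + vform N (vals f) (vals f)) / 4 \<le> energy f f"
proof -
  have "(\<Sum>(x, y)\<in>grid_edges N. (vals f x - vals f y) * (vals f x - vals f y)) / 4
    \<le> (\<Sum>e\<in>grid_edges N. edge_form f f e)"
    unfolding sum_divide_distrib
  proof (rule sum_mono)
    fix e assume e: "e \<in> grid_edges N"
    obtain x y where xy: "e = (x, y)" by (cases e)
    have t: "vals f x - vals f y = (\<Sum>j<n. f (node n e j) - f (node n e (Suc j)))"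
      using trace_node[of x y f] e sum_lessThan_telescope'[of "\<lambda>j. f (node n e j)" n] by (simp add: xy)
    have "(\<Sum>j<n. (f (node n e j) - f (node n e (Suc j))) * 1)\<^sup>2 \<le> (\<Sum>j<n. (f (node n e j) - f (node n e (Suc j)))\<^sup>2) * (\<Sum>j<n. 1\<^sup>2)"
      by (rule Cauchy_Schwarz_ineq_sum)
    then have "(vals f x - vals f y)\<^sup>2 \<le> real n * (\<Sum>j<n. (f (node n e j) - f (node n e (Suc j)))\<^sup>2)"
      by (simp add: t mult.commute)
    then show "(case e of (x, y) \<Rightarrow> (vals f x - vals f y) * (vals f x - vals f y)) / 4
      \<le> edge_form f f e"
      by (simp add: xy power2_eq_square edge_form_def)
  qed
  moreover have "(\<Sum>x\<in>square N. sides N x * (vals f x * vals f x)) / 4 = (\<Sum>x\<in>square N. sides N x / 4 * (vals f x * vals f x))"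
    by (simp add: sum_divide_distrib)
  ultimately show ?thesis
    unfolding energy_sum trace_form[symmetric] add_divide_distrib by linarith
qed

text \<open>Covariance of the bridge of length 2 of \<open>sqrt 2\<close> times a Brownian motion at the times \<open>2 i / n\<close> and \<open>2 j / n\<close>.\<close>

definition bridge_cov :: "nat \<Rightarrow> nat \<Rightarrow> real" where
  "bridge_cov i j = 4 * real (min i j) * (real n - real (max i j)) / (real n)\<^sup>2"

lemma bridge_cov_ends: "i \<le> n \<Longrightarrow> bridge_cov i 0 = 0" "i \<le> n \<Longrightarrow> bridge_cov i n = 0"
  by (simp_all add: bridge_cov_def)

text \<open>\<open>bridge_cov i\<close> is Green's function with pole i on the path 0, ..., n of
  conductances n/4 with grounded ends. It is linear on either side of i, so the pairing with the
  increments of \<open>v\<close> telescopes on both sides.\<close>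

lemma sum_bridge_cov:
  fixes v :: "nat \<Rightarrow> real"
  assumes "i \<le> n"
  shows "real n / 4 * (\<Sum>j<n. (v j - v (Suc j)) * (bridge_cov i j - bridge_cov i (Suc j)))
    = v i - ((1 - real i / real n) * v 0 + real i / real n * v n)"
proof -
  have "(\<Sum>j<n. (v j - v (Suc j)) * (bridge_cov i j - bridge_cov i (Suc j)))
     = (\<Sum>j<n. (v j - v (Suc j)) * (if j < i then - (4 * (real n - real i) / (real n)\<^sup>2) else 4 * real i / (real n)\<^sup>2))"
  proof (intro sum.cong refl arg_cong2[where f = "(*)"])
    fix j assume "j \<in> {..<n}"
    show "bridge_cov i j - bridge_cov i (Suc j) = (if j < i then - (4 * (real n - real i) / (real n)\<^sup>2) else 4 * real i / (real n)\<^sup>2)"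
    proof (cases "j < i")
      case True
      then have "min i j = j" "max i j = i" "min i (Suc j) = Suc j" "max i (Suc j) = i" by auto
      then show ?thesis using True
        by (simp add: bridge_cov_def diff_divide_distrib[symmetric] minus_divide_left) (simp add: algebra_simps)
    next
      case False
      then have "min i j = i" "max i j = j" "min i (Suc j) = i" "max i (Suc j) = Suc j" by auto
      then show ?thesis using False
        by (simp add: bridge_cov_def diff_divide_distrib[symmetric]) (simp add: algebra_simps)
    qed
  qed
  also have "\<dots> = (\<Sum>j<i. (v j - v (Suc j)) * - (4 * (real n - real i) / (real n)\<^sup>2)) + (\<Sum>j\<in>{i..<n}. (v j - v (Suc j)) * (4 * real i / (real n)\<^sup>2))"
  proof -
    have un: "{..<i} \<union> {i..<n} = {..<n}" using assms by auto
    have sp: "(\<Sum>j<n. F j) = (\<Sum>j<i. F j) + (\<Sum>j\<in>{i..<n}. F j)" for F :: "nat \<Rightarrow> real"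
      by (subst un[symmetric], rule sum.union_disjoint) auto
    show ?thesis unfolding sp by (rule arg_cong2[where f = "(+)"]; rule sum.cong; simp)
  qed
  also have "\<dots> = (v 0 - v i) * - (4 * (real n - real i) / (real n)\<^sup>2) + (v i - v n) * (4 * real i / (real n)\<^sup>2)"
    unfolding sum_distrib_right[symmetric]
    using sum_lessThan_telescope'[of v i] sum_Suc_diff'[of i n "\<lambda>j. - v j"] assms by simp
  finally have eq: "(\<Sum>j<n. (v j - v (Suc j)) * (bridge_cov i j - bridge_cov i (Suc j)))
    = (v 0 - v i) * - (4 * (real n - real i) / (real n)\<^sup>2) + (v i - v n) * (4 * real i / (real n)\<^sup>2)" .
  show ?thesis unfolding eq using n by (simp add: power2_eq_square field_simps)
qed

text \<open>The reproducing property of \<open>u\<close>, which will be the covariance with the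
  field at \<open>node n (x0, y0) i\<close>. The interpolated lattice Green's function reproduces
  the interpolation of the end values of \<open>f\<close>, by \<open>green_laplacian\<close>; the
  bridge term supplies the deviation of \<open>f\<close> from it, by
  \<open>sum_bridge_cov\<close>.\<close>

lemma energy_green:
  assumes e0: "(x0, y0) \<in> grid_edges N" and i: "i \<le> n"
    and u: "\<And>e j. e \<in> grid_edges N \<Longrightarrow> j \<le> n \<Longrightarrow> u (node n e j)
      = (1 - real j / real n) * \<gamma> (fst e) + real j / real n * \<gamma> (snd e) + of_bool (e = (x0, y0)) * bridge_cov i j"
    and \<gamma>: "\<And>x. x \<in> square N \<Longrightarrow> \<gamma> x = (1 - real i / real n) * green (square N) x x0 + real i / real n * green (square N) x y0"
  shows "energy f u = f (node n (x0, y0) i)"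
proof -
  have xy0: "x0 \<in> square N" "y0 \<in> square N" using grid_edges_square[OF e0] by auto
  have tru: "vals u x = \<gamma> x" if x: "x \<in> square N" for x
  proof -
    obtain e where e: "e \<in> grid_edges N" "fst e = x \<or> snd e = x" using square_endpoint[OF N x] by blast
    obtain y z where yz: "e = (y, z)" by (cases e)
    have "u (dilate n y) = \<gamma> y" "u (dilate n z) = \<gamma> z"
      using u[OF e(1), of 0] u[OF e(1), of n] n bridge_cov_ends[OF i] by (simp_all add: yz node_0 node_n)
    then show ?thesis using e(2) x by (auto simp: yz vals_def)
  qed
  define \<gamma>0 where "\<gamma>0 x = (1 - real i / real n) * green (square N) x x0 + real i / real n * green (square N) x y0" for x
  have tru': "vals u = \<gamma>0"
    using tru \<gamma> by (auto simp: \<gamma>0_def green_outside vals_def)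
  have lap: "4 * \<gamma>0 (a, b) - \<gamma>0 (a + 1, b) - \<gamma>0 (a - 1, b) - \<gamma>0 (a, b + 1) - \<gamma>0 (a, b - 1)
      = (1 - real i / real n) * (4 * of_bool ((a, b) = x0)) + real i / real n * (4 * of_bool ((a, b) = y0))" 
    if "(a, b) \<in> square N" for a b
    unfolding green_laplacian[OF that, symmetric] \<gamma>0_def by (simp add: algebra_simps)
  have "hform N (vals f) (vals u) + vform N (vals f) (vals u)
     = (\<Sum>(a, b)\<in>square N. vals f (a, b) * ((1 - real i / real n) * (4 * of_bool ((a, b) = x0)) + real i / real n * (4 * of_bool ((a, b) = y0))))"
    unfolding tru' using N
    by (subst dirichlet_form_laplacian) (auto simp: lap vals_def intro!: sum.cong)
  also have "\<dots> = (\<Sum>x\<in>square N. (if x = x0 then 4 * (1 - real i / real n) * vals f x else 0) + (if x = y0 then 4 * (real i / real n) * vals f x else 0))"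
    by (intro sum.cong refl) (auto simp: algebra_simps)
  also have "\<dots> = 4 * ((1 - real i / real n) * vals f x0 + real i / real n * vals f y0)"
    using xy0 by (simp add: sum.distrib square_def) (simp add: algebra_simps)
  finally have main: "(hform N (vals f) (vals u) + vform N (vals f) (vals u)) / 4 = (1 - real i / real n) * vals f x0 + real i / real n * vals f y0"
    by simp
  \<comment> \<open>The linear part of \<open>u\<close> pairs only with the total increment of
    \<open>f\<close> along the edge, and the bridge is present on the edge (x0, y0) alone.\<close>
  have edge: "edge_form f u e
     = (vals f (fst e) - vals f (snd e)) * (vals u (fst e) - vals u (snd e)) / 4
       + (if e = (x0, y0) then f (node n e i) - ((1 - real i / real n) * vals f x0 + real i / real n * vals f y0) else 0)"
    if e: "e \<in> grid_edges N" for e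
  proof -
    obtain x y where xy: "e = (x, y)" by (cases e)
    have sq: "x \<in> square N" "y \<in> square N" using grid_edges_square e xy by auto
    let ?f = "\<lambda>j. f (node n e j)" and ?u = "\<lambda>j. u (node n e j)" and ?b = "\<lambda>j. bridge_cov i j - bridge_cov i (Suc j)"
    have du: "?u j - ?u (Suc j) = (\<gamma> x - \<gamma> y) / real n + of_bool (e = (x0, y0)) * ?b j"
      if "j < n" for j
    proof -
      have S: "real (Suc j) / real n = real j / real n + 1 / real n" by (simp add: add_divide_distrib)
      have "?u j = (1 - real j / real n) * \<gamma> x + real j / real n * \<gamma> y + of_bool (e = (x0, y0)) * bridge_cov i j"
        "?u (Suc j) = (1 - real (Suc j) / real n) * \<gamma> x + real (Suc j) / real n * \<gamma> y + of_bool (e = (x0, y0)) * bridge_cov i (Suc j)"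
        using u[OF e] that by (simp_all add: xy)
      then show ?thesis unfolding S by (simp add: algebra_simps diff_divide_distrib)
    qed
    have "(\<Sum>j<n. (?f j - ?f (Suc j)) * (?u j - ?u (Suc j)))
      = (\<Sum>j<n. (?f j - ?f (Suc j)) * ((\<gamma> x - \<gamma> y) / real n)
         + of_bool (e = (x0, y0)) * ((?f j - ?f (Suc j)) * ?b j))"
      by (intro sum.cong refl) (simp add: du algebra_simps)
    also have "\<dots> = (?f 0 - ?f n) * ((\<gamma> x - \<gamma> y) / real n)
        + of_bool (e = (x0, y0)) * (\<Sum>j<n. (?f j - ?f (Suc j)) * ?b j)"
      unfolding sum.distrib sum_distrib_right[symmetric] sum_distrib_left[symmetric]
      by (simp add: sum_lessThan_telescope'[of ?f n])
    finally have st: "(\<Sum>j<n. (?f j - ?f (Suc j)) * (?u j - ?u (Suc j)))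
      = (?f 0 - ?f n) * ((\<gamma> x - \<gamma> y) / real n)
        + of_bool (e = (x0, y0)) * (\<Sum>j<n. (?f j - ?f (Suc j)) * ?b j)" .
    have "edge_form f u e
      = (?f 0 - ?f n) * (\<gamma> x - \<gamma> y) / 4
        + of_bool (e = (x0, y0)) * (?f i - ((1 - real i / real n) * ?f 0 + real i / real n * ?f n))"
    proof -
      have "real n / 4 * (p * (q / real n) + r * s) = p * q / 4 + r * (real n / 4 * s)" for p q r s :: real
        using n by (simp add: field_simps)
      from this[of "?f 0 - ?f n" "\<gamma> x - \<gamma> y"] show ?thesis
        unfolding edge_form_def st sum_bridge_cov[OF i, of ?f, symmetric] by simp
    qed
    then show ?thesis
      using trace_node[of x y f] e by (auto simp: xy tru sq)
  qed
  have "energy f u = (\<Sum>e\<in>grid_edges N. (vals f (fst e) - vals f (snd e)) * (vals u (fst e) - vals u (snd e)) / 4)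
     + (f (node n (x0, y0) i) - ((1 - real i / real n) * vals f x0 + real i / real n * vals f y0))
     + (\<Sum>x\<in>square N. sides N x / 4 * (vals f x * vals u x))"
  proof -
    have "(\<Sum>e\<in>grid_edges N. edge_form f u e)
      = (\<Sum>e\<in>grid_edges N. (vals f (fst e) - vals f (snd e)) * (vals u (fst e) - vals u (snd e)) / 4)
      + (\<Sum>e\<in>grid_edges N. if e = (x0, y0) then f (node n e i) - ((1 - real i / real n) * vals f x0 + real i / real n * vals f y0) else 0)"
      unfolding sum.distrib[symmetric] by (rule sum.cong[OF refl edge])
    then show ?thesis unfolding energy_sum using e0 finite_grid_edges by simp
  qed
  also have "\<dots> = (hform N (vals f) (vals u) + vform N (vals f) (vals u)) / 4 
      + (f (node n (x0, y0) i) - ((1 - real i / real n) * vals f x0 + real i / real n * vals f y0))"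
    unfolding trace_form[symmetric] by (simp add: add_divide_distrib sum_divide_distrib case_prod_unfold)
  finally show ?thesis using main by simp
qed

section \<open>Paths in the subdivided square\<close>

lemma adj_cases:
  assumes "adj p q"
  shows "(\<exists>b. snd p = int n * b \<and> snd q = int n * b) \<or> (\<exists>a. fst p = int n * a \<and> fst q = int n * a)"
    and "\<bar>fst p - fst q\<bar> + \<bar>snd p - snd q\<bar> = 1"
proof -
  obtain \<epsilon> where \<epsilon>: "\<epsilon> \<in> sub_edges N n" "sub_src n \<epsilon> = p \<and> sub_tgt n \<epsilon> = q \<or> sub_src n \<epsilon> = q \<and> sub_tgt n \<epsilon> = p"
    using assms unfolding adj_def by blast
  obtain e j where "\<epsilon> = (e, j)" by (cases \<epsilon>)
  with \<epsilon> have e: "e \<in> grid_edges N"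
    and pq: "node n e j = p \<and> node n e (Suc j) = q \<or> node n e j = q \<and> node n e (Suc j) = p"
    by (simp_all add: sub_edges_def sub_src_def sub_tgt_def)
  show "(\<exists>b. snd p = int n * b \<and> snd q = int n * b) \<or> (\<exists>a. fst p = int n * a \<and> fst q = int n * a)"
    "\<bar>fst p - fst q\<bar> + \<bar>snd p - snd q\<bar> = 1"
    using e pq by (cases rule: grid_edges_cases; auto simp: node_def)+
qed

text \<open>The sup norm changes by at most 1 per step, so the value n r cannot be skipped. Where it
  is first reached, the moving coordinate is n r up to sign and the other one is a multiple of n
  because the step follows a grid line; the point is thus a lattice vertex.\<close>

lemma cluster_meets_ring:
  assumes q: "q \<in> cluster (0, 0) S" "sup_norm q = int n * N" and r: "1 \<le> r" "r \<le> N"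
  shows "\<exists>x\<in>square N. sup_norm x = r \<and> dilate n x \<in> cluster (0, 0) S"
proof (rule ccontr)
  assume no: "\<not> ?thesis"
  have "sup_norm p < int n * r" if "p \<in> cluster (0, 0) S" for p
    using that
  proof (induction rule: cluster_induct)
    case base
    then show ?case using n r by (simp add: sup_norm_def)
  next
    case (step p q)
    note ac = adj_cases[OF step.hyps(3)]
    have le: "sup_norm q \<le> int n * r" using step.IH ac(2) by (auto simp: sup_norm_def max_def abs_if split: if_splits)
    have "sup_norm q \<noteq> int n * r"
    proof
      assume eq: "sup_norm q = int n * r"
      have "int n dvd fst q \<and> int n dvd snd q"
        using ac(1)
      proof (elim disjE exE)
        fix b assume b: "snd p = int n * b \<and> snd q = int n * b"
        then have "\<bar>fst q\<bar> = int n * r" using step.IH eq by (auto simp: sup_norm_def max_def split: if_splits)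
        then show ?thesis using b by (metis dvd_triv_left dvd_abs_iff)
      next
        fix a assume a: "fst p = int n * a \<and> fst q = int n * a"
        then have "\<bar>snd q\<bar> = int n * r" using step.IH eq by (auto simp: sup_norm_def max_def split: if_splits)
        then show ?thesis using a by (metis dvd_triv_left dvd_abs_iff)
      qed
      then obtain a b where "fst q = int n * a" "snd q = int n * b" by (auto simp: dvd_def)
      then have qx: "q = dilate n (a, b)" by (simp add: dilate_def prod_eq_iff)
      have "sup_norm q = int n * sup_norm (a, b)"
        using n by (simp add: qx dilate_def sup_norm_def abs_mult max_mult_distrib_left)
      then have "sup_norm (a, b) = r" using eq n by simp
      moreover have "(a, b) \<in> square N" using \<open>sup_norm (a, b) = r\<close> r by (auto simp: square_def sup_norm_def)
      ultimately show False using no step.hyps(2) qx by blast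
    qed
    then show ?case using le by simp
  qed
  from this[OF q(1)] have "N < r" using n by (simp add: q(2))
  then show False using r by simp
qed

text \<open>The constant 1/40 is the 1/10 of \<open>dirichlet_energy_lower\<close> times the
  conductance 1/4 of a lattice edge.\<close>

lemma capacity_lower:
  assumes S: "(0, 0) \<in> S" and q: "q \<in> cluster (0, 0) S" "sup_norm q = int n * N"
    and f: "\<And>p. p \<in> cluster (0, 0) S \<Longrightarrow> f p = 1"
  shows "ln (real_of_int N) / 40 \<le> energy f f"
proof -
  have "ln (real_of_int N) / 10 \<le> hform N (vals f) (vals f) + vform N (vals f) (vals f)"
  proof (rule dirichlet_energy_lower[OF N])
    show "vals f x = 0" if "x \<notin> square N" for x using that by (simp add: vals_def)
    fix r assume r: "r \<in> {0..N}"
    have "\<exists>x\<in>square N. sup_norm x = r \<and> dilate n x \<in> cluster (0, 0) S"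
    proof (cases "r = 0")
      case True
      have "dilate n (0, 0) \<in> cluster (0, 0) S" using cluster_self[OF S] by (simp add: dilate_def)
      then show ?thesis using True N by (intro bexI[of _ "(0, 0)"]) (auto simp: square_def sup_norm_def)
    next
      case False
      then show ?thesis using cluster_meets_ring[OF q, of r] r by auto
    qed
    then obtain x where x: "x \<in> square N" "sup_norm x = r" "dilate n x \<in> cluster (0, 0) S" by blast
    then have "vals f x = 1" using f by (simp add: vals_def)
    with x show "\<exists>x\<in>square N. sup_norm x = r \<and> vals f x = 1" by blast
  qed
  then show ?thesis using energy_trace[of f] by argo
qed

lemma radial_energy_n1:
  assumes "n = 1"
  shows "energy (radial N) (radial N) = radial N (0, 0)"
proof -
  have tr: "vals (radial N) = radial N"
  proof
    fix x
    have "dilate n x = x" by (simp add: dilate_def assms)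
    then show "vals (radial N) x = radial N x"
      using radial_outside[of x N] unfolding vals_def by simp
  qed
  have "energy (radial N) (radial N) = (hform N (radial N) (radial N) + vform N (radial N) (radial N)) / 4"
    using trace_form[of "radial N" "radial N"] assms unfolding energy_sum tr edge_form_def
    by (simp add: sum_divide_distrib add_divide_distrib case_prod_unfold node_def)
       (simp add: sum_divide_distrib[symmetric] add_divide_distrib[symmetric])
  then show ?thesis using radial_energy[of N] N by simp
qed

end

section \<open>The metric-graph field at the division points\<close>

lemma B_eq_square: "B (real_of_int N) = square N"
  by (auto simp: B_def square_def sup_norm_def)

lemma nbr_iff: "nbr x y \<longleftrightarrow> \<bar>fst x - fst y\<bar> + \<bar>snd x - snd y\<bar> = 1"
proof -
  define a b where "a = fst x - fst y" and "b = snd x - snd y"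
  have "nbr x y \<longleftrightarrow> (real_of_int a)\<^sup>2 + (real_of_int b)\<^sup>2 = 1"
    by (simp add: nbr_def pt_def dist_prod_def dist_real_def a_def b_def)
  also have "\<dots> \<longleftrightarrow> a\<^sup>2 + b\<^sup>2 = 1"
    by (simp flip: of_int_power of_int_add)
  also have "\<dots> \<longleftrightarrow> \<bar>a\<bar> + \<bar>b\<bar> = 1"
  proof
    assume *: "a\<^sup>2 + b\<^sup>2 = 1"
    have le: "\<bar>c\<bar> \<le> c\<^sup>2" for c :: int
    proof (cases "c = 0")
      case False
      then have "\<bar>c\<bar> * 1 \<le> \<bar>c\<bar> * \<bar>c\<bar>" by (intro mult_left_mono) auto
      then show ?thesis by (simp add: power2_eq_square)
    qed simp
    have "\<bar>a\<bar> \<le> a\<^sup>2" "\<bar>b\<bar> \<le> b\<^sup>2" by (rule le)+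
    moreover have "a \<noteq> 0 \<or> b \<noteq> 0" using * by auto
    ultimately show "\<bar>a\<bar> + \<bar>b\<bar> = 1" using * by linarith
  next
    assume *: "\<bar>a\<bar> + \<bar>b\<bar> = 1"
    then have "a = 0 \<and> \<bar>b\<bar> = 1 \<or> \<bar>a\<bar> = 1 \<and> b = 0" by linarith
    then show "a\<^sup>2 + b\<^sup>2 = 1" by (auto simp: power2_eq_1_iff abs_eq_iff)
  qed
  finally show ?thesis by (simp add: a_def b_def)
qed

lemma inner_boundary_square:
  "x \<in> inner_boundary (square N) \<longleftrightarrow> sup_norm x = N \<and> x \<in> square N"
proof
  assume "x \<in> inner_boundary (square N)"
  then show "sup_norm x = N \<and> x \<in> square N"
    by (auto simp: inner_boundary_def square_def sup_norm_def nbr_iff max_def abs_if split: if_splits)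
next
  assume x: "sup_norm x = N \<and> x \<in> square N"
  obtain a b where ab: "x = (a, b)" by (cases x)
  have "\<exists>y. y \<notin> square N \<and> nbr x y"
  proof (cases "\<bar>a\<bar> = N")
    case True
    then show ?thesis unfolding ab
      by (intro exI[of _ "(if 0 \<le> a then a + 1 else a - 1, b)"]) (auto simp: square_def nbr_iff)
  next
    case False
    then have "\<bar>b\<bar> = N" using x by (auto simp: ab sup_norm_def max_def split: if_splits)
    then show ?thesis unfolding ab
      by (intro exI[of _ "(a, if 0 \<le> b then b + 1 else b - 1)"]) (auto simp: square_def nbr_iff)
  qed
  then show "x \<in> inner_boundary (square N)" using x by (auto simp: inner_boundary_def)
qed

section \<open>Sums of independent centred normal variables\<close>

lemma centred_normal_if_char:
  assumes [measurable]: "Y \<in> borel_measurable M" and M: "prob_space M"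
    and v: "0 \<le> v" and ch: "\<And>t. char (distr M borel Y) t = complex_of_real (exp (- (v * t\<^sup>2) / 2))"
  shows "centred_normal M Y"
proof -
  interpret prob_space M by fact
  have "distr M borel Y = normal_law 0 (sqrt v)"
    using v by (intro Levy_uniqueness real_distribution_normal_law ext) (auto simp: ch char_normal_law)
  then show ?thesis using v unfolding centred_normal_def by (auto intro!: exI[of _ "sqrt v"])
qed

lemma (in prob_space) centred_normal_sum_indep:
  assumes "indep_vars (\<lambda>_. borel) T I" "\<And>i. i \<in> I \<Longrightarrow> centred_normal M (T i)"
  shows "centred_normal M (\<lambda>\<omega>. \<Sum>i\<in>I. T i \<omega>)"
proof (rule centred_normal_if_char[where v = "\<Sum>i\<in>I. \<integral>\<omega>. (T i \<omega>)\<^sup>2 \<partial>M"])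
  show "(\<lambda>\<omega>. \<Sum>i\<in>I. T i \<omega>) \<in> borel_measurable M"
    using assms(2) by (intro borel_measurable_sum centred_normal_measurable)
  show "char (distr M borel (\<lambda>\<omega>. \<Sum>i\<in>I. T i \<omega>)) t = complex_of_real (exp (- ((\<Sum>i\<in>I. \<integral>\<omega>. (T i \<omega>)\<^sup>2 \<partial>M) * t\<^sup>2) / 2))" for t
  proof (cases "finite I")
    case True
    have "char (distr M borel (\<lambda>\<omega>. \<Sum>i\<in>I. T i \<omega>)) t = (\<Prod>i\<in>I. complex_of_real (exp (- ((\<integral>\<omega>. (T i \<omega>)\<^sup>2 \<partial>M) * t\<^sup>2) / 2)))"
      unfolding char_distr_sum[OF assms(1)] by (intro prod.cong refl centred_normal_char assms(2))
    also have "\<dots> = complex_of_real (exp (\<Sum>i\<in>I. - ((\<integral>\<omega>. (T i \<omega>)\<^sup>2 \<partial>M) * t\<^sup>2) / 2))"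
      using True by (simp only: of_real_prod[symmetric] exp_sum)
    finally show ?thesis
      by (simp add: sum_distrib_right sum_divide_distrib sum_negf)
  next
    case False
    then show ?thesis by (simp add: char_def integral_distr prob_space del: distr_const)
  qed
qed (auto intro!: sum_nonneg prob_space_axioms)

lemma (in prob_space) centred_normal_add_indep:
  assumes "indep_var borel U borel V" "centred_normal M U" "centred_normal M V"
  shows "centred_normal M (\<lambda>\<omega>. U \<omega> + V \<omega>)"
proof (rule centred_normal_if_char[where v = "(\<integral>\<omega>. (U \<omega>)\<^sup>2 \<partial>M) + (\<integral>\<omega>. (V \<omega>)\<^sup>2 \<partial>M)"])
  show "(\<lambda>\<omega>. U \<omega> + V \<omega>) \<in> borel_measurable M"
    using assms by (intro borel_measurable_add centred_normal_measurable)
  show "char (distr M borel (\<lambda>\<omega>. U \<omega> + V \<omega>)) t = complex_of_real (exp (- (((\<integral>\<omega>. (U \<omega>)\<^sup>2 \<partial>M) + (\<integral>\<omega>. (V \<omega>)\<^sup>2 \<partial>M)) * t\<^sup>2) / 2))" for t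
    unfolding char_distr_add[OF assms(1)] centred_normal_char[OF assms(2)] centred_normal_char[OF assms(3)]
    by (simp add: exp_add[symmetric] algebra_simps diff_divide_distrib add_divide_distrib del: of_real_mult flip: of_real_mult)
qed (auto intro!: prob_space_axioms)

text \<open>The events generated by a measurable function of \<open>V\<close> lie in the
  sigma-algebra pulled back along \<open>V\<close>, and likewise for \<open>W\<close>.\<close>

lemma (in prob_space) indep_var_vimage_algebra:
  assumes ind: "indep_set (sets (vimage_algebra (space M) V S)) (sets (vimage_algebra (space M) W T))"
    and V: "V \<in> measurable M S" and W: "W \<in> measurable M T"
    and F: "F \<in> measurable S N" and G: "G \<in> measurable T N"
  shows "indep_var N (\<lambda>\<omega>. F (V \<omega>)) N (\<lambda>\<omega>. G (W \<omega>))"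
proof -
  have sub: "sigma_sets (space M) {(\<lambda>\<omega>. f (Y \<omega>)) -` A \<inter> space M | A. A \<in> sets N} \<subseteq> sets (vimage_algebra (space M) Y R)"
    if Y: "Y \<in> measurable M R" and f: "f \<in> measurable R N" for Y R and f :: "'x \<Rightarrow> _"
    unfolding sets_vimage_algebra
  proof (intro sigma_sets_subseteq subsetI)
    fix C assume "C \<in> {(\<lambda>\<omega>. f (Y \<omega>)) -` A \<inter> space M | A. A \<in> sets N}"
    then obtain A where A: "C = (\<lambda>\<omega>. f (Y \<omega>)) -` A \<inter> space M" "A \<in> sets N" by blast
    have "C = Y -` (f -` A \<inter> space R) \<inter> space M" using A(1) measurable_space[OF Y] by auto
    then show "C \<in> {Y -` A \<inter> space M | A. A \<in> sets R}" using measurable_sets[OF f A(2)] by blast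
  qed
  have "indep_set (sigma_sets (space M) {(\<lambda>\<omega>. F (V \<omega>)) -` A \<inter> space M | A. A \<in> sets N})
     (sigma_sets (space M) {(\<lambda>\<omega>. G (W \<omega>)) -` A \<inter> space M | A. A \<in> sets N})"
    using ind sub[OF V F] sub[OF W G] unfolding indep_sets2_eq by blast
  then show ?thesis
    unfolding indep_var_eq using measurable_compose[OF V F] measurable_compose[OF W G] by blast
qed

section \<open>The law of the sampled field\<close>

locale mgff =
  fixes K :: nat and M :: "'w measure" and \<phi> :: "real \<times> real \<Rightarrow> 'w \<Rightarrow> real" and n :: nat
  assumes K: "1 \<le> K" and n0: "0 < n" and gff: "metric_graph_gff K M \<phi>"
begin

sublocale prob_space M
  using gff by (simp add: metric_graph_gff_def)

sublocale subdivided_grid "int K" n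
  using K n0 by unfold_locales auto

abbreviation sq :: "vertex set" where "sq \<equiv> square (int K)"
abbreviation edges :: "(vertex \<times> vertex) set" where "edges \<equiv> grid_edges (int K)"
abbreviation verts :: "vertex set" where "verts \<equiv> sub_verts (int K) n"

definition X :: "vertex \<Rightarrow> 'w \<Rightarrow> real" where
  "X p = \<phi> (real_of_int (fst p) / real n, real_of_int (snd p) / real n)"

definition \<beta> :: "vertex \<times> vertex \<Rightarrow> nat \<Rightarrow> 'w \<Rightarrow> real" where
  "\<beta> e j = edge_bridge \<phi> e (2 * real j / real n)"

lemma B_K: "B (real K) = sq" and B_K1: "B (real K + 1) = square (int K + 1)" "B (1 + real K) = square (int K + 1)"
  using B_eq_square[of "int K"] B_eq_square[of "int K + 1"] by (simp_all add: add.commute)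

lemma edges_free: "edges \<subseteq> free_edges K"
proof
  fix e assume e: "e \<in> edges"
  obtain x y where xy: "e = (x, y)" by (cases e)
  have sq: "x \<in> sq" "y \<in> sq" using grid_edges_square e xy by auto
  then have "x \<in> square (int K + 1)" "y \<in> square (int K + 1)" "x \<notin> inner_boundary (square (int K + 1))"
    unfolding inner_boundary_square by (auto simp: square_def sup_norm_def)
  moreover have "nbr x y \<and> fst x \<le> fst y \<and> snd x \<le> snd y"
    using e by (cases rule: grid_edges_cases) (auto simp: xy nbr_iff)
  ultimately show "e \<in> free_edges K"
    by (simp add: free_edges_def B_K1 xy)
qed

lemma vertex_gaussian: "centred_gaussian_field M (sq) (\<lambda>x. \<phi> (pt x))"
proof -
  have "centred_gaussian_field M (square (int K + 1)) (\<lambda>x. \<phi> (pt x))"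
    using gff by (simp add: metric_graph_gff_def discrete_gff_def B_K1 add.commute)
  moreover have "sq \<subseteq> square (int K + 1)" by (auto simp: square_def)
  ultimately show ?thesis unfolding centred_gaussian_field_def by blast
qed

lemma vertex_cov: "x \<in> sq \<Longrightarrow> y \<in> sq \<Longrightarrow> (\<integral>\<omega>. \<phi> (pt x) \<omega> * \<phi> (pt y) \<omega> \<partial>M) = green (sq) x y"
  using gff by (simp add: metric_graph_gff_def discrete_gff_def B_K)

lemma bridge: "e \<in> free_edges K \<Longrightarrow> brownian_bridge M (sqrt 2) 2 (edge_bridge \<phi> e)"
  using gff by (simp add: metric_graph_gff_def)

lemma div_pt_range: "j \<le> n \<Longrightarrow> 2 * real j / real n \<in> {0..2}"
  using n0 by (simp add: divide_le_eq)

lemma bridge_normal: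
  assumes e: "e \<in> free_edges K"
  shows "centred_normal M (\<lambda>\<omega>. \<Sum>j\<le>n. c j * \<beta> e j \<omega>)"
proof -
  have inj: "inj_on (\<lambda>j. 2 * real j / real n) {..n}" using n0 by (auto simp: inj_on_def)
  let ?J = "(\<lambda>j. 2 * real j / real n) ` {..n}"
  have "centred_gaussian_field M {0..2} (edge_bridge \<phi> e)" using bridge[OF e] by (simp add: brownian_bridge_def)
  moreover have "?J \<subseteq> {0..2}" using div_pt_range by blast
  ultimately have cg: "centred_gaussian_field M ?J (edge_bridge \<phi> e)" unfolding centred_gaussian_field_def by blast
  \<comment> \<open>Gaussianity is given for sums over sets of times; the coefficients are carried
    over by the inverse of the injection of j to 2 j / n.\<close>
  have "centred_normal M (\<lambda>\<omega>. \<Sum>t\<in>?J. c (the_inv_into {..n} (\<lambda>j. 2 * real j / real n) t) * edge_bridge \<phi> e t \<omega>)"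
    by (rule centred_gaussian_field_sum[OF cg]) simp
  then show ?thesis
    by (simp add: sum.reindex[OF inj] the_inv_into_f_f[OF inj] \<beta>_def)
qed

lemma bridge_single:
  assumes e: "e \<in> free_edges K" and j: "j \<le> n"
  shows "centred_normal M (\<beta> e j)"
proof -
  have "centred_gaussian_field M {0..2} (edge_bridge \<phi> e)" using bridge[OF e] by (simp add: brownian_bridge_def)
  from centred_gaussian_field_single[OF this div_pt_range[OF j]] show ?thesis by (simp add: \<beta>_def)
qed

lemma bridge_cov_same:
  assumes e: "e \<in> free_edges K" and "i \<le> n" "j \<le> n"
  shows "(\<integral>\<omega>. \<beta> e j \<omega> * \<beta> e i \<omega> \<partial>M) = bridge_cov i j"
proof -
  let ?s = "2 * real j / real n" and ?t = "2 * real i / real n"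
  have "(\<integral>\<omega>. \<beta> e j \<omega> * \<beta> e i \<omega> \<partial>M) = (sqrt 2)\<^sup>2 * (min ?s ?t * (2 - max ?s ?t) / 2)"
    using bridge[OF e] div_pt_range[OF assms(2)] div_pt_range[OF assms(3)] unfolding \<beta>_def brownian_bridge_def by blast
  moreover have "min ?s ?t = 2 * real (min i j) / real n" "max ?s ?t = 2 * real (max i j) / real n"
    using n0 by (auto simp: min_def max_def divide_le_cancel)
  ultimately show ?thesis
    using n0 by (simp add: bridge_cov_def power2_eq_square) (simp add: field_simps)
qed

lemma indep_bridges:
  assumes F: "\<And>e. F e \<in> borel_measurable (PiM {0..2} (\<lambda>_. borel))"
  shows "indep_vars (\<lambda>_. borel) (\<lambda>e \<omega>. F e (\<lambda>t\<in>{0..2}. edge_bridge \<phi> e t \<omega>)) (edges)"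
proof -
  have "indep_vars (\<lambda>_. PiM {0..2} (\<lambda>_. borel)) (\<lambda>e \<omega>. \<lambda>t\<in>{0..2}. edge_bridge \<phi> e t \<omega>) (free_edges K)"
    using gff by (simp add: metric_graph_gff_def)
  then have "indep_vars (\<lambda>_. PiM {0..2} (\<lambda>_. borel)) (\<lambda>e \<omega>. \<lambda>t\<in>{0..2}. edge_bridge \<phi> e t \<omega>) (edges)"
    by (rule indep_vars_subset[OF _ edges_free])
  then show ?thesis by (rule indep_vars_compose2) (rule F)
qed

lemma indep_vertices_bridges:
  assumes F: "F \<in> borel_measurable (PiM (B (real K + 1)) (\<lambda>_. borel))"
    and G: "G \<in> borel_measurable (PiM (free_edges K \<times> {0..2}) (\<lambda>_. borel))"
  shows "indep_var borel (\<lambda>\<omega>. F (\<lambda>x\<in>B (real K + 1). \<phi> (pt x) \<omega>))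
     borel (\<lambda>\<omega>. G (\<lambda>(e, t)\<in>free_edges K \<times> {0..2}. edge_bridge \<phi> e t \<omega>))"
proof -
  let ?V = "\<lambda>\<omega>. \<lambda>x\<in>B (real K + 1). \<phi> (pt x) \<omega>"
  let ?W = "\<lambda>\<omega>. \<lambda>(e, t)\<in>free_edges K \<times> {0..2}. edge_bridge \<phi> e t \<omega>"
  have "?V \<in> measurable M (PiM (B (real K + 1)) (\<lambda>_. borel))"
    using gff by (intro measurable_restrict) (auto simp: metric_graph_gff_def discrete_gff_def centred_gaussian_field_def add.commute)
  moreover have "?W \<in> measurable M (PiM (free_edges K \<times> {0..2}) (\<lambda>_. borel))"
    using bridge by (intro measurable_restrict) (auto simp: brownian_bridge_def centred_gaussian_field_def)
  moreover have "indep_set (sets (vimage_algebra (space M) ?V (PiM (B (real K + 1)) (\<lambda>_. borel))))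
      (sets (vimage_algebra (space M) ?W (PiM (free_edges K \<times> {0..2}) (\<lambda>_. borel))))"
    using gff by (simp add: metric_graph_gff_def add.commute)
  ultimately show ?thesis by (intro indep_var_vimage_algebra[OF _ _ _ F G])
qed

text \<open>The vertex part is Gaussian by assumption. The bridges of different edges are
  independent of each other and jointly of the vertex values, so sums of independent normal
  variables complete the joint Gaussianity.\<close>

lemma combination_normal:
  "centred_normal M (\<lambda>\<omega>. (\<Sum>x\<in>sq. b x * \<phi> (pt x) \<omega>) + (\<Sum>e\<in>edges. \<Sum>j\<le>n. c e j * \<beta> e j \<omega>))"
proof (rule centred_normal_add_indep)
  have fin: "finite (sq)" by (simp add: square_def)
  show "centred_normal M (\<lambda>\<omega>. \<Sum>x\<in>sq. b x * \<phi> (pt x) \<omega>)"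
    by (rule centred_gaussian_field_sum[OF vertex_gaussian fin])
  have "indep_vars (\<lambda>_. borel) (\<lambda>e \<omega>. (\<lambda>g. \<Sum>j\<le>n. c e j * g (2 * real j / real n)) (\<lambda>t\<in>{0..2}. edge_bridge \<phi> e t \<omega>)) (edges)"
  proof (rule indep_bridges)
    show "(\<lambda>g. \<Sum>j\<le>n. c e j * g (2 * real j / real n)) \<in> borel_measurable (PiM {0..2} (\<lambda>_. borel))" for e
      using div_pt_range by (intro borel_measurable_sum borel_measurable_times borel_measurable_const measurable_component_singleton) auto
  qed
  then have "indep_vars (\<lambda>_. borel) (\<lambda>e \<omega>. \<Sum>j\<le>n. c e j * \<beta> e j \<omega>) (edges)"
    by (rule iffD1[OF indep_vars_cong, rotated -1]) (use div_pt_range in \<open>auto simp: \<beta>_def restrict_def intro!: ext sum.cong\<close>)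
  then show "centred_normal M (\<lambda>\<omega>. \<Sum>e\<in>edges. \<Sum>j\<le>n. c e j * \<beta> e j \<omega>)"
    by (rule centred_normal_sum_indep) (use bridge_normal edges_free in blast)
  let ?F = "\<lambda>g. \<Sum>x\<in>sq. b x * g x"
  let ?G = "\<lambda>g. \<Sum>e\<in>edges. \<Sum>j\<le>n. c e j * g (e, 2 * real j / real n)"
  have sub: "sq \<subseteq> B (real K + 1)" by (auto simp: B_K1 square_def)
  have "indep_var borel (\<lambda>\<omega>. ?F (\<lambda>x\<in>B (real K + 1). \<phi> (pt x) \<omega>))
     borel (\<lambda>\<omega>. ?G (\<lambda>(e, t)\<in>free_edges K \<times> {0..2}. edge_bridge \<phi> e t \<omega>))"
    using sub edges_free div_pt_range
    by (intro indep_vertices_bridges borel_measurable_sum borel_measurable_times borel_measurable_const measurable_component_singleton) auto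
  moreover have "?F (\<lambda>x\<in>B (real K + 1). \<phi> (pt x) \<omega>) = (\<Sum>x\<in>sq. b x * \<phi> (pt x) \<omega>)" for \<omega>
    using sub by (intro sum.cong refl) auto
  moreover have "?G (\<lambda>(e, t)\<in>free_edges K \<times> {0..2}. edge_bridge \<phi> e t \<omega>) = (\<Sum>e\<in>edges. \<Sum>j\<le>n. c e j * \<beta> e j \<omega>)" for \<omega>
  proof (intro sum.cong refl)
    fix e j assume "e \<in> edges" "j \<in> {..n}"
    then have "(e, 2 * real j / real n) \<in> free_edges K \<times> {0..2}" using edges_free div_pt_range by auto
    then show "c e j * (\<lambda>(e, t)\<in>free_edges K \<times> {0..2}. edge_bridge \<phi> e t \<omega>) (e, 2 * real j / real n) = c e j * \<beta> e j \<omega>"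
      by (simp add: \<beta>_def)
  qed
  ultimately show "indep_var borel (\<lambda>\<omega>. \<Sum>x\<in>sq. b x * \<phi> (pt x) \<omega>) borel (\<lambda>\<omega>. \<Sum>e\<in>edges. \<Sum>j\<le>n. c e j * \<beta> e j \<omega>)"
    by simp
qed

lemma cov_vertex_bridge:
  assumes x: "x \<in> sq" and e: "e \<in> edges" and j: "j \<le> n"
  shows "(\<integral>\<omega>. \<phi> (pt x) \<omega> * \<beta> e j \<omega> \<partial>M) = 0"
proof -
  have mem: "x \<in> B (real K + 1)" "(e, 2 * real j / real n) \<in> free_edges K \<times> {0..2}"
    using x e edges_free div_pt_range[OF j] by (auto simp: B_K1 square_def)
  have cn: "centred_normal M (\<phi> (pt x))" "centred_normal M (\<beta> e j)"
    using centred_gaussian_field_single[OF vertex_gaussian x] bridge_single[OF _ j] e edges_free by blast+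
  have "indep_var borel (\<lambda>\<omega>. (\<lambda>g. g x) (\<lambda>x\<in>B (real K + 1). \<phi> (pt x) \<omega>))
     borel (\<lambda>\<omega>. (\<lambda>g. g (e, 2 * real j / real n)) (\<lambda>(e, t)\<in>free_edges K \<times> {0..2}. edge_bridge \<phi> e t \<omega>))"
    using mem by (intro indep_vertices_bridges measurable_component_singleton) auto
  then have "indep_var borel (\<phi> (pt x)) borel (\<beta> e j)"
    using mem by (simp add: \<beta>_def[abs_def])
  from indep_var_lebesgue_integral[OF this] show ?thesis
    using centred_normal_moments[OF cn(1)] centred_normal_moments[OF cn(2)] 
      square_integrable_imp_integrable[OF centred_normal_measurable[OF cn(1)]] square_integrable_imp_integrable[OF centred_normal_measurable[OF cn(2)]]
    by simp
qed

lemma cov_bridges: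
  assumes e: "e \<in> edges" "e' \<in> edges" "e \<noteq> e'" and j: "i \<le> n" "j \<le> n"
  shows "(\<integral>\<omega>. \<beta> e j \<omega> * \<beta> e' i \<omega> \<partial>M) = 0"
proof -
  \<comment> \<open>One family indexed by edges has to evaluate the two bridges at different times,
    hence the conditional.\<close>
  have "indep_vars (\<lambda>_. borel) (\<lambda>e'' \<omega>. (\<lambda>g. g (2 * real (if e'' = e then j else i) / real n)) (\<lambda>t\<in>{0..2}. edge_bridge \<phi> e'' t \<omega>)) (edges)"
  proof (rule indep_bridges)
    show "(\<lambda>g. g (2 * real (if e'' = e then j else i) / real n)) \<in> borel_measurable (PiM {0..2} (\<lambda>_. borel))" for e''
      using div_pt_range j by (intro measurable_component_singleton) auto
  qed
  then have iv: "indep_vars (\<lambda>_. borel) (\<lambda>e'' \<omega>. (\<lambda>g. g (2 * real (if e'' = e then j else i) / real n)) (\<lambda>t\<in>{0..2}. edge_bridge \<phi> e'' t \<omega>)) {e, e'}"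
    by (rule indep_vars_subset) (use e in auto)
  have cn: "centred_normal M (\<beta> e j)" "centred_normal M (\<beta> e' i)"
    using bridge_single j e edges_free by blast+
  have eq: "(\<lambda>g. g (2 * real (if e'' = e then j else i) / real n)) (\<lambda>t\<in>{0..2}. edge_bridge \<phi> e'' t \<omega>) = \<beta> e'' (if e'' = e then j else i) \<omega>" for e'' \<omega>
    using div_pt_range j by (auto simp: \<beta>_def)
  have int: "integrable M (\<beta> e j)" "integrable M (\<beta> e' i)"
    using centred_normal_moments[OF cn(1)] centred_normal_moments[OF cn(2)] 
      square_integrable_imp_integrable[OF centred_normal_measurable[OF cn(1)]] square_integrable_imp_integrable[OF centred_normal_measurable[OF cn(2)]]
    by auto
  have "integrable M (\<beta> e'' (if e'' = e then j else i))" if "e'' \<in> {e, e'}" for e''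
    using that int e(3) by (cases "e'' = e") simp_all
  from indep_vars_lebesgue_integral[OF _ iv[unfolded eq] this]
  have "(\<integral>\<omega>. (\<Prod>e''\<in>{e, e'}. \<beta> e'' (if e'' = e then j else i) \<omega>) \<partial>M) = (\<Prod>e''\<in>{e, e'}. \<integral>\<omega>. \<beta> e'' (if e'' = e then j else i) \<omega> \<partial>M)"
    by blast
  then show ?thesis using e(3) centred_normal_moments[OF cn(1)] by simp
qed

lemma X_node:
  assumes "e \<in> edges"
  shows "X (node n e j) \<omega> = (1 - real j / real n) * \<phi> (pt (fst e)) \<omega> + real j / real n * \<phi> (pt (snd e)) \<omega> + \<beta> e j \<omega>"
proof -
  obtain x y where xy: "e = (x, y)" by (cases e)
  have "(real_of_int (fst (node n e j)) / real n, real_of_int (snd (node n e j)) / real n) = edge_pt x y (2 * real j / real n)"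
    using n0 by (simp add: node_def xy edge_pt_def pt_def field_simps)
  then show ?thesis by (simp add: X_def \<beta>_def edge_bridge_def xy)
qed

text \<open>Reduces Gaussianity of the samples to \<open>combination_normal\<close>. A lattice
  vertex is a node of several edges; any representation serves.\<close>

lemma X_combination:
  assumes "finite J" "J \<subseteq> verts"
  shows "\<exists>b c. \<forall>\<omega>. (\<Sum>p\<in>J. a p * X p \<omega>) = (\<Sum>x\<in>sq. b x * \<phi> (pt x) \<omega>) + (\<Sum>e\<in>edges. \<Sum>j\<le>n. c e j * \<beta> e j \<omega>)"
  using assms
proof (induction J rule: finite_induct)
  case empty
  show ?case by (intro exI[of _ "\<lambda>_. 0"] exI[of _ "\<lambda>_ _. 0"]) simp
next
  case (insert p J)
  then obtain b c where bc: "(\<Sum>p\<in>J. a p * X p \<omega>) = (\<Sum>x\<in>sq. b x * \<phi> (pt x) \<omega>) + (\<Sum>e\<in>edges. \<Sum>j\<le>n. c e j * \<beta> e j \<omega>)" for \<omega>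
    by blast
  obtain e j where e: "e \<in> edges" "j \<le> n" "p = node n e j" using insert.prems by (auto simp: sub_verts_def)
  have es: "fst e \<in> sq" "snd e \<in> sq" using grid_edges_square[of "fst e" "snd e"] e by auto
  have fin: "finite sq" by (simp add: square_def)
  define b' where "b' x = (if x = fst e then a p * (1 - real j / real n) else 0) + (if x = snd e then a p * (real j / real n) else 0)" for x
  define c' where "c' e' i = (if e' = e then if i = j then a p else 0 else 0)" for e' i
  have "(\<Sum>x\<in>sq. b' x * \<phi> (pt x) \<omega>) = a p * ((1 - real j / real n) * \<phi> (pt (fst e)) \<omega> + real j / real n * \<phi> (pt (snd e)) \<omega>)" for \<omega>
  proof -
    have "(\<Sum>x\<in>sq. b' x * \<phi> (pt x) \<omega>) = (\<Sum>x\<in>sq. (if x = fst e then a p * (1 - real j / real n) * \<phi> (pt x) \<omega> else 0)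
        + (if x = snd e then a p * (real j / real n) * \<phi> (pt x) \<omega> else 0))"
      by (intro sum.cong refl) (simp add: b'_def distrib_right)
    then show ?thesis using es fin by (simp add: sum.distrib) (simp add: algebra_simps)
  qed
  moreover have "(\<Sum>e'\<in>edges. \<Sum>i\<le>n. c' e' i * \<beta> e' i \<omega>) = a p * \<beta> e j \<omega>" for \<omega>
  proof -
    have "(\<Sum>i\<le>n. c' e' i * \<beta> e' i \<omega>) = (\<Sum>i\<le>n. if i = j then if e' = e then a p * \<beta> e' i \<omega> else 0 else 0)" for e'
      by (intro sum.cong refl) (simp add: c'_def)
    then show ?thesis using e finite_grid_edges by simp
  qed
  ultimately have "(\<Sum>p\<in>insert p J. a p * X p \<omega>) = (\<Sum>x\<in>sq. (b' x + b x) * \<phi> (pt x) \<omega>) + (\<Sum>e\<in>edges. \<Sum>j\<le>n. (c' e j + c e j) * \<beta> e j \<omega>)" for \<omega>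
    using insert.hyps by (simp add: bc e(3) X_node[OF e(1)] distrib_right sum.distrib distrib_left)
  then show ?case by (intro exI[of _ "\<lambda>x. b' x + b x"] exI[of _ "\<lambda>e j. c' e j + c e j"] allI)
qed

lemma X_gaussian: "centred_gaussian_field M verts X"
proof -
  have comb: "centred_normal M (\<lambda>\<omega>. \<Sum>p\<in>J. a p * X p \<omega>)" if "finite J" "J \<subseteq> verts" for J a
    using X_combination[OF that, of a] combination_normal by (metis (no_types, lifting) ext)
  have "X p \<in> borel_measurable M" if "p \<in> verts" for p
    using comb[of "{p}" "\<lambda>_. 1"] that by (simp add: centred_normal_def)
  then show ?thesis using comb by (simp add: centred_gaussian_field_def centred_normal_def)
qed

text \<open>Let \<open>u\<close> be the covariance of the samples with \<open>X r\<close>. By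
  \<open>sum_L\<close>, the claim \<open>green_inverse\<close> reads
  \<open>energy f u = f r\<close>, and independence brings \<open>u\<close> into the form that
  \<open>energy_green\<close> requires.\<close>

sublocale gaussian_network verts "sub_edges (int K) n" "sub_src n" "sub_tgt n" "real n / 4" "kill (int K) n" M X
proof (unfold_locales, rule X_gaussian)
  fix f r assume "r \<in> verts"
  then obtain e0 i where e0: "e0 \<in> edges" "i \<le> n" "r = node n e0 i" by (auto simp: sub_verts_def)
  obtain x0 y0 where xy0: "e0 = (x0, y0)" by (cases e0)
  have sq0: "x0 \<in> sq" "y0 \<in> sq" using grid_edges_square e0(1) xy0 by auto
  define s where "s = real i / real n"
  have Xr: "X r \<omega> = (1 - s) * \<phi> (pt x0) \<omega> + s * \<phi> (pt y0) \<omega> + \<beta> e0 i \<omega>" for \<omega>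
    using X_node[OF e0(1)] e0(3) by (simp add: xy0 s_def)
  have cnv: "centred_normal M (\<phi> (pt x))" if "x \<in> sq" for x
    by (rule centred_gaussian_field_single[OF vertex_gaussian that])
  have cnb: "centred_normal M (\<beta> e j)" if "e \<in> edges" "j \<le> n" for e j
    using bridge_single that edges_free by blast
  have cnX: "centred_normal M (X p)" if "p \<in> verts" for p
    by (rule centred_gaussian_field_single[OF X_gaussian that])
  have rV: "r \<in> verts" by fact
  have mX: "(\<integral>\<omega>. Y \<omega> * X r \<omega> \<partial>M) = (1 - s) * (\<integral>\<omega>. Y \<omega> * \<phi> (pt x0) \<omega> \<partial>M) + s * (\<integral>\<omega>. Y \<omega> * \<phi> (pt y0) \<omega> \<partial>M) + (\<integral>\<omega>. Y \<omega> * \<beta> e0 i \<omega> \<partial>M)"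
    if Y: "centred_normal M Y" for Y
  proof -
    have "(\<integral>\<omega>. Y \<omega> * X r \<omega> \<partial>M) = (\<integral>\<omega>. (1 - s) * (Y \<omega> * \<phi> (pt x0) \<omega>) + s * (Y \<omega> * \<phi> (pt y0) \<omega>) + Y \<omega> * \<beta> e0 i \<omega> \<partial>M)"
      by (intro Bochner_Integration.integral_cong refl) (simp add: Xr algebra_simps)
    then show ?thesis
      using centred_normal_mult_integrable[OF Y cnv[OF sq0(1)]] centred_normal_mult_integrable[OF Y cnv[OF sq0(2)]]
        centred_normal_mult_integrable[OF Y cnb[OF e0(1,2)]] by simp
  qed
  define \<gamma> where "\<gamma> x = (\<integral>\<omega>. \<phi> (pt x) \<omega> * X r \<omega> \<partial>M)" for x
  define u where "u p = (\<integral>\<omega>. X p \<omega> * X r \<omega> \<partial>M)" for p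
  have \<gamma>: "\<gamma> x = (1 - s) * green (sq) x x0 + s * green (sq) x y0" if x: "x \<in> sq" for x
    unfolding \<gamma>_def mX[OF cnv[OF x]] using cov_vertex_bridge[OF x e0(1,2)] by (simp add: vertex_cov x sq0)
  have \<beta>: "(\<integral>\<omega>. \<beta> e j \<omega> * X r \<omega> \<partial>M) = of_bool (e = (x0, y0)) * bridge_cov i j" if e: "e \<in> edges" "j \<le> n" for e j
    unfolding mX[OF cnb[OF e]]
    using cov_vertex_bridge[OF sq0(1) e] cov_vertex_bridge[OF sq0(2) e] bridge_cov_same[of e i j] cov_bridges[of e e0 i j] e e0 edges_free
    by (auto simp: mult.commute xy0)
  have u: "u (node n e j) = (1 - real j / real n) * \<gamma> (fst e) + real j / real n * \<gamma> (snd e) + of_bool (e = (x0, y0)) * bridge_cov i j"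
    if e: "e \<in> edges" "j \<le> n" for e j
  proof -
    have sq: "fst e \<in> sq" "snd e \<in> sq" using grid_edges_square[of "fst e" "snd e"] e by auto
    have "u (node n e j) = (\<integral>\<omega>. (1 - real j / real n) * (\<phi> (pt (fst e)) \<omega> * X r \<omega>) + real j / real n * (\<phi> (pt (snd e)) \<omega> * X r \<omega>) + \<beta> e j \<omega> * X r \<omega> \<partial>M)"
      unfolding u_def by (intro Bochner_Integration.integral_cong refl) (simp add: X_node[OF e(1)] algebra_simps)
    then show ?thesis
      using centred_normal_mult_integrable[OF cnv[OF sq(1)] cnX[OF rV]] centred_normal_mult_integrable[OF cnv[OF sq(2)] cnX[OF rV]]
        centred_normal_mult_integrable[OF cnb[OF e] cnX[OF rV]] by (simp add: \<gamma>_def \<beta>[OF e])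
  qed
  have "(\<integral>\<omega>. (\<Sum>p\<in>verts. L f p * X p \<omega>) * X r \<omega> \<partial>M) = (\<integral>\<omega>. (\<Sum>p\<in>verts. L f p * (X p \<omega> * X r \<omega>)) \<partial>M)"
    by (simp add: sum_distrib_right mult.assoc)
  also have "\<dots> = (\<Sum>p\<in>verts. L f p * u p)"
    unfolding u_def by (subst Bochner_Integration.integral_sum)
      (auto intro!: integrable_mult_right centred_normal_mult_integrable cnX rV)
  also have "\<dots> = energy f u" by (rule sum_L)
  also have "\<dots> = f r"
    using energy_green[of x0 y0 i u \<gamma> f] e0 u \<gamma> by (simp add: xy0 s_def)
  finally show "(\<integral>\<omega>. (\<Sum>p\<in>verts. L f p * X p \<omega>) * X r \<omega> \<partial>M) = f r" .
qed

end

section \<open>Connected subsets of the metric graph\<close>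

lemma metric_graph_integer_coordinate:
  assumes "p \<in> metric_graph A"
  shows "(\<exists>a. fst p = real_of_int a) \<or> (\<exists>b. snd p = real_of_int b)"
proof -
  from assms consider x where "p = pt x" 
    | x y where "nbr x y" "p \<in> closed_segment (pt x) (pt y)"
    unfolding metric_graph_def by blast
  then show ?thesis
  proof cases
    case 1
    then show ?thesis by (auto simp: pt_def)
  next
    case 2
    then obtain u where p: "p = (1 - u) *\<^sub>R pt x + u *\<^sub>R pt y" by (auto simp: closed_segment_def)
    have "fst x = fst y \<or> snd x = snd y" using 2(1) by (auto simp: nbr_iff)
    then have "fst p = real_of_int (fst x) \<or> snd p = real_of_int (snd x)"
      by (auto simp: p pt_def algebra_simps)
    then show ?thesis by blast
  qed
qed

lemma compact_metric_graph:
  assumes "finite A"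
  shows "compact (metric_graph A)"
proof -
  have "{closed_segment (pt x) (pt y) | x y. x \<in> A \<and> y \<in> A \<and> nbr x y} \<subseteq> (\<lambda>(x, y). closed_segment (pt x) (pt y)) ` (A \<times> A)"
    by auto
  then have "finite {closed_segment (pt x) (pt y) | x y. x \<in> A \<and> y \<in> A \<and> nbr x y}"
    by (rule finite_subset) (use assms in simp)
  then have "compact (\<Union>{closed_segment (pt x) (pt y) | x y. x \<in> A \<and> y \<in> A \<and> nbr x y})"
    by (intro compact_Union) auto
  moreover have "compact (pt ` A)" using assms by (intro finite_imp_compact) simp
  ultimately show ?thesis unfolding metric_graph_def by (rule compact_Un[rotated])
qed

context subdivided_grid
begin

lemma adj_sym: "adj p q \<Longrightarrow> adj q p"
  by (auto simp: adj_def)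

lemma adj_in_verts: "adj p q \<Longrightarrow> p \<in> sub_verts N n \<and> q \<in> sub_verts N n"
  using src_in tgt_in by (auto simp: adj_def)

lemma division_point:
  assumes "- (int n * N) \<le> a" "a < int n * N"
  obtains c j where "a = int n * c + int j" "j < n" "- N \<le> c" "c < N"
proof -
  define c j where "c = a div int n" and "j = nat (a mod int n)"
  have j: "int j = a mod int n" "j < n" using n by (auto simp: j_def nat_less_iff)
  have a: "int n * c + int j = a" by (simp add: c_def j)
  have "int n * (- N) < int n * (c + 1)"
    using a j(2) assms by (simp add: algebra_simps)
  moreover have "int n * c < int n * N"
    using a assms(2) by linarith
  ultimately have "- N \<le> c" "c < N" using n by (simp_all only: mult_less_cancel_left_pos of_nat_0_less_iff)
  with a j show thesis by (intro that[of c j]) auto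
qed

lemma adj_node: "e \<in> grid_edges N \<Longrightarrow> j < n \<Longrightarrow> adj (node n e j) (node n e (Suc j))"
  unfolding adj_def unfolding sub_edges_def sub_src_def sub_tgt_def by (intro bexI[of _ "(e, j)"]) auto

lemma adj_horizontal:
  assumes a: "- (int n * N) \<le> a" "a < int n * N" and b: "- N \<le> b" "b \<le> N"
  shows "adj (a, int n * b) (a + 1, int n * b)"
proof -
  obtain c j where c: "a = int n * c + int j" "j < n" "- N \<le> c" "c < N" by (rule division_point[OF a])
  then have "((c, b), (c + 1, b)) \<in> grid_edges N" using b by (auto simp: grid_edges_def image_iff)
  from adj_node[OF this c(2)] show ?thesis by (simp add: node_def c(1) add_ac)
qed

lemma adj_vertical:
  assumes b: "- (int n * N) \<le> b" "b < int n * N" and a: "- N \<le> a" "a \<le> N"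
  shows "adj (int n * a, b) (int n * a, b + 1)"
proof -
  obtain c j where c: "b = int n * c + int j" "j < n" "- N \<le> c" "c < N" by (rule division_point[OF b])
  then have "((a, c), (a, c + 1)) \<in> grid_edges N" using a by (auto simp: grid_edges_def image_iff)
  from adj_node[OF this c(2)] show ?thesis by (simp add: node_def c(1) add_ac)
qed

lemma sub_verts_bound:
  assumes "p \<in> sub_verts N n"
  shows "sup_norm p \<le> int n * N" "int n dvd fst p \<or> int n dvd snd p"
proof -
  obtain e j where e: "e \<in> grid_edges N" "j \<le> n" "p = node n e j" using assms by (auto simp: sub_verts_def)
  have le: "\<bar>int n * a + int j\<bar> \<le> int n * N" if "- N \<le> a" "a < N" for a
  proof -
    have "int n * (- N) \<le> int n * a" "int n * (a + 1) \<le> int n * N" using that by (intro mult_left_mono; simp)+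
    then show ?thesis using e(2) by (simp add: algebra_simps)
  qed
  have le': "\<bar>int n * a\<bar> \<le> int n * N" if "- N \<le> a" "a \<le> N" for a
    using that by (simp add: abs_mult mult_left_mono)
  show "sup_norm p \<le> int n * N"
    using e(1) le le' by (cases rule: grid_edges_cases) (auto simp: e(3) node_def sup_norm_def)
  show "int n dvd fst p \<or> int n dvd snd p"
    using e(1) by (cases rule: grid_edges_cases) (auto simp: e(3) node_def)
qed

lemma adj_neighbour:
  assumes q: "q \<in> sub_verts N n" "sup_norm q < int n * N"
    and q': "int n dvd fst q' \<or> int n dvd snd q'" "\<bar>fst q - fst q'\<bar> + \<bar>snd q - snd q'\<bar> = 1"
  shows "adj q q'"
proof -
  \<comment> \<open>If n did not divide z, it would divide the consecutive integers x and y, hence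
    1, and then z after all.\<close>
  have dvd: "int n dvd z" if "int n dvd x \<or> int n dvd z" "int n dvd y \<or> int n dvd z" "\<bar>x - y\<bar> = 1" for x y z
  proof (rule ccontr)
    assume no: "\<not> int n dvd z"
    then have "int n dvd \<bar>x - y\<bar>" using that(1,2) by (simp add: dvd_diff)
    then show False using no that(3) by auto
  qed
  have dv: "int n dvd snd q" if "snd q = snd q'" "\<bar>fst q - fst q'\<bar> = 1"
    using dvd[OF _ _ that(2)] sub_verts_bound(2)[OF q(1)] q'(1) that(1) by simp
  have dh: "int n dvd fst q" if "fst q = fst q'" "\<bar>snd q - snd q'\<bar> = 1"
    using dvd[OF _ _ that(2)] sub_verts_bound(2)[OF q(1)] q'(1) that(1) by auto
  have bd: "\<bar>fst q\<bar> < int n * N" "\<bar>snd q\<bar> < int n * N" using q(2) by (auto simp: sup_norm_def)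
  have small: "- N \<le> b \<and> b \<le> N" if "\<bar>int n * b\<bar> < int n * N" for b
  proof -
    have "int n * \<bar>b\<bar> < int n * N" using that by (simp add: abs_mult)
    then have "\<bar>b\<bar> < N" using n by (simp add: mult_less_cancel_left)
    then show ?thesis by linarith
  qed
  consider "snd q = snd q'" "fst q' = fst q + 1" | "snd q = snd q'" "fst q = fst q' + 1"
    | "fst q = fst q'" "snd q' = snd q + 1" | "fst q = fst q'" "snd q = snd q' + 1"
    using q'(2) by linarith
  then show ?thesis
  proof cases
    case 1
    then obtain b where b: "snd q = int n * b" using dv by (auto simp: dvd_def)
    have "adj (fst q, int n * b) (fst q + 1, int n * b)"
      using bd b small[of b] by (intro adj_horizontal) auto
    then show ?thesis using 1 b by (metis prod.collapse)
  next
    case 2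
    then obtain b where b: "snd q = int n * b" using dv by (auto simp: dvd_def)
    have "adj (fst q', int n * b) (fst q' + 1, int n * b)"
      using bd b 2 small[of b] by (intro adj_horizontal) auto
    then show ?thesis using 2 b by (metis prod.collapse adj_sym)
  next
    case 3
    then obtain a where a: "fst q = int n * a" using dh by (auto simp: dvd_def)
    have "adj (int n * a, snd q) (int n * a, snd q + 1)"
      using bd a small[of a] by (intro adj_vertical) auto
    then show ?thesis using 3 a by (metis prod.collapse)
  next
    case 4
    then obtain a where a: "fst q = int n * a" using dh by (auto simp: dvd_def)
    have "adj (int n * a, snd q') (int n * a, snd q' + 1)"
      using bd a 4 small[of a] by (intro adj_vertical) auto
    then show ?thesis using 4 a by (metis prod.collapse adj_sym)
  qed
qed

text \<open>If the cluster stopped short of radius n N, the points of \<open>C\<close> near it would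
  form a set both open and closed in \<open>C\<close>, hence all of \<open>C\<close>, including
  \<open>pt x\<close>. Stopping short also keeps its vertices away from the outer edges, which have
  no division points.\<close>

lemma connected_set_reaches:
  assumes C: "connected C" "C \<subseteq> metric_graph A" "(0, 0) \<in> C" and x: "pt x \<in> C" "sup_norm x = N"
    and S: "S = {p \<in> sub_verts N n. P p}"
    and P: "\<And>p. (real_of_int (fst p) / real n, real_of_int (snd p) / real n) \<in> C \<Longrightarrow> P p"
  shows "\<exists>q\<in>cluster (0, 0) S. sup_norm q = int n * N"
proof (rule ccontr)
  assume no: "\<not> ?thesis"
  define Q where "Q = cluster (0, 0) S"
  have QV: "Q \<subseteq> sub_verts N n" using cluster_subset[of "(0, 0)" S] S by (auto simp: Q_def)
  have Qlt: "sup_norm q < int n * N" if "q \<in> Q" for q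
    using no sub_verts_bound(1)[of q] QV that by (force simp: Q_def)
  have finQ: "finite Q" using QV finV by (rule finite_subset)
  \<comment> \<open>In coordinates scaled by n, \<open>U q\<close> is an open box around q and
    \<open>W q\<close> a closed cross with arms of length 1. They give the same trace on
    \<open>C\<close> after the union over the cluster: points of the metric graph have an integer
    coordinate, which puts \<open>U q\<close> inside \<open>W q\<close>.\<close>
  define U where "U q = {p. \<bar>real n * fst p - real_of_int (fst q)\<bar> < 1 \<and> \<bar>real n * snd p - real_of_int (snd q)\<bar> < 1}" for q :: vertex
  define W where "W q = {p. \<bar>real n * fst p - real_of_int (fst q)\<bar> \<le> 1 \<and> real n * snd p = real_of_int (snd q)}
     \<union> {p. real n * fst p = real_of_int (fst q) \<and> \<bar>real n * snd p - real_of_int (snd q)\<bar> \<le> 1}" for q :: vertex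
  have U: "open (U q)" for q
    unfolding U_def by (intro open_Collect_conj open_Collect_less continuous_intros)
  have W: "closed (W q)" for q
    unfolding W_def by (intro closed_Un closed_Collect_conj closed_Collect_le closed_Collect_eq continuous_intros)
  have UW: "C \<inter> U q \<subseteq> W q" for q
  proof
    fix p assume p: "p \<in> C \<inter> U q"
    have int0: "real n * real_of_int a = real_of_int b" if "\<bar>real n * real_of_int a - real_of_int b\<bar> < 1" for a b
    proof -
      have "\<bar>real_of_int (int n * a - b)\<bar> < 1" using that by simp
      then have "\<bar>int n * a - b\<bar> < 1" by linarith
      then have "int n * a = b" by simp
      then show ?thesis by (metis of_int_mult of_int_of_nat_eq)
    qed
    have pU: "\<bar>real n * fst p - real_of_int (fst q)\<bar> < 1" "\<bar>real n * snd p - real_of_int (snd q)\<bar> < 1"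
      using p by (simp_all add: U_def)
    have "(\<exists>a. fst p = real_of_int a) \<or> (\<exists>b. snd p = real_of_int b)"
      using metric_graph_integer_coordinate[of p A] p C(2) by blast
    then have "real n * fst p = real_of_int (fst q) \<or> real n * snd p = real_of_int (snd q)"
      using pU int0 by metis
    then show "p \<in> W q" using pU by (auto simp: W_def)
  qed
  \<comment> \<open>A point of the cross outside the box is the tip of an arm, hence a division
    point in \<open>C\<close> adjacent to q; so it belongs to the cluster and is the centre of
    another box.\<close>
  have WU: "\<exists>q'\<in>Q. p \<in> U q'" if q: "q \<in> Q" and p: "p \<in> C" "p \<in> W q" for p q
  proof (cases "p \<in> U q")
    case False
    have "\<exists>q'. \<bar>fst q - fst q'\<bar> + \<bar>snd q - snd q'\<bar> = 1 \<and> real n * fst p = real_of_int (fst q') \<and> real n * snd p = real_of_int (snd q')"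
    proof -
      have pm: "\<exists>z. \<bar>y - z\<bar> = 1 \<and> x = real_of_int z" if "\<bar>x - real_of_int y\<bar> = 1" for x y
      proof -
        have "x = real_of_int (y + 1) \<or> x = real_of_int (y - 1)" using that by auto
        moreover have "\<bar>y - (y + 1)\<bar> = 1" "\<bar>y - (y - 1)\<bar> = 1" by auto
        ultimately show ?thesis by blast
      qed
      show ?thesis
      proof (cases "real n * snd p = real_of_int (snd q)")
        case True
        then have "\<bar>real n * fst p - real_of_int (fst q)\<bar> = 1" using False p(2) by (auto simp: U_def W_def)
        then obtain z where "\<bar>fst q - z\<bar> = 1 \<and> real n * fst p = real_of_int z" using pm by blast
        then show ?thesis using True by (intro exI[of _ "(z, snd q)"]) simp
      next
        case False2: False
        then have f: "real n * fst p = real_of_int (fst q)" using p(2) by (auto simp: W_def)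
        then have "\<bar>real n * snd p - real_of_int (snd q)\<bar> = 1" using False p(2) by (auto simp: U_def W_def)
        then obtain z where "\<bar>snd q - z\<bar> = 1 \<and> real n * snd p = real_of_int z" using pm by blast
        then show ?thesis using f by (intro exI[of _ "(fst q, z)"]) simp
      qed
    qed
    then obtain q' where q': "\<bar>fst q - fst q'\<bar> + \<bar>snd q - snd q'\<bar> = 1" "real n * fst p = real_of_int (fst q')" "real n * snd p = real_of_int (snd q')"
      by blast
    have "int n dvd fst q' \<or> int n dvd snd q'"
    proof -
      have dv: "int n dvd b" if "real n * real_of_int a = real_of_int b" for a b
        using that by (metis dvd_triv_left of_int_eq_iff of_int_mult of_int_of_nat_eq)
      show ?thesis
        using metric_graph_integer_coordinate[of p A] p(1) C(2) q'(2,3) dv by (metis subsetD)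
    qed
    then have "adj q q'" using QV q Qlt[OF q] q'(1) by (intro adj_neighbour) auto
    moreover have "p = (real_of_int (fst q') / real n, real_of_int (snd q') / real n)"
      using q'(2,3) n by (cases p) (simp add: field_simps)
    then have "P q'" using P p(1) by simp
    ultimately have "q' \<in> Q"
      using cluster_step[of q "(0, 0)" S q'] q adj_in_verts[of q q'] by (auto simp: Q_def S)
    moreover have "p \<in> U q'" using q' by (simp add: U_def)
    ultimately show ?thesis by blast
  qed (use q in blast)
  define F where "F = C \<inter> (\<Union>q\<in>Q. U q)"
  have F: "F = C \<inter> (\<Union>q\<in>Q. W q)" using UW WU by (fastforce simp: F_def)
  have "openin (top_of_set C) F" unfolding F_def using U by (intro openin_open_Int open_UN) auto
  moreover have "closedin (top_of_set C) F" unfolding F using W finQ by (intro closedin_closed_Int closed_UN) auto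
  ultimately have "F = {} \<or> F = C" using C(1) by (simp add: connected_clopen)
  moreover have "(0, 0) \<in> F"
  proof -
    have "(0, 0) \<in> sub_verts N n" using dilate_in_sub_verts[OF N, of "(0, 0)"] N by (simp add: dilate_def square_def)
    moreover have "P (0, 0)" using P[of "(0, 0)"] C(3) by simp
    ultimately have "(0, 0) \<in> Q" unfolding Q_def by (intro cluster_self) (simp add: S)
    then show ?thesis using C(3) by (force simp: F_def U_def)
  qed
  ultimately have "pt x \<in> F" using x by auto
  then obtain q where q: "q \<in> Q" "pt x \<in> U q" by (auto simp: F_def)
  have "fst q = int n * fst x" "snd q = int n * snd x"
  proof -
    have "\<bar>real_of_int (int n * fst x - fst q)\<bar> < 1" "\<bar>real_of_int (int n * snd x - snd q)\<bar> < 1"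
      using q(2) by (simp_all add: U_def pt_def)
    then show "fst q = int n * fst x" "snd q = int n * snd x" by linarith+
  qed
  then have "sup_norm q = int n * N" 
    unfolding x(2)[symmetric] using n by (simp add: sup_norm_def abs_mult max_mult_distrib_left)
  then show False using Qlt[OF q(1)] by simp
qed

text \<open>The right side does not involve n, so n can tend to infinity while \<epsilon> is
  fixed.\<close>

lemma total_eq: "total = (\<Sum>x\<in>square N. sides N x / 4)"
proof -
  have "total = energy (\<lambda>_. 1) (\<lambda>_. 1)" by (simp add: energy_def total_def)
  also have "\<dots> = (\<Sum>x\<in>square N. sides N x / 4)" by (simp add: energy_sum edge_form_def vals_def)
  finally show ?thesis .
qed

end

section \<open>The connection probability\<close>

lemma (in prob_space) normal_slab:
  assumes cn: "centred_normal M Y" and g: "0 < g" "g \<le> (\<integral>\<omega>. (Y \<omega>)\<^sup>2 \<partial>M)" and s: "0 \<le> s"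
  shows "prob {\<omega> \<in> space M. 0 \<le> Y \<omega> \<and> Y \<omega> < s} \<le> s / sqrt (2 * pi * g)"
proof -
  define \<sigma> where "\<sigma> = sqrt (\<integral>\<omega>. (Y \<omega>)\<^sup>2 \<partial>M)"
  have \<sigma>: "0 < \<sigma>" "\<sigma>\<^sup>2 = (\<integral>\<omega>. (Y \<omega>)\<^sup>2 \<partial>M)" using g by (simp_all add: \<sigma>_def)
  have [measurable]: "Y \<in> borel_measurable M" by (rule centred_normal_measurable[OF cn])
  have d: "distr M borel Y = density lborel (\<lambda>x. ennreal (normal_density 0 \<sigma> x))"
    using centred_normal_law[OF cn] \<sigma> by (simp add: \<sigma>_def[symmetric] normal_law_def)
  have bound: "normal_density 0 \<sigma> x \<le> 1 / sqrt (2 * pi * g)" for x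
  proof -
    have "normal_density 0 \<sigma> x \<le> 1 / sqrt (2 * pi * \<sigma>\<^sup>2)"
      unfolding normal_density_def by (intro mult_left_le) auto
    also have "\<dots> \<le> 1 / sqrt (2 * pi * g)"
      using g \<sigma> by (intro divide_left_mono) auto
    finally show ?thesis .
  qed
  have "emeasure M {\<omega> \<in> space M. 0 \<le> Y \<omega> \<and> Y \<omega> < s} = emeasure (distr M borel Y) {0..<s}"
    by (subst emeasure_distr) (auto intro!: arg_cong[where f = "emeasure M"])
  also have "\<dots> = (\<integral>\<^sup>+x. ennreal (normal_density 0 \<sigma> x) * indicator {0..<s} x \<partial>lborel)"
    unfolding d by (subst emeasure_density) auto
  also have "\<dots> \<le> (\<integral>\<^sup>+x. ennreal (1 / sqrt (2 * pi * g)) * indicator {0..<s} x \<partial>lborel)"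
    using bound by (intro nn_integral_mono mult_right_mono ennreal_leI) auto
  also have "\<dots> = ennreal (1 / sqrt (2 * pi * g)) * ennreal s"
    using s by (simp add: nn_integral_cmult)
  also have "\<dots> = ennreal (s / sqrt (2 * pi * g))"
    using s g by (subst ennreal_mult[symmetric]) auto
  finally show ?thesis
    using s g by (simp add: emeasure_eq_measure)
qed

context mgff
begin

lemma origin_in_verts: "(0, 0) \<in> verts"
  using dilate_in_sub_verts[OF N, of "(0, 0)"] K by (simp add: dilate_def square_def)

lemma node_in_metric_graph:
  assumes "p \<in> verts"
  shows "(real_of_int (fst p) / real n, real_of_int (snd p) / real n) \<in> metric_graph (sq)"
proof -
  obtain e j where e: "e \<in> edges" "j \<le> n" "p = node n e j" using assms by (auto simp: sub_verts_def)
  obtain x y where xy: "e = (x, y)" by (cases e)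
  have sq: "x \<in> sq" "y \<in> sq" using grid_edges_square e xy by auto
  have "nbr x y" using e(1) edges_free by (auto simp: xy free_edges_def)
  have "(real_of_int (fst p) / real n, real_of_int (snd p) / real n) = (1 - real j / real n) *\<^sub>R pt x + (real j / real n) *\<^sub>R pt y"
    using n0 by (simp add: e(3) node_def xy pt_def field_simps)
  also have "\<dots> \<in> closed_segment (pt x) (pt y)"
    unfolding closed_segment_def using e(2) n0 by (auto intro!: exI[of _ "real j / real n"])
  finally show ?thesis
    unfolding metric_graph_def using sq \<open>nbr x y\<close> by blast
qed

lemma connected_above_imp_cluster:
  assumes "connected_above K (\<lambda>p. \<phi> p \<omega>) h {pt (0, 0)} (pt ` inner_boundary (B (real K)))"
  shows "cluster (0, 0) (level h \<omega>) \<inter> {p. sup_norm p = int n * int K} \<noteq> {}"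
proof -
  obtain C where C: "C \<in> components {p \<in> metric_graph (B (real K + 1)). h \<le> \<phi> p \<omega>}"
    and "C \<inter> {pt (0, 0)} \<noteq> {}" "C \<inter> pt ` inner_boundary (B (real K)) \<noteq> {}"
    using assms by (auto simp: connected_above_def add.commute)
  then obtain x where x: "pt x \<in> C" "x \<in> inner_boundary (sq)" and o: "(0, 0) \<in> C"
    by (auto simp: B_K pt_def zero_prod_def)
  have Csub: "C \<subseteq> {p \<in> metric_graph (B (real K + 1)). h \<le> \<phi> p \<omega>}" "connected C"
    using in_components_subset[OF C] in_components_connected[OF C] by auto
  have "\<exists>q\<in>cluster (0, 0) (level h \<omega>). sup_norm q = int n * int K"
  proof (rule connected_set_reaches)
    show "connected C" "C \<subseteq> metric_graph (B (real K + 1))" "(0, 0) \<in> C" "pt x \<in> C" using Csub o x by auto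
    show "sup_norm x = int K" using x by (simp add: inner_boundary_square)
    show "level h \<omega> = {p \<in> verts. h \<le> X p \<omega>}" by (simp add: level_def)
    show "h \<le> X p \<omega>" if "(real_of_int (fst p) / real n, real_of_int (snd p) / real n) \<in> C" for p
      using that Csub by (auto simp: X_def)
  qed
  then show ?thesis by auto
qed

lemma jump_subset:
  assumes \<omega>: "\<omega> \<in> space M" and d: "0 < d" "1 / real n < d"
    and u: "\<And>p q. p \<in> metric_graph (sq) \<Longrightarrow> q \<in> metric_graph (sq) \<Longrightarrow> dist p q < d \<Longrightarrow> \<bar>\<phi> p \<omega> - \<phi> q \<omega>\<bar> \<le> \<epsilon>"
  shows "\<omega> \<notin> jump \<epsilon>"
proof
  assume "\<omega> \<in> jump \<epsilon>"
  then obtain e where e: "e \<in> sub_edges (int K) n" "\<epsilon> < \<bar>X (sub_src n e) \<omega> - X (sub_tgt n e) \<omega>\<bar>"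
    by (auto simp: jump_def)
  let ?p = "sub_src n e" and ?q = "sub_tgt n e"
  have "adj ?p ?q" using e(1) by (auto simp: adj_def)
  from adj_cases(2)[OF this] have 1: "\<bar>fst ?p - fst ?q\<bar> + \<bar>snd ?p - snd ?q\<bar> = 1" .
  have "dist (real_of_int (fst ?p) / real n, real_of_int (snd ?p) / real n) (real_of_int (fst ?q) / real n, real_of_int (snd ?q) / real n)
    \<le> \<bar>real_of_int (fst ?p) / real n - real_of_int (fst ?q) / real n\<bar> + \<bar>real_of_int (snd ?p) / real n - real_of_int (snd ?q) / real n\<bar>"
    unfolding dist_prod_def dist_real_def fst_conv snd_conv power2_abs by (rule sqrt_sum_squares_le_sum_abs)
  also have "\<dots> = real_of_int (\<bar>fst ?p - fst ?q\<bar> + \<bar>snd ?p - snd ?q\<bar>) / real n"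
    using n0 by (simp add: diff_divide_distrib[symmetric] add_divide_distrib)
  also have "\<dots> < d" using 1 d by simp
  finally have "\<bar>X ?p \<omega> - X ?q \<omega>\<bar> \<le> \<epsilon>"
    unfolding X_def using src_in[OF e(1)] tgt_in[OF e(1)] by (intro u node_in_metric_graph)
  then show False using e(2) by simp
qed

text \<open>Without interior division points the energy of \<open>radial\<close> equals its value r
  at the origin, so \<open>variance_lower\<close> gives 2 r - r = r.\<close>

lemma variance_origin:
  assumes "2 \<le> K"
  shows "ln (real K) / 2 \<le> (\<integral>\<omega>. (\<phi> (0, 0) \<omega>)\<^sup>2 \<partial>M)"
proof -
  interpret one: mgff K M \<phi> 1 using K gff by unfold_locales auto
  have "one.energy (radial (int K)) (radial (int K)) = radial (int K) (0, 0)"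
    by (rule one.radial_energy_n1) simp
  with one.variance_lower[OF one.origin_in_verts, of "radial (int K)"]
  have "radial (int K) (0, 0) \<le> (\<integral>\<omega>. (\<phi> (0, 0) \<omega>)\<^sup>2 \<partial>M)" unfolding one.X_def by simp
  moreover have "ln (real K) / 2 \<le> radial (int K) (0, 0)" using radial_0_lower[of "int K"] K by simp
  ultimately show ?thesis by simp
qed

end

text \<open>Each sample path is uniformly continuous on the compact metric graph, so it has no jump
  larger than \<epsilon> once 1 / n is small; dominated convergence does the rest.
  \<open>Suc m\<close> keeps the number of parts positive.\<close>

lemma jump_tendsto:
  assumes K: "1 \<le> K" and gff: "metric_graph_gff K M \<phi>" and \<epsilon>: "0 < \<epsilon>"
  shows "(\<lambda>m. measure M (gaussian_network.jump (sub_edges (int K) (Suc m)) (sub_src (Suc m)) (sub_tgt (Suc m)) M (mgff.X \<phi> (Suc m)) \<epsilon>)) \<longlonglongrightarrow> 0"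
proof -
  interpret m: mgff K M \<phi> "Suc m" for m using K gff by unfold_locales auto
  have "(\<lambda>m. \<integral>\<omega>. indicat_real (m.jump m \<epsilon>) \<omega> \<partial>M) \<longlonglongrightarrow> (\<integral>\<omega>. 0 \<partial>M)"
  proof (rule integral_dominated_convergence[where w = "\<lambda>_. 1"])
    show "indicat_real (m.jump m \<epsilon>) \<in> borel_measurable M" for m
      using m.jump_measurable by (intro borel_measurable_indicator)
    show "AE \<omega> in M. (\<lambda>m. indicat_real (m.jump m \<epsilon>) \<omega>) \<longlonglongrightarrow> 0"
    proof (rule AE_I2)
      fix \<omega> assume \<omega>: "\<omega> \<in> space M"
      let ?G = "metric_graph (square (int K))"
      have "square (int K) \<subseteq> B (1 + real K)" by (auto simp: m.B_K1 square_def)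
      then have "?G \<subseteq> metric_graph (B (1 + real K))" unfolding metric_graph_def by blast
      then have "continuous_on ?G (\<lambda>p. \<phi> p \<omega>)"
        using gff \<omega> by (auto simp: metric_graph_gff_def intro: continuous_on_subset)
      moreover have "compact ?G" by (rule compact_metric_graph) (simp add: square_def)
      ultimately have "uniformly_continuous_on ?G (\<lambda>p. \<phi> p \<omega>)" by (rule compact_uniformly_continuous)
      then obtain d where d: "0 < d" "\<And>p q. p \<in> ?G \<Longrightarrow> q \<in> ?G \<Longrightarrow> dist p q < d \<Longrightarrow> \<bar>\<phi> p \<omega> - \<phi> q \<omega>\<bar> \<le> \<epsilon>"
        using \<epsilon> unfolding uniformly_continuous_on_def dist_real_def by (metis less_imp_le abs_minus_commute dist_commute)
      have "eventually (\<lambda>m. 1 / real (Suc m) < d) sequentially"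
        using LIMSEQ_inverse_real_of_nat d(1) by (simp add: order_tendstoD(2) divide_inverse)
      then have "eventually (\<lambda>m. indicat_real (m.jump m \<epsilon>) \<omega> = 0) sequentially"
        by eventually_elim (use m.jump_subset[OF \<omega> d(1) _ d(2)] in \<open>auto simp: indicator_def\<close>)
      then show "(\<lambda>m. indicat_real (m.jump m \<epsilon>) \<omega>) \<longlonglongrightarrow> 0" by (rule tendsto_eventually)
    qed
  qed (auto simp: indicator_def m.prob_space)
  moreover have "(\<integral>\<omega>. indicat_real (m.jump m \<epsilon>) \<omega> \<partial>M) = measure M (m.jump m \<epsilon>)" for m
    using m.jump_measurable[of m \<epsilon>] sets.sets_into_space by (simp add: Int_absorb2)
  ultimately show ?thesis by simp
qed

lemma connection_bound:
  fixes \<phi> :: "real \<times> real \<Rightarrow> 'w \<Rightarrow> real"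
  assumes K: "2 \<le> K" and gff: "metric_graph_gff K M \<phi>" and h: "0 \<le> h"
  shows "measure M {\<omega> \<in> space M. connected_above K (\<lambda>p. \<phi> p \<omega>) h {pt (0, 0)} (pt ` inner_boundary (B (real K)))}
    \<le> sqrt (40 / pi) / (1 - exp (- 1 / 2)) * inverse (ln (real K)) * real K powr (- (1 / 80) * h\<^sup>2)"
proof -
  have ps: "prob_space M" using gff by (simp add: metric_graph_gff_def)
  let ?E = "{\<omega> \<in> space M. connected_above K (\<lambda>p. \<phi> p \<omega>) h {pt (0, 0)} (pt ` inner_boundary (B (real K)))}"
  have lnK: "0 < ln (real K)" using K by simp
  define \<tau> where "\<tau> = ln (real K) / 40"
  define s where "s = 1 / sqrt \<tau>"
  define T where "T = (\<Sum>x\<in>square (int K). sides (int K) x / 4)"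
  define slab where "slab = measure M {\<omega> \<in> space M. 0 \<le> \<phi> (0, 0) \<omega> \<and> \<phi> (0, 0) \<omega> < s}"
  have \<tau>: "0 < \<tau>" using lnK by (simp add: \<tau>_def)
  have s: "0 < s" "s\<^sup>2 * \<tau> = 1" using \<tau> by (simp_all add: s_def power_divide)
  define a where "a \<epsilon> = exp (h * \<epsilon> * T - h\<^sup>2 * \<tau> / 2)" for \<epsilon>
  define r where "r \<epsilon> = slab + (exp (s * \<epsilon> * T) - 1)" for \<epsilon>
  have step: "measure M ?E * (1 - exp (s * \<epsilon> * T - 1 / 2)) \<le> a \<epsilon> * r \<epsilon>"
    if \<epsilon>: "0 < \<epsilon>" and small: "s * \<epsilon> * T \<le> 1 / 2" for \<epsilon>
  proof -
    define k where "k = 1 - exp (s * \<epsilon> * T - 1 / 2)"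
    \<comment> \<open>Nonnegativity, from \<open>small\<close>, allows multiplication of
      inequalities by k; the bound by 1 keeps the jump term from growing.\<close>
    have k: "0 \<le> k" "k \<le> 1" using small by (simp_all add: k_def)
    define J where "J m = measure M (gaussian_network.jump (sub_edges (int K) (Suc m)) (sub_src (Suc m)) (sub_tgt (Suc m)) M (mgff.X \<phi> (Suc m)) \<epsilon>)" for m
    have J: "J \<longlonglongrightarrow> 0" unfolding J_def using jump_tendsto[OF _ gff \<epsilon>] K by simp
    have "measure M ?E * k \<le> a \<epsilon> * (r \<epsilon> + 2 * J m) + J m" for m
    proof -
      interpret m: mgff K M \<phi> "Suc m" using K gff by unfold_locales auto
      let ?T = "{p. sup_norm p = int (Suc m) * int K}"
      let ?A = "\<lambda>h. measure M {\<omega> \<in> space M. m.cluster (0, 0) (m.level h \<omega>) \<inter> ?T \<noteq> {}}"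
      have cap: "\<tau> \<le> m.energy f f" if "S \<subseteq> sub_verts (int K) (Suc m)" "(0, 0) \<in> S" "m.cluster (0, 0) S \<inter> ?T \<noteq> {}" "\<And>p. p \<in> m.cluster (0, 0) S \<Longrightarrow> f p = 1" for S f
        using m.capacity_lower[of S _ f] that unfolding \<tau>_def by auto
      have total: "m.total = T" by (simp add: m.total_eq T_def)
      have X0: "m.X (0, 0) = \<phi> (0, 0)" by (simp add: m.X_def)
      have 1: "?A h \<le> a \<epsilon> * ?A 0 + J m"
        unfolding J_def a_def total[symmetric]
        by (rule m.connection_bounds(1)[OF m.origin_in_verts less_imp_le[OF \<epsilon>] _ h]) (rule cap)
      have "?A 0 * (1 - exp (s * \<epsilon> * T - s\<^sup>2 * \<tau> / 2)) \<le> r \<epsilon> + 2 * J m"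
        unfolding J_def r_def slab_def total[symmetric] X0[symmetric]
        by (rule m.connection_bounds(2)[OF m.origin_in_verts less_imp_le[OF \<epsilon>] _ less_imp_le[OF s(1)]]) (rule cap)
      then have 2: "?A 0 * k \<le> r \<epsilon> + 2 * J m"
        using s(2) by (simp add: k_def)
      \<comment> \<open>Monotonicity asks for measurability of the larger, discrete event, and this
        follows from the finite number of level sets.\<close>
      have "measure M ?E \<le> ?A h"
      proof (rule m.finite_measure_mono)
        show "?E \<subseteq> {\<omega> \<in> space M. m.cluster (0, 0) (m.level h \<omega>) \<inter> ?T \<noteq> {}}"
          using m.connected_above_imp_cluster by blast
        show "{\<omega> \<in> space M. m.cluster (0, 0) (m.level h \<omega>) \<inter> ?T \<noteq> {}} \<in> sets M"
          by (rule m.level_measurable)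
      qed
      then have "measure M ?E * k \<le> ?A h * k" using k by (intro mult_right_mono) auto
      also have "\<dots> \<le> (a \<epsilon> * ?A 0 + J m) * k" using 1 k by (intro mult_right_mono) auto
      also have "\<dots> = a \<epsilon> * (?A 0 * k) + J m * k" by (simp add: algebra_simps)
      also have "\<dots> \<le> a \<epsilon> * (r \<epsilon> + 2 * J m) + J m"
        using 2 k by (intro add_mono mult_left_mono mult_left_le) (auto simp: J_def a_def)
      finally show ?thesis .
    qed
    moreover have "(\<lambda>m. a \<epsilon> * (r \<epsilon> + 2 * J m) + J m) 
        \<longlonglongrightarrow> a \<epsilon> * (r \<epsilon> + 2 * 0) + 0"
      by (intro tendsto_intros J)
    ultimately show ?thesis unfolding k_def by (intro LIMSEQ_le_const) auto
  qed
  \<comment> \<open>The limit in n is already contained in \<open>step\<close>; here \<epsilon>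
    decreases to 0.\<close>
  have lim: "measure M ?E * (1 - exp (s * 0 * T - 1 / 2)) \<le> a 0 * r 0"
  proof (rule tendsto_le)
    show "((\<lambda>\<epsilon>. a \<epsilon> * r \<epsilon>) \<longlongrightarrow> a 0 * r 0) (at_right 0)"
      unfolding a_def r_def by (intro tendsto_intros)
    show "((\<lambda>\<epsilon>. measure M ?E * (1 - exp (s * \<epsilon> * T - 1 / 2))) \<longlongrightarrow> measure M ?E * (1 - exp (s * 0 * T - 1 / 2))) (at_right 0)"
      by (intro tendsto_intros)
    have "((\<lambda>\<epsilon>. s * \<epsilon> * T) \<longlongrightarrow> s * 0 * T) (at_right 0)" by (intro tendsto_intros)
    then have "eventually (\<lambda>\<epsilon>. s * \<epsilon> * T < 1 / 2) (at_right 0)" by (rule order_tendstoD) simp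
    then show "eventually (\<lambda>\<epsilon>. measure M ?E * (1 - exp (s * \<epsilon> * T - 1 / 2)) \<le> a \<epsilon> * r \<epsilon>) (at_right 0)"
      using eventually_at_right_less[of 0] by eventually_elim (rule step; simp)
  qed simp
  have "slab \<le> s / sqrt (2 * pi * (ln (real K) / 2))"
    unfolding slab_def
  proof (rule prob_space.normal_slab[OF ps])
    interpret m: mgff K M \<phi> 1 using K gff by unfold_locales auto
    have "m.X (0, 0) = \<phi> (0, 0)" unfolding m.X_def by simp
    then show "centred_normal M (\<phi> (0, 0))"
      using centred_gaussian_field_single[OF m.X m.origin_in_verts] by simp
    show "ln (real K) / 2 \<le> (\<integral>\<omega>. (\<phi> (0, 0) \<omega>)\<^sup>2 \<partial>M)" by (rule m.variance_origin[OF K])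
  qed (use lnK s in auto)
  \<comment> \<open>Here s = sqrt(40 / ln K), and the variance bound ln K / 2 makes the denominator
    sqrt(pi ln K).\<close>
  also have "\<dots> = sqrt (40 / pi) * inverse (ln (real K))"
  proof -
    have "sqrt (40 / pi) * inverse (ln (real K)) = sqrt (40 / pi) / sqrt (ln (real K) * ln (real K))" using lnK by (simp add: divide_inverse)
    also have "\<dots> = s / sqrt (2 * pi * (ln (real K) / 2))"
      using lnK unfolding s_def \<tau>_def by (simp add: real_sqrt_divide real_sqrt_mult)
    finally show ?thesis by simp
  qed
  finally have slab: "slab \<le> sqrt (40 / pi) * inverse (ln (real K))" .
  define c where "c = 1 - exp (- 1 / 2 :: real)"
  have c: "0 < c" by (simp add: c_def)
  have "measure M ?E * c \<le> exp (- (h\<^sup>2 * \<tau> / 2)) * slab" using lim by (simp add: c_def a_def r_def)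
  also have "\<dots> \<le> exp (- (h\<^sup>2 * \<tau> / 2)) * (sqrt (40 / pi) * inverse (ln (real K)))"
    using slab by (intro mult_left_mono) auto
  \<comment> \<open>With \<tau> = ln K / 40 the exponent is -h^2 ln K / 80, which fixes c =
    1/80.\<close>
  also have "exp (- (h\<^sup>2 * \<tau> / 2)) = real K powr (- (1 / 80) * h\<^sup>2)"
    using K by (simp add: powr_def \<tau>_def)
  finally have "measure M ?E \<le> real K powr (- (1 / 80) * h\<^sup>2) * (sqrt (40 / pi) * inverse (ln (real K))) / c"
    using c by (simp add: pos_le_divide_eq)
  then show ?thesis unfolding c_def by (simp add: mult.commute mult.left_commute)
qed

theorem proposition1p2:
  "\<exists>c>0. \<exists>C::real. \<forall>h\<ge>0. \<forall>N\<ge>2. \<forall>(M :: sample measure) (\<phi> :: real \<times> real \<Rightarrow> sample \<Rightarrow> real).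
     metric_graph_gff N M \<phi> \<longrightarrow>
     measure M {\<omega> \<in> space M.
         connected_above N (\<lambda>p. \<phi> p \<omega>) h {pt (0, 0)} (pt ` inner_boundary (B (real N)))}
       \<le> C * inverse (ln (real N)) * real N powr (- c * h\<^sup>2)"
proof (rule exI[of _ "1 / 80"], rule conjI, simp, rule exI[of _ "sqrt (40 / pi) / (1 - exp (- 1 / 2))"], intro allI impI)
  fix h :: real and N :: nat and M :: "sample measure" and \<phi> :: "real \<times> real \<Rightarrow> sample \<Rightarrow> real"
  assume "0 \<le> h" "2 \<le> N" "metric_graph_gff N M \<phi>"
  then show "measure M {\<omega> \<in> space M.
         connected_above N (\<lambda>p. \<phi> p \<omega>) h {pt (0, 0)} (pt ` inner_boundary (B (real N)))}
       \<le> sqrt (40 / pi) / (1 - exp (- 1 / 2)) * inverse (ln (real N)) * real N powr (- (1 / 80) * h\<^sup>2)"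
    by (intro connection_bound)
qed

end
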